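(* Assume $K<\infty$. Equip $L^1(a,b)$ with the strong topology and $\mathcal M(a,b)$ with the topology of the flat norm. Then the family $\{E_\varepsilon\}_{\varepsilon>0}$ $\Gamma$-converges to $E$ on $L^1(a,b)\times\mathcal M(a,b)$ as $\varepsilon\to0$, i.e.: (i) for every $(u,\gamma)\in L^1(a,b)\times\mathcal M(a,b)$ and every family $(u_\varepsilon,\gamma_\varepsilon)\in L^1(a,b)\times\mathcal M(a,b)$ with $u_\varepsilon\to u$ in $L^1(a,b)$ and $\|\gamma_\varepsilon-\gamma\|_{\rm flat}\to0$, one has $\liminf_{\varepsilon\to0}E_\varepsilon(u_\varepsilon,\gamma_\varepsilon)\ge E(u,\gamma)$; (ii) for every $(u,\gamma)\in L^1(a,b)\times\mathcal M(a,b)$ there exist $(u_\varepsilon,\gamma_\varepsilon)\in L^1(a,b)\times\mathcal M(a,b)$ with $u_\varepsilon\to u$ in $L^1(a,b)$, $\|\gamma_\varepsilon-\gamma\|_{\rm flat}\to0$ and $\limsup_{\varepsilon\to0}E_\varepsilon(u_\varepsilon,\gamma_\varepsilon)\le E(u,\gamma)$.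
   Context: Fix $0<a<b<\infty$, $c_0>0$ and $K\in(0,\infty)$. Let $f:[0,\infty)\to[0,\infty)$, $f(t)=c_0t$ for $t<1$ and $f(t)=c_0$ for $t\ge1$. For $\varepsilon>0$ and $x\in\mathbb R$ put $I_\varepsilon(x)=(x-\varepsilon,x+\varepsilon)$, and write $\fint_B h=\frac{1}{|B|}\int_B h$. $\mathcal M(a,b)$ is the space of finite (signed) Radon measures on $(a,b)$, with flat norm $\|\mu\|_{\rm flat}=\sup\{\int_a^b\varphi\,d\mu:\varphi\in W^{1,\infty}_0(a,b),\ \|\varphi\|_{W^{1,\infty}(a,b)}\le1\}$. For $u\in BV(a,b)$ write $Du=u'\mathcal L^1+D^su$ and $D^su=[u]\,\mathcal H^0\llcorner J_u+D^cu$, where $u'$ is the approximate derivative, $J_u$ the jump set, $[u](x)=u(x+)-u(x-)$, and $D^cu$ the Cantor part. For $(u,\gamma)\in L^1(a,b)\times\mathcal M(a,b)$ define $E_\varepsilon(u,\gamma)=\int_a^b|u'-g|^2\,dx+\frac1\varepsilon\int_a^b f\Big(\varepsilon\fint_{I_\varepsilon(x)\cap(a,b)}|g|\,dt\Big)dx$ if $u\in W^{1,1}(a,b)$, $\|u\|_{L^\infty}\le K$, $\gamma=g\mathcal L^1$ with $g\in L^1(a,b)$ and $u'-g\in L^2(a,b)$; and $E_\varepsilon(u,\gamma)=+\infty$ otherwise. Define $E(u,\gamma)=\int_a^b|u'-g|^2dx+c_0\int_a^b|g|dx+2\sum_{x\in J_u}f\big(\tfrac12|[u](x)|\big)+c_0|D^cu|(a,b)$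 if $u\in BV(a,b)$, $\|u\|_{L^\infty}\le K$, $\gamma=D^su+g\mathcal L^1$ with $g\in L^1(a,b)$ and $u'-g\in L^2(a,b)$; and $E(u,\gamma)=+\infty$ otherwise. *)

theory Defs
  imports "HOL-Analysis.Analysis"
begin

definition fcap :: "real \<Rightarrow> real \<Rightarrow> real" where
  "fcap c0 t = (if t < 1 then c0 * t else c0)"

definition L1 :: "real \<Rightarrow> real \<Rightarrow> (real \<Rightarrow> real) \<Rightarrow> bool" where
  "L1 a b u \<longleftrightarrow> set_integrable lborel {a<..<b} u"

definition ess_bdd :: "real \<Rightarrow> real \<Rightarrow> real \<Rightarrow> (real \<Rightarrow> real) \<Rightarrow> bool" where
  "ess_bdd a b K u \<longleftrightarrow> (AE x in lborel. x \<in> {a<..<b} \<longrightarrow> \<bar>u x\<bar> \<le> K)"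

text \<open>Finite signed Radon measures on (a,b) are represented as differences of two finite
  Borel measures on the real line concentrated on (a,b) (Jordan decomposition); every
  notion below only depends on the difference.\<close>
type_synonym smeasure = "real measure \<times> real measure"

definition fin_meas_on :: "real \<Rightarrow> real \<Rightarrow> real measure \<Rightarrow> bool" where
  "fin_meas_on a b M \<longleftrightarrow> sets M = sets borel \<and> emeasure M UNIV \<noteq> \<infinity>
       \<and> emeasure M (UNIV - {a<..<b}) = 0"

definition smeas :: "real \<Rightarrow> real \<Rightarrow> smeasure \<Rightarrow> bool" where
  "smeas a b \<gamma> \<longleftrightarrow> fin_meas_on a b (fst \<gamma>) \<and> fin_meas_on a b (snd \<gamma>)"

definition sval :: "smeasure \<Rightarrow> real set \<Rightarrow> real" where
  "sval \<gamma> A = measure (fst \<gamma>) A - measure (snd \<gamma>) A"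

definition sint :: "smeasure \<Rightarrow> (real \<Rightarrow> real) \<Rightarrow> real" where
  "sint \<gamma> \<phi> = (\<integral>x. \<phi> x \<partial>(fst \<gamma>)) - (\<integral>x. \<phi> x \<partial>(snd \<gamma>))"

definition tvar :: "(real set \<Rightarrow> real) \<Rightarrow> real set \<Rightarrow> ennreal" where
  "tvar \<nu> \<Omega> = (SUP A \<in> {A :: nat \<Rightarrow> real set. disjoint_family A \<and>
        (\<forall>n. A n \<in> sets borel \<and> A n \<subseteq> \<Omega>)}. (\<Sum>n. ennreal \<bar>\<nu> (A n)\<bar>))"

text \<open>Test functions of W^{1,\<infinity>}_0(a,b) with W^{1,\<infinity>} norm
  max(||phi||_\<infinity>, ||phi'||_\<infinity>) \<le> 1, extended by zero outside (a,b)
  (the zero extension is again 1-Lipschitz).\<close>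
definition flat_test :: "real \<Rightarrow> real \<Rightarrow> (real \<Rightarrow> real) \<Rightarrow> bool" where
  "flat_test a b \<phi> \<longleftrightarrow> (\<forall>x. \<bar>\<phi> x\<bar> \<le> 1) \<and> (\<forall>x y. \<bar>\<phi> x - \<phi> y\<bar> \<le> \<bar>x - y\<bar>)
        \<and> (\<forall>x. x \<notin> {a<..<b} \<longrightarrow> \<phi> x = 0)"

definition flat_dist :: "real \<Rightarrow> real \<Rightarrow> smeasure \<Rightarrow> smeasure \<Rightarrow> real" where
  "flat_dist a b \<gamma>1 \<gamma>2 = Sup {sint \<gamma>1 \<phi> - sint \<gamma>2 \<phi> | \<phi>. flat_test a b \<phi>}"

definition test_fun :: "real \<Rightarrow> real \<Rightarrow> (real \<Rightarrow> real) \<Rightarrow> bool" where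
  "test_fun a b \<phi> \<longleftrightarrow> (\<forall>n x. ((deriv ^^ n) \<phi>) field_differentiable (at x))
       \<and> (\<exists>c d. a < c \<and> c \<le> d \<and> d < b \<and> (\<forall>x. x \<notin> {c..d} \<longrightarrow> \<phi> x = 0))"

definition weak_deriv :: "real \<Rightarrow> real \<Rightarrow> (real \<Rightarrow> real) \<Rightarrow> (real \<Rightarrow> real) \<Rightarrow> bool" where
  "weak_deriv a b u v \<longleftrightarrow> L1 a b u \<and> L1 a b v \<and>
     (\<forall>\<phi>. test_fun a b \<phi> \<longrightarrow>
        (\<integral>x\<in>{a<..<b}. u x * deriv \<phi> x \<partial>lborel) = - (\<integral>x\<in>{a<..<b}. v x * \<phi> x \<partial>lborel))"

definition meas_deriv :: "real \<Rightarrow> real \<Rightarrow> (real \<Rightarrow> real) \<Rightarrow> smeasure \<Rightarrow> bool" where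
  "meas_deriv a b u Du \<longleftrightarrow> L1 a b u \<and> smeas a b Du \<and>
     (\<forall>\<phi>. test_fun a b \<phi> \<longrightarrow>
        (\<integral>x\<in>{a<..<b}. u x * deriv \<phi> x \<partial>lborel) = - sint Du \<phi>)"

definition BV_decomp :: "real \<Rightarrow> real \<Rightarrow> (real \<Rightarrow> real) \<Rightarrow> smeasure \<Rightarrow> (real \<Rightarrow> real) \<Rightarrow> smeasure \<Rightarrow> bool" where
  "BV_decomp a b u Du u' Ds \<longleftrightarrow> meas_deriv a b u Du \<and> L1 a b u' \<and> smeas a b Ds \<and>
     (\<exists>N \<in> sets borel. emeasure lborel N = 0 \<and> (\<forall>A \<in> sets borel. sval Ds A = sval Ds (A \<inter> N))) \<and>
     (\<forall>A \<in> sets borel. sval Du A = (\<integral>x\<in>A \<inter> {a<..<b}. u' x \<partial>lborel) + sval Ds A)"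

definition aplim_right :: "(real \<Rightarrow> real) \<Rightarrow> real \<Rightarrow> real \<Rightarrow> bool" where
  "aplim_right u x l \<longleftrightarrow>
     ((\<lambda>r. (\<integral>t\<in>{x<..<x+r}. \<bar>u t - l\<bar> \<partial>lborel) / r) \<longlongrightarrow> 0) (at_right 0)"

definition aplim_left :: "(real \<Rightarrow> real) \<Rightarrow> real \<Rightarrow> real \<Rightarrow> bool" where
  "aplim_left u x l \<longleftrightarrow>
     ((\<lambda>r. (\<integral>t\<in>{x-r<..<x}. \<bar>u t - l\<bar> \<partial>lborel) / r) \<longlongrightarrow> 0) (at_right 0)"

definition jset :: "real \<Rightarrow> real \<Rightarrow> (real \<Rightarrow> real) \<Rightarrow> real set" where
  "jset a b u = {x \<in> {a<..<b}. \<exists>l1 l2. l1 \<noteq> l2 \<and> aplim_right u x l1 \<and> aplim_left u x l2}"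

definition jump :: "(real \<Rightarrow> real) \<Rightarrow> real \<Rightarrow> real" where
  "jump u x = (THE l. aplim_right u x l) - (THE l. aplim_left u x l)"

definition avg_abs :: "real \<Rightarrow> real \<Rightarrow> real \<Rightarrow> (real \<Rightarrow> real) \<Rightarrow> real \<Rightarrow> real" where
  "avg_abs a b \<epsilon> g x =
     (\<integral>t\<in>{x-\<epsilon><..<x+\<epsilon>} \<inter> {a<..<b}. \<bar>g t\<bar> \<partial>lborel) / measure lborel ({x-\<epsilon><..<x+\<epsilon>} \<inter> {a<..<b})"

text \<open>E_eps. The infimum ranges over the (a.e. unique) witnesses u' = v and g;
  it is +\<infinity> if there is none.\<close>
definition Eeps :: "real \<Rightarrow> real \<Rightarrow> real \<Rightarrow> real \<Rightarrow> real \<Rightarrow> (real \<Rightarrow> real) \<Rightarrow> smeasure \<Rightarrow> ennreal" where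
  "Eeps a b K c0 \<epsilon> u \<gamma> =
     (INF vg \<in> {(v, g). weak_deriv a b u v \<and> ess_bdd a b K u \<and> smeas a b \<gamma> \<and> L1 a b g \<and>
                 (\<forall>A \<in> sets borel. sval \<gamma> A = (\<integral>x\<in>A \<inter> {a<..<b}. g x \<partial>lborel)) \<and>
                 L1 a b (\<lambda>x. (v x - g x)^2)}.
        (\<integral>\<^sup>+x\<in>{a<..<b}. ennreal ((fst vg x - snd vg x)^2) \<partial>lborel)
        + ennreal (1 / \<epsilon>) *
          (\<integral>\<^sup>+x\<in>{a<..<b}. ennreal (fcap c0 (\<epsilon> * avg_abs a b \<epsilon> (snd vg) x)) \<partial>lborel))"

definition Elim :: "real \<Rightarrow> real \<Rightarrow> real \<Rightarrow> real \<Rightarrow> (real \<Rightarrow> real) \<Rightarrow> smeasure \<Rightarrow> ennreal" where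
  "Elim a b K c0 u \<gamma> =
     (INF w \<in> {(Du, v, Ds, g). BV_decomp a b u Du v Ds \<and> ess_bdd a b K u \<and> smeas a b \<gamma> \<and>
                 L1 a b g \<and>
                 (\<forall>A \<in> sets borel. sval \<gamma> A = sval Ds A + (\<integral>x\<in>A \<inter> {a<..<b}. g x \<partial>lborel)) \<and>
                 L1 a b (\<lambda>x. (v x - g x)^2)}.
        (case w of (Du, v, Ds, g) \<Rightarrow>
          (\<integral>\<^sup>+x\<in>{a<..<b}. ennreal ((v x - g x)^2) \<partial>lborel)
          + ennreal c0 * (\<integral>\<^sup>+x\<in>{a<..<b}. ennreal \<bar>g x\<bar> \<partial>lborel)
          + 2 * (\<integral>\<^sup>+x. ennreal (fcap c0 (\<bar>jump u x\<bar> / 2)) \<partial>count_space (jset a b u))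
          + ennreal c0 * tvar (\<lambda>A. sval Ds (A - jset a b u)) {a<..<b}))"

end

theory Submission
  imports Defs "HOL-Probability.Distribution_Functions"
begin

text \<open>
  Write \<open>\<gamma> = \<sigma> \<tau>\<close> with \<open>\<bar>\<sigma>\<bar> = 1\<close> and \<open>\<tau>\<close> the total variation, and \<open>q t = min 1 (2 / t)\<close>. Whenever the limit
  energy is finite, \<open>Du = \<gamma> + h dx\<close> with \<open>h = u' - g\<close> square integrable, the jumps of \<open>u\<close> are the atoms
  of \<open>\<gamma>\<close>, and the limit energy is the integral of \<open>h\<^sup>2\<close> plus \<open>c0\<close> times the \<open>\<tau>\<close>-integral of
  \<open>q (\<tau> {x})\<close>: the absolutely continuous, the Cantor and the small jump part all cost \<open>c0\<close> per unit of
  variation, and a jump of size at least 2 costs \<open>2 c0\<close>.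

  Limsup: average \<open>u\<close> over \<open>(x, x + \<epsilon>\<^sup>2)\<close>. The derivative splits into averages of \<open>\<gamma>\<close> and of \<open>h\<close>;
  the latter are controlled by Jensen's inequality, and \<open>min (\<tau> A) 2\<close> is at most the integral over \<open>A\<close>
  of \<open>q (\<tau> {x})\<close>, so that Fubini's theorem bounds the nonlocal term.

  Liminf: the functions \<open>h\<^sub>\<epsilon>\<close> converge weakly in \<open>L\<^sup>2\<close>, because \<open>u\<^sub>\<epsilon>\<close> and \<open>\<gamma>\<^sub>\<epsilon>\<close> converge as distributions.
  For functions supported in separated intervals \<open>U\<^sub>k\<close>, Fubini's theorem and the concavity of \<open>min t 2\<close>
  bound the nonlocal term below by the sum of \<open>c0 min \<bar>\<integral>\<phi>\<^sub>k d\<gamma>\<^sub>\<epsilon>\<bar> 2\<close>, which gives the sum of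
  \<open>c0 min (\<tau> U\<^sub>k) 2\<close> in the limit. Refining a partition that avoids the atoms yields the claim.
\<close>

section \<open>Signed measures on an interval\<close>

text \<open>The number 2 comes from the averaging interval: away from the endpoints it has length 2
  \<epsilon>, so \<epsilon> times the average of |g| is half of the mass seen, and \<open>f\<close>
  saturates at mass 2. The main obstacle is that bounded energy does not bound the variation of the
  approximating measures: a saturated window costs the same whatever mass it holds. So no
  compactness of measures is used, and only their pairings with finitely many fixed Lipschitz
  functions vanishing outside (a, b) are passed to the limit. The two terms of the energy are
  separated by a subsequence along which the L2 terms converge to a number A; the limit
  \<open>h\<close> costs at most A, and the nonlocal terms at most what A leaves over. The averaging
  width \<epsilon>^2 is small against \<epsilon>, so it lengthens the windows only by the factor 1 +
  \<epsilon>/2. Signed measures are pairs whose components may overlap; two pairs are identified by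
  comparing the crosswise sums of their components.\<close>

lemma fin_meas_onD:
  assumes "fin_meas_on a b M"
  shows "sets M = sets borel" "space M = UNIV" "finite_measure M" "emeasure M (UNIV - {a<..<b}) = 0"
proof -
  show s: "sets M = sets borel" and "emeasure M (UNIV - {a<..<b}) = 0"
    using assms by (auto simp: fin_meas_on_def)
  show sp: "space M = UNIV"
    using sets_eq_imp_space_eq[OF s] by simp
  show "finite_measure M"
    using assms sp by (auto intro!: finite_measureI simp: fin_meas_on_def)
qed

lemma borel_measurable_fin_meas:
  assumes "fin_meas_on a b M"
  shows "borel_measurable M = (borel_measurable borel :: (real \<Rightarrow> 'b::topological_space) set)"
  using fin_meas_onD(1)[OF assms] by (intro measurable_cong_sets) auto

lemma AE_fin_meas:
  assumes "fin_meas_on a b M"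
  shows "AE x in M. x \<in> {a<..<b}"
  using fin_meas_onD[OF assms] by (intro AE_I[where N = "UNIV - {a<..<b}"]) auto

lemma integrable_fin_meas:
  fixes \<phi> :: "real \<Rightarrow> real"
  assumes "fin_meas_on a b M" "\<phi> \<in> borel_measurable borel" "\<And>x. \<bar>\<phi> x\<bar> \<le> C"
  shows "integrable M \<phi>"
proof -
  interpret finite_measure M by (rule fin_meas_onD(3)[OF assms(1)])
  show ?thesis
    using assms(2,3) borel_measurable_fin_meas[OF assms(1)]
    by (intro integrable_const_bound[where B = C]) auto
qed

lemma measure_fin_meas_Int:
  assumes "fin_meas_on a b M" "A \<in> sets borel"
  shows "measure M A = measure M (A \<inter> {a<..<b})"
  using AE_fin_meas[OF assms(1)] fin_meas_onD(1)[OF assms(1)] assms(2)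
  by (intro measure_eq_AE) auto

lemma measure_fin_meas_null:
  assumes "fin_meas_on a b M" "A \<in> sets borel" "A \<inter> {a<..<b} = {}"
  shows "measure M A = 0"
  using measure_fin_meas_Int[OF assms(1,2)] assms(3) by simp

lemma fin_meas_on_density:
  fixes f :: "real \<Rightarrow> real"
  assumes "sets M = sets borel" "integrable M f" "\<And>x. 0 \<le> f x"
    and "AE x in M. x \<notin> {a<..<b} \<longrightarrow> f x = 0"
  shows "fin_meas_on a b (density M (\<lambda>x. ennreal (f x)))"
proof -
  have [measurable]: "f \<in> borel_measurable M" using assms(2) by auto
  have sp: "space M = UNIV" using sets_eq_imp_space_eq[OF assms(1)] by simp
  have "emeasure (density M (\<lambda>x. ennreal (f x))) UNIV = (\<integral>\<^sup>+x. ennreal (f x) \<partial>M)"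
    using assms(1) sp by (subst emeasure_density) auto
  also have "\<dots> \<noteq> \<infinity>"
    using assms(2,3) by (subst nn_integral_eq_integral) auto
  finally have 1: "emeasure (density M (\<lambda>x. ennreal (f x))) UNIV \<noteq> \<infinity>" .
  have "emeasure (density M (\<lambda>x. ennreal (f x))) (UNIV - {a<..<b}) =
      (\<integral>\<^sup>+x. ennreal (f x) * indicator (UNIV - {a<..<b}) x \<partial>M)"
    using assms(1) by (subst emeasure_density) auto
  also have "\<dots> = (\<integral>\<^sup>+x. 0 \<partial>M)"
    using assms(4) by (intro nn_integral_cong_AE) (auto split: split_indicator)
  finally show ?thesis using 1 assms(1) by (simp add: fin_meas_on_def)
qed

text \<open>Two pairs represent the same signed measure exactly when the crosswise sums of their
  components agree, so sums of positive measures stand in for differences. The sum of both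
  components of one pair also dominates its total variation.\<close>

definition add_meas :: "real measure \<Rightarrow> real measure \<Rightarrow> real measure" where
  "add_meas M N = measure_of UNIV (sets borel) (\<lambda>A. emeasure M A + emeasure N A)"

lemma add_meas:
  assumes "sets M = sets borel" "sets N = sets borel"
  shows sets_add_meas: "sets (add_meas M N) = sets borel"
    and emeasure_add_meas: "A \<in> sets borel \<Longrightarrow> emeasure (add_meas M N) A = emeasure M A + emeasure N A"
proof -
  have sa: "sigma_algebra UNIV (sets (borel :: real measure))"
    by (metis sets.sigma_algebra_axioms space_borel)
  show s: "sets (add_meas M N) = sets borel"
    unfolding add_meas_def by (subst sets_measure_of) (auto simp: sigma_algebra.sigma_sets_eq[OF sa])
  assume A: "A \<in> sets borel"
  show "emeasure (add_meas M N) A = emeasure M A + emeasure N A"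
  proof (rule emeasure_measure_of[OF add_meas_def])
    show "countably_additive (sets (add_meas M N)) (\<lambda>A. emeasure M A + emeasure N A)"
      unfolding s countably_additive_def
      using assms by (auto simp: suminf_add[symmetric] suminf_emeasure)
  qed (use A s in \<open>auto simp: positive_def\<close>)
qed

lemma nn_integral_add_meas:
  assumes "sets M = sets borel" "sets N = sets borel" "f \<in> borel_measurable borel"
  shows "(\<integral>\<^sup>+x. f x \<partial>add_meas M N) = (\<integral>\<^sup>+x. f x \<partial>M) + (\<integral>\<^sup>+x. f x \<partial>N)"
  using assms(3)
proof induction
  have [measurable_cong]: "sets M = sets borel" "sets N = sets borel" "sets (add_meas M N) = sets borel"
    using assms(1,2) by (simp_all add: sets_add_meas)
  {
    case (cong f g)
    then show ?case by (simp cong: nn_integral_cong)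
  next
    case (set A)
    then show ?case using assms by (simp add: emeasure_add_meas sets_add_meas)
  next
    case (mult u c)
    then show ?case by (simp add: nn_integral_cmult distrib_left)
  next
    case (add u v)
    then show ?case by (simp add: nn_integral_add ac_simps)
  next
    case (seq U)
    have 1: "(\<integral>\<^sup>+x. (SUP i. U i) x \<partial>L) = (SUP i. \<integral>\<^sup>+x. U i x \<partial>L)" if "sets L = sets borel" for L
      unfolding SUP_apply using seq that
      by (intro nn_integral_monotone_convergence_SUP)
        (auto simp: measurable_cong_sets[OF that refl])
    \<comment> \<open>Both sequences of integrals increase, so the supremum of the sums is the sum
      of the suprema.\<close>
    have 2: "mono (\<lambda>i. \<integral>\<^sup>+x. U i x \<partial>L)" for L
      using seq(3) by (auto simp: mono_def le_fun_def intro!: nn_integral_mono)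
    have 3: "(\<integral>\<^sup>+x. U i x \<partial>add_meas M N) = (\<integral>\<^sup>+x. U i x \<partial>M) + (\<integral>\<^sup>+x. U i x \<partial>N)" for i
      using seq by auto
    show ?case
      unfolding 1[OF assms(1)] 1[OF assms(2)] 1[OF sets_add_meas[OF assms(1,2)]] 3
      by (intro ennreal_SUP_add 2)
  }
qed

lemma fin_meas_on_add_meas:
  assumes "fin_meas_on a b M" "fin_meas_on a b N"
  shows "fin_meas_on a b (add_meas M N)"
  using assms by (auto simp: fin_meas_on_def sets_add_meas emeasure_add_meas)

lemma measure_add_meas:
  assumes "fin_meas_on a b M" "fin_meas_on a b N" "A \<in> sets borel"
  shows "measure (add_meas M N) A = measure M A + measure N A"
proof -
  interpret M: finite_measure M by (rule fin_meas_onD(3)[OF assms(1)])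
  interpret N: finite_measure N by (rule fin_meas_onD(3)[OF assms(2)])
  interpret MN: finite_measure "add_meas M N"
    by (rule fin_meas_onD(3)[OF fin_meas_on_add_meas[OF assms(1,2)]])
  have "ennreal (measure (add_meas M N) A) = ennreal (measure M A + measure N A)"
    using emeasure_add_meas[of M N A] fin_meas_onD(1)[OF assms(1)] fin_meas_onD(1)[OF assms(2)] assms(3)
    by (simp add: M.emeasure_eq_measure N.emeasure_eq_measure MN.emeasure_eq_measure)
  then show ?thesis by (subst (asm) ennreal_inj) auto
qed

lemma integral_add_meas:
  fixes \<phi> :: "real \<Rightarrow> real"
  assumes "fin_meas_on a b M" "fin_meas_on a b N" "\<phi> \<in> borel_measurable borel" "\<And>x. \<bar>\<phi> x\<bar> \<le> C"
  shows "(\<integral>x. \<phi> x \<partial>add_meas M N) = (\<integral>x. \<phi> x \<partial>M) + (\<integral>x. \<phi> x \<partial>N)"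
proof -
  have s: "sets M = sets borel" "sets N = sets borel" using fin_meas_onD(1) assms by auto
  have i: "integrable L \<phi>" if "fin_meas_on a b L" for L
    using integrable_fin_meas[OF that assms(3,4)] .
  have fin: "(\<integral>\<^sup>+x. ennreal (\<phi> x) \<partial>L) < \<infinity>" "(\<integral>\<^sup>+x. ennreal (- \<phi> x) \<partial>L) < \<infinity>"
    if "fin_meas_on a b L" for L
    using i[OF that] by (auto simp: real_integrable_def top.not_eq_extremum)
  note f1 = fin[OF assms(1)] and f2 = fin[OF assms(2)]
  show ?thesis
    using f1 f2 nn_integral_add_meas[OF s, of "\<lambda>x. ennreal (\<phi> x)"]
      nn_integral_add_meas[OF s, of "\<lambda>x. ennreal (- \<phi> x)"] assms(3)
    by (simp add: real_lebesgue_integral_def i assms(1,2) fin_meas_on_add_meas enn2real_plus)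
qed

section \<open>Signed measures with a density, and sums of signed measures\<close>

definition dens :: "real \<Rightarrow> real \<Rightarrow> (real \<Rightarrow> real) \<Rightarrow> smeasure" where
  "dens a b g = (density lborel (\<lambda>x. ennreal (max 0 (indicator {a<..<b} x * g x))),
                 density lborel (\<lambda>x. ennreal (max 0 (- indicator {a<..<b} x * g x))))"

definition add_smeas :: "smeasure \<Rightarrow> smeasure \<Rightarrow> smeasure" where
  "add_smeas \<gamma> \<delta> = (add_meas (fst \<gamma>) (fst \<delta>), add_meas (snd \<gamma>) (snd \<delta>))"

lemma L1_iff: "L1 a b g \<longleftrightarrow> integrable lborel (\<lambda>x. indicator {a<..<b} x * g x)"
  by (simp add: L1_def set_integrable_def)

lemma L1_mult_bounded:
  assumes "L1 a b g" "\<phi> \<in> borel_measurable borel" "\<And>x. \<bar>\<phi> x\<bar> \<le> C"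
  shows "L1 a b (\<lambda>x. g x * \<phi> x)"
proof -
  have "integrable lborel (\<lambda>x. indicator {a<..<b} x * g x * \<phi> x)"
  proof (rule Bochner_Integration.integrable_bound)
    show "integrable lborel (\<lambda>x. C * (indicator {a<..<b} x * g x))"
      using assms(1) by (auto simp: L1_iff)
    show "AE x in lborel. norm (indicator {a<..<b} x * g x * \<phi> x) \<le> norm (C * (indicator {a<..<b} x * g x))"
    proof (rule AE_I2)
      fix x
      have "\<bar>\<phi> x\<bar> \<le> \<bar>C\<bar>" using assms(3)[of x] by linarith
      then show "norm (indicator {a<..<b} x * g x * \<phi> x) \<le> norm (C * (indicator {a<..<b} x * g x))"
        by (auto simp: abs_mult split: split_indicator) (metis abs_ge_zero mult.commute mult_right_mono)
    qed
  qed (use assms in \<open>auto simp: L1_iff\<close>)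
  then show ?thesis by (simp add: L1_iff mult.assoc)
qed

lemma smeas_dens: assumes "L1 a b g" shows "smeas a b (dens a b g)"
  using assms unfolding smeas_def dens_def L1_iff
  by (auto intro!: fin_meas_on_density integrable_max AE_I2 split: split_indicator)

lemma sint_dens:
  assumes "L1 a b g" "\<phi> \<in> borel_measurable borel" "\<And>x. \<bar>\<phi> x\<bar> \<le> C"
  shows "sint (dens a b g) \<phi> = (\<integral>x\<in>{a<..<b}. g x * \<phi> x \<partial>lborel)"
proof -
  define g0 where "g0 = (\<lambda>x. indicator {a<..<b} x * g x :: real)"
  have [measurable]: "g0 \<in> borel_measurable lborel" "\<phi> \<in> borel_measurable lborel"
    using assms by (auto simp: L1_iff g0_def)
  have i: "integrable lborel (\<lambda>x. g0 x * \<phi> x)"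
    using L1_mult_bounded[OF assms] by (simp add: L1_iff mult.assoc g0_def)
  have i1: "integrable lborel (\<lambda>x. max 0 (g0 x) * \<phi> x)"
    by (rule Bochner_Integration.integrable_bound[OF i]) (auto simp: abs_mult intro!: mult_right_mono)
  have i2: "integrable lborel (\<lambda>x. max 0 (- g0 x) * \<phi> x)"
    by (rule Bochner_Integration.integrable_bound[OF i]) (auto simp: abs_mult intro!: mult_right_mono)
  have "dens a b g = (density lborel (\<lambda>x. ennreal (max 0 (g0 x))), density lborel (\<lambda>x. ennreal (max 0 (- g0 x))))"
    by (simp add: dens_def g0_def)
  then have "sint (dens a b g) \<phi> = (\<integral>x. max 0 (g0 x) * \<phi> x \<partial>lborel) - (\<integral>x. max 0 (- g0 x) * \<phi> x \<partial>lborel)"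
    unfolding sint_def by (simp add: integral_density)
  also have "\<dots> = (\<integral>x. max 0 (g0 x) * \<phi> x - max 0 (- g0 x) * \<phi> x \<partial>lborel)"
    using i1 i2 by simp
  also have "\<dots> = (\<integral>x. g0 x * \<phi> x \<partial>lborel)"
    by (intro Bochner_Integration.integral_cong) (auto split: split_max)
  finally show ?thesis by (simp add: set_lebesgue_integral_def mult.assoc g0_def)
qed

lemma sint_indicator:
  assumes "smeas a b \<gamma>" "A \<in> sets borel"
  shows "sint \<gamma> (indicator A) = sval \<gamma> A"
  using assms fin_meas_onD[of a b "fst \<gamma>"] fin_meas_onD[of a b "snd \<gamma>"]
  by (simp add: smeas_def sint_def sval_def)

lemma sval_dens:
  assumes "L1 a b g" "A \<in> sets borel"
  shows "sval (dens a b g) A = (\<integral>x\<in>A \<inter> {a<..<b}. g x \<partial>lborel)"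
proof -
  have "sval (dens a b g) A = (\<integral>x\<in>{a<..<b}. g x * indicator A x \<partial>lborel)"
    using assms sint_indicator[OF smeas_dens[OF assms(1)] assms(2)]
    by (subst (asm) sint_dens[where C = 1]) (auto simp: indicator_def)
  then show ?thesis
    by (auto simp: set_lebesgue_integral_def indicator_inter_arith ac_simps)
qed

lemma smeas_add: "smeas a b \<gamma> \<Longrightarrow> smeas a b \<delta> \<Longrightarrow> smeas a b (add_smeas \<gamma> \<delta>)"
  by (simp add: smeas_def add_smeas_def fin_meas_on_add_meas)

lemma sval_add:
  assumes "smeas a b \<gamma>" "smeas a b \<delta>" "A \<in> sets borel"
  shows "sval (add_smeas \<gamma> \<delta>) A = sval \<gamma> A + sval \<delta> A"
  using assms measure_add_meas[of a b "fst \<gamma>" "fst \<delta>" A] measure_add_meas[of a b "snd \<gamma>" "snd \<delta>" A]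
  by (simp add: sval_def smeas_def add_smeas_def)

lemma sint_add:
  assumes "smeas a b \<gamma>" "smeas a b \<delta>" "\<phi> \<in> borel_measurable borel" "\<And>x. \<bar>\<phi> x\<bar> \<le> C"
  shows "sint (add_smeas \<gamma> \<delta>) \<phi> = sint \<gamma> \<phi> + sint \<delta> \<phi>"
  using assms(1,2) integral_add_meas[of a b "fst \<gamma>" "fst \<delta>", OF _ _ assms(3,4)]
    integral_add_meas[of a b "snd \<gamma>" "snd \<delta>", OF _ _ assms(3,4)]
  by (simp add: sint_def smeas_def add_smeas_def)

text \<open>The components may overlap, so their sum \<mu> can be larger than the total variation.
  Both have densities \<open>p\<close> and \<open>q\<close> with respect to \<mu>; the total
  variation has density |p - q|, and \<open>\<sigma>\<close> is the sign of p - q.\<close>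

lemma polar_decomposition:
  assumes "smeas a b \<gamma>"
  obtains \<tau> :: "real measure" and \<sigma> :: "real \<Rightarrow> real"
  where "fin_meas_on a b \<tau>" "\<sigma> \<in> borel_measurable borel" "\<And>x. \<bar>\<sigma> x\<bar> = 1"
    "\<And>\<phi> C. \<phi> \<in> borel_measurable borel \<Longrightarrow> (\<And>x. \<bar>\<phi> x\<bar> \<le> C) \<Longrightarrow> sint \<gamma> \<phi> = (\<integral>x. \<phi> x * \<sigma> x \<partial>\<tau>)"
proof -
  let ?M = "fst \<gamma>" and ?N = "snd \<gamma>"
  have M: "fin_meas_on a b ?M" and N: "fin_meas_on a b ?N" using assms by (auto simp: smeas_def)
  define \<mu> where "\<mu> = add_meas ?M ?N"
  have \<mu>: "fin_meas_on a b \<mu>" unfolding \<mu>_def by (rule fin_meas_on_add_meas[OF M N])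
  interpret \<mu>: finite_measure \<mu> by (rule fin_meas_onD(3)[OF \<mu>])
  note sets = fin_meas_onD(1)[OF M] fin_meas_onD(1)[OF N] fin_meas_onD(1)[OF \<mu>]
  have em: "emeasure \<mu> A = emeasure ?M A + emeasure ?N A" if "A \<in> sets borel" for A
    unfolding \<mu>_def using sets that by (simp add: emeasure_add_meas)
  have RN: "\<exists>p :: real \<Rightarrow> real. p \<in> borel_measurable borel \<and> (\<forall>x. 0 \<le> p x) \<and> integrable \<mu> p \<and>
      L = density \<mu> (\<lambda>x. ennreal (p x))"
    if L: "fin_meas_on a b L" and ac: "\<And>A. A \<in> sets borel \<Longrightarrow> emeasure L A \<le> emeasure \<mu> A" for L
  proof -
    have ac': "absolutely_continuous \<mu> L"
      unfolding absolutely_continuous_def null_sets_def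
      using ac sets(3) fin_meas_onD(1)[OF L] by (auto simp: order_antisym_conv) (metis le_zero_eq)
    have sL: "sets L = sets \<mu>" using fin_meas_onD(1)[OF L] sets by simp
    obtain p where p: "p \<in> borel_measurable \<mu>" "AE x in \<mu>. RN_deriv \<mu> L x = ennreal (p x)" "\<And>x. 0 \<le> p x"
      using \<mu>.real_RN_deriv[OF fin_meas_onD(3)[OF L] ac' sL] by metis
    have "density \<mu> (RN_deriv \<mu> L) = density \<mu> (\<lambda>x. ennreal (p x))"
      using p by (intro density_cong) auto
    then have eq: "L = density \<mu> (\<lambda>x. ennreal (p x))"
      using \<mu>.density_RN_deriv[OF ac' sL] by simp
    have "(\<integral>\<^sup>+x. ennreal (p x) \<partial>\<mu>) = emeasure L UNIV"
      using p(1) sets fin_meas_onD(2)[OF \<mu>] by (subst eq, subst emeasure_density) auto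
    also have "\<dots> < \<infinity>"
      using L by (simp add: fin_meas_on_def top.not_eq_extremum)
    finally have "integrable \<mu> p"
      using p by (intro integrableI_nonneg) auto
    with p eq show ?thesis using borel_measurable_fin_meas[OF \<mu>] by blast
  qed
  obtain p where p: "p \<in> borel_measurable borel" "\<And>x. 0 \<le> p x" "integrable \<mu> p"
    "?M = density \<mu> (\<lambda>x. ennreal (p x))"
    using RN[OF M] em by auto
  obtain q where q: "q \<in> borel_measurable borel" "\<And>x. 0 \<le> q x" "integrable \<mu> q"
    "?N = density \<mu> (\<lambda>x. ennreal (q x))"
    using RN[OF N] em by auto
  define d where "d = (\<lambda>x. p x - q x)"
  \<comment> \<open>The value at the zeros of \<open>d\<close> is arbitrary, as
    \<open>\<tau>\<close> does not charge them; taking 1 makes |\<sigma>| = 1 hold everywhere and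
    not just almost everywhere.\<close>
  define \<sigma> where "\<sigma> = (\<lambda>x. if d x \<ge> 0 then 1 else - 1 :: real)"
  define \<tau> where "\<tau> = density \<mu> (\<lambda>x. ennreal \<bar>d x\<bar>)"
  have bm: "borel_measurable \<mu> = (borel_measurable borel :: (real \<Rightarrow> real) set)"
    by (rule borel_measurable_fin_meas[OF \<mu>])
  have d[measurable]: "d \<in> borel_measurable borel" "integrable \<mu> d"
    using p q by (auto simp: d_def)
  have \<sigma>[measurable]: "\<sigma> \<in> borel_measurable borel" unfolding \<sigma>_def by measurable
  show thesis
  proof (rule that[of \<tau> \<sigma>])
    show "fin_meas_on a b \<tau>"
      unfolding \<tau>_def using sets d AE_fin_meas[OF \<mu>]
      by (intro fin_meas_on_density) auto
    fix \<phi> :: "real \<Rightarrow> real" and C assume phi: "\<phi> \<in> borel_measurable borel" "\<And>x. \<bar>\<phi> x\<bar> \<le> C"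
    have mu: "integrable \<mu> (\<lambda>x. p x * \<phi> x)" "integrable \<mu> (\<lambda>x. q x * \<phi> x)"
      using integrable_fin_meas[OF M phi] integrable_fin_meas[OF N phi] p q phi bm
      by (auto simp: p(4) q(4) integrable_density)
    have "sint \<gamma> \<phi> = (\<integral>x. p x * \<phi> x \<partial>\<mu>) - (\<integral>x. q x * \<phi> x \<partial>\<mu>)"
      unfolding sint_def p(4) q(4) using p q phi bm by (subst (1 2) integral_density) auto
    also have "\<dots> = (\<integral>x. d x * \<phi> x \<partial>\<mu>)"
      using mu by (simp add: d_def left_diff_distrib)
    also have "\<dots> = (\<integral>x. \<bar>d x\<bar> * (\<phi> x * \<sigma> x) \<partial>\<mu>)"
      by (intro Bochner_Integration.integral_cong) (auto simp: \<sigma>_def)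
    also have "\<dots> = (\<integral>x. \<phi> x * \<sigma> x \<partial>\<tau>)"
      unfolding \<tau>_def using bm d \<sigma> phi by (subst integral_density) auto
    finally show "sint \<gamma> \<phi> = (\<integral>x. \<phi> x * \<sigma> x \<partial>\<tau>)" .
  qed (use \<sigma> in \<open>auto simp: \<sigma>_def\<close>)
qed

section \<open>Fubini's theorem for signed measures\<close>

lemma measurable_sint_kernel:
  assumes "smeas a b D" "case_prod k \<in> borel_measurable (borel \<Otimes>\<^sub>M borel)"
  shows "(\<lambda>x. sint D (\<lambda>y. k y x)) \<in> borel_measurable borel"
proof -
  have "(\<lambda>x. \<integral>y. k y x \<partial>M) \<in> borel_measurable borel" if M: "fin_meas_on a b M" for M
  proof -
    interpret finite_measure M by (rule fin_meas_onD(3)[OF M])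
    have [measurable_cong]: "sets M = sets borel" by (rule fin_meas_onD(1)[OF M])
    have [measurable]: "(\<lambda>z. k (snd z) (fst z)) \<in> borel_measurable (borel \<Otimes>\<^sub>M M)"
      using measurable_compose[OF measurable_Pair[OF measurable_snd measurable_fst] assms(2)]
      by (simp add: measurable_cong_sets[OF sets_pair_measure_cong[OF refl fin_meas_onD(1)[OF M]] refl])
    show ?thesis by (rule borel_measurable_lebesgue_integral) (simp add: case_prod_beta)
  qed
  then show ?thesis using assms(1) unfolding sint_def smeas_def by auto
qed

text \<open>A bounded kernel times an integrable weight is integrable on the product with a finite
  measure, so each component of \<open>D\<close> obeys Fubini's theorem. The kernels used later are
  indicators: half lines give integration by parts, windows trade averages of measures for averages
  of test functions.\<close>

lemma Fubini_sint:
  fixes k :: "real \<Rightarrow> real \<Rightarrow> real"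
  assumes D: "smeas a b D" and k: "case_prod k \<in> borel_measurable (borel \<Otimes>\<^sub>M borel)"
    and C: "\<And>y x. \<bar>k y x\<bar> \<le> C" and w: "integrable lborel w"
  shows "sint D (\<lambda>y. \<integral>x. k y x * w x \<partial>lborel) = (\<integral>x. sint D (\<lambda>y. k y x) * w x \<partial>lborel)"
    and "integrable lborel (\<lambda>x. sint D (\<lambda>y. k y x) * w x)"
proof -
  have main: "(\<integral>y. (\<integral>x. k y x * w x \<partial>lborel) \<partial>M) = (\<integral>x. (\<integral>y. k y x \<partial>M) * w x \<partial>lborel)
     \<and> integrable lborel (\<lambda>x. (\<integral>y. k y x \<partial>M) * w x)" if M: "fin_meas_on a b M" for M
  proof -
    interpret M: finite_measure M by (rule fin_meas_onD(3)[OF M])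
    interpret P: pair_sigma_finite M lborel ..
    have s: "sets (M \<Otimes>\<^sub>M lborel) = sets (borel \<Otimes>\<^sub>M borel)"
      by (intro sets_pair_measure_cong) (auto simp: fin_meas_onD(1)[OF M])
    have [measurable]: "w \<in> borel_measurable lborel" using w by auto
    have km: "case_prod k \<in> borel_measurable (M \<Otimes>\<^sub>M lborel)"
      using k by (simp add: measurable_cong_sets[OF s refl])
    have wm: "(\<lambda>z. w (snd z)) \<in> borel_measurable (M \<Otimes>\<^sub>M lborel)" by measurable
    have i0: "integrable (M \<Otimes>\<^sub>M lborel) (\<lambda>z. w (snd z))"
      by (rule P.Fubini_integrable) (use w wm in \<open>auto\<close>)
    have int: "integrable (M \<Otimes>\<^sub>M lborel) (\<lambda>(y, x). k y x * w x)"
    proof (rule Bochner_Integration.integrable_bound)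
      show "integrable (M \<Otimes>\<^sub>M lborel) (\<lambda>z. C * w (snd z))" using i0 by simp
      show "(\<lambda>(y, x). k y x * w x) \<in> borel_measurable (M \<Otimes>\<^sub>M lborel)"
        using borel_measurable_times[OF km wm] by (simp add: case_prod_beta)
      show "AE z in M \<Otimes>\<^sub>M lborel. norm (case z of (y, x) \<Rightarrow> k y x * w x) \<le> norm (C * w (snd z))"
        by (intro AE_I2) (auto simp: abs_mult intro!: mult_right_mono order.trans[OF C])
    qed
    have k1: "integrable M (\<lambda>y. k y x)" for x
    proof (rule integrable_fin_meas[OF M _ C])
      show "(\<lambda>y. k y x) \<in> borel_measurable borel"
        using measurable_compose[OF measurable_Pair[OF measurable_ident measurable_const] k] by simp
    qed
    have "(\<integral>x. (\<integral>y. k y x * w x \<partial>M) \<partial>lborel) = (\<integral>y. (\<integral>x. k y x * w x \<partial>lborel) \<partial>M)"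
      by (rule P.Fubini_integral[OF int])
    moreover have "integrable lborel (\<lambda>x. \<integral>y. k y x * w x \<partial>M)"
      using P.integrable_snd[OF int] .
    ultimately show ?thesis using k1 by simp
  qed
  have M: "fin_meas_on a b (fst D)" "fin_meas_on a b (snd D)" using D by (auto simp: smeas_def)
  show "sint D (\<lambda>y. \<integral>x. k y x * w x \<partial>lborel) = (\<integral>x. sint D (\<lambda>y. k y x) * w x \<partial>lborel)"
    "integrable lborel (\<lambda>x. sint D (\<lambda>y. k y x) * w x)"
    using main[OF M(1)] main[OF M(2)] by (auto simp: sint_def left_diff_distrib)
qed

section \<open>Smooth test functions\<close>

text \<open>For \<open>p = 1\<close> this is the classical smooth function exp(-1/t) that is flat at
  0. The polynomial factor in 1/t closes the family under differentiation.\<close>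

definition flat_exp :: "real poly \<Rightarrow> real \<Rightarrow> real" where
  "flat_exp p t = (if t > 0 then poly p (1 / t) * exp (- (1 / t)) else 0)"

lemma poly_exp_tendsto_0: "((\<lambda>y::real. poly p y * exp (- y)) \<longlongrightarrow> 0) at_top"
proof -
  have "((\<lambda>y. \<Sum>i\<le>degree p. coeff p i * (y ^ i / exp y)) \<longlongrightarrow> (\<Sum>i\<le>degree p. coeff p i * 0)) at_top"
    by (intro tendsto_intros tendsto_power_div_exp_0)
  moreover have "(\<Sum>i\<le>degree p. coeff p i * (y ^ i / exp y)) = poly p y * exp (- y)" for y
    by (simp add: poly_altdef exp_minus sum_distrib_right divide_inverse mult.assoc)
  ultimately show ?thesis by simp
qed

text \<open>For t > 0 the chain rule produces the factor 1/t^2, the value of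
  \<open>[:0, 0, 1:]\<close> at 1/t, times p - p'. At 0 only the decay of exp(-y) against
  polynomials in y = 1/t matters.\<close>

lemma flat_exp_has_derivative:
  "(flat_exp p has_field_derivative flat_exp ([:0, 0, 1:] * (p - pderiv p)) t) (at t)"
proof (cases t "0::real" rule: linorder_cases)
  case less
  have "((\<lambda>_. 0) has_field_derivative flat_exp ([:0, 0, 1:] * (p - pderiv p)) t) (at t)"
    using less by (simp add: flat_exp_def)
  moreover have "eventually (\<lambda>s. s < 0) (nhds t)"
    using less by (intro eventually_nhds_in_open[of "{..<0}", simplified]) auto
  then have "\<forall>\<^sub>F s in nhds t. 0 = flat_exp p s"
    by eventually_elim (auto simp: flat_exp_def)
  ultimately show ?thesis by (subst DERIV_cong_ev[OF refl _ refl, symmetric]) auto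
next
  case greater
  have "((\<lambda>t. poly p (1 / t) * exp (- (1 / t))) has_field_derivative flat_exp ([:0, 0, 1:] * (p - pderiv p)) t) (at t)"
    using greater by (auto intro!: derivative_eq_intros simp: flat_exp_def field_simps power2_eq_square)
  moreover have "eventually (\<lambda>s. s > 0) (nhds t)"
    using greater by (intro eventually_nhds_in_open[of "{0<..}", simplified]) auto
  then have "\<forall>\<^sub>F s in nhds t. poly p (1 / s) * exp (- (1 / s)) = flat_exp p s"
    by eventually_elim (auto simp: flat_exp_def)
  ultimately show ?thesis by (subst DERIV_cong_ev[OF refl _ refl, symmetric]) auto
next
  case equal
  have "((\<lambda>s. flat_exp p s / s) \<longlongrightarrow> 0) (at 0)"
  proof (rule filterlim_split_at)
    have "\<forall>\<^sub>F s in at_left 0. 0 = flat_exp p s / s"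
      by (auto simp: eventually_at_filter flat_exp_def)
    then show "((\<lambda>s. flat_exp p s / s) \<longlongrightarrow> 0) (at_left 0)"
      by (rule tendsto_eventually[OF eventually_mono]) simp
    \<comment> \<open>With s = 1/y the division by s becomes a multiplication by y, which
      \<open>pCons 0 p\<close> records.\<close>
    have "\<forall>\<^sub>F y in at_top. poly (pCons 0 p) y * exp (- y) = flat_exp p (inverse y) / inverse y"
      using eventually_gt_at_top[of 0] by eventually_elim (auto simp: flat_exp_def field_simps)
    then show "((\<lambda>s. flat_exp p s / s) \<longlongrightarrow> 0) (at_right 0)"
      unfolding filterlim_at_right_to_top
      by (rule Lim_transform_eventually[OF poly_exp_tendsto_0])
  qed
  then show ?thesis using equal by (simp add: has_field_derivative_iff flat_exp_def)
qed

text \<open>An algebra of functions that contains the building blocks of the cutoffs and is closed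
  under differentiation. Membership yields derivatives of every order, as \<open>test_fun\<close>
  demands, without a formula for the n-th derivative.\<close>

inductive smooth_gen :: "(real \<Rightarrow> real) \<Rightarrow> bool" where
  flat: "smooth_gen (\<lambda>x. flat_exp p (k * x + m))"
| const: "smooth_gen (\<lambda>x. c)"
| add: "smooth_gen f \<Longrightarrow> smooth_gen g \<Longrightarrow> smooth_gen (\<lambda>x. f x + g x)"
| mult: "smooth_gen f \<Longrightarrow> smooth_gen g \<Longrightarrow> smooth_gen (\<lambda>x. f x * g x)"

lemma smooth_gen_derivative:
  assumes "smooth_gen f"
  shows "\<exists>f'. smooth_gen f' \<and> (\<forall>x. (f has_field_derivative f' x) (at x))"
  using assms
proof induction
  case (flat p k m)
  let ?q = "[:0, 0, 1:] * (p - pderiv p)"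
  have "((\<lambda>x. flat_exp p (k * x + m)) has_field_derivative flat_exp ?q (k * x + m) * k) (at x)" for x
    by (rule DERIV_chain2[OF flat_exp_has_derivative]) (auto intro!: derivative_eq_intros)
  moreover have "smooth_gen (\<lambda>x. flat_exp ?q (k * x + m) * k)"
    by (intro smooth_gen.intros)
  ultimately show ?case by blast
next
  case (const c)
  show ?case by (intro exI[of _ "\<lambda>x. 0"]) (auto intro: smooth_gen.const)
next
  case (add f g)
  then obtain f' g' where "smooth_gen f'" "\<And>x. (f has_field_derivative f' x) (at x)"
    "smooth_gen g'" "\<And>x. (g has_field_derivative g' x) (at x)" by blast
  then show ?case
    by (intro exI[of _ "\<lambda>x. f' x + g' x"]) (auto intro!: smooth_gen.intros derivative_intros)
next
  case (mult f g)
  then obtain f' g' where "smooth_gen f'" "\<And>x. (f has_field_derivative f' x) (at x)"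
    "smooth_gen g'" "\<And>x. (g has_field_derivative g' x) (at x)" by blast
  with mult(1,2) show ?case
    by (intro exI[of _ "\<lambda>x. f' x * g x + g' x * f x"])
      (auto intro!: smooth_gen.intros derivative_eq_intros)
qed

lemma smooth_gen_deriv_funpow: "smooth_gen f \<Longrightarrow> smooth_gen ((deriv ^^ n) f)"
proof (induction n)
  case (Suc n)
  then obtain f' where f': "smooth_gen f'" "\<And>x. ((deriv ^^ n) f has_field_derivative f' x) (at x)"
    using smooth_gen_derivative by blast
  then have "deriv ((deriv ^^ n) f) = f'" by (auto intro: DERIV_imp_deriv)
  with f' show ?case by simp
qed auto

lemma smooth_gen_differentiable: "smooth_gen f \<Longrightarrow> (deriv ^^ n) f field_differentiable (at x)"
  using smooth_gen_derivative[OF smooth_gen_deriv_funpow, of f n] by (auto simp: field_differentiable_def)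

text \<open>An antiderivative need not lie in the algebra, but its derivative does; so only the
  zeroth iterate uses the second hypothesis alone.\<close>

lemma smooth_antiderivative_differentiable:
  assumes "smooth_gen f" "\<And>x. (F has_field_derivative f x) (at x)"
  shows "(deriv ^^ n) F field_differentiable (at x)"
proof (cases n)
  case 0
  then show ?thesis using assms(2) by (auto simp: field_differentiable_def)
next
  case (Suc m)
  have "deriv F = f" using assms(2) by (auto intro: DERIV_imp_deriv)
  then have "(deriv ^^ n) F = (deriv ^^ m) f" by (simp add: Suc funpow_Suc_right del: funpow.simps)
  then show ?thesis using smooth_gen_differentiable[OF assms(1)] by simp
qed

lemma continuous_smooth_gen: "smooth_gen f \<Longrightarrow> continuous_on A f"
  using smooth_gen_derivative[of f] by (metis continuous_at_imp_continuous_on DERIV_isCont)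

text \<open>The shift by 1 keeps the support compact in \<open>(c, d)\<close>; the pointwise limit for \<open>n \<longrightarrow> \<infinity>\<close> is still the indicator.\<close>
definition cutoff :: "real \<Rightarrow> real \<Rightarrow> nat \<Rightarrow> real \<Rightarrow> real" where
  "cutoff c d n x = flat_exp 1 (real n * (x - c) - 1) * flat_exp 1 (real n * (d - x) - 1)"

lemma flat_exp_1_bounds: "0 \<le> flat_exp 1 t" "flat_exp 1 t \<le> 1"
  by (auto simp: flat_exp_def)

lemma smooth_gen_cutoff: "smooth_gen (cutoff c d n)"
proof -
  have 1: "cutoff c d n = (\<lambda>x. flat_exp 1 (real n * x + (- real n * c - 1)) * flat_exp 1 ((- real n) * x + (real n * d - 1)))"
    by (auto simp: cutoff_def algebra_simps)
  show ?thesis unfolding 1 by (intro smooth_gen.intros)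
qed

lemma borel_measurable_cutoff[measurable]: "cutoff c d n \<in> borel_measurable borel"
  by (intro borel_measurable_continuous_onI continuous_smooth_gen smooth_gen_cutoff)

lemma cutoff_bounds: "0 \<le> cutoff c d n x" "cutoff c d n x \<le> 1"
  unfolding cutoff_def using flat_exp_1_bounds by (auto intro: mult_le_one)

lemma cutoff_eq_0:
  assumes "n > 0" "x \<notin> {c + 1 / n..d - 1 / n}"
  shows "cutoff c d n x = 0"
proof -
  have "x < c + 1 / n \<or> x > d - 1 / n" using assms(2) by auto
  then have "real n * (x - c) - 1 \<le> 0 \<or> real n * (d - x) - 1 \<le> 0"
    using assms(1) by (auto simp: field_simps)
  then show ?thesis by (auto simp: cutoff_def flat_exp_def)
qed

lemma flat_exp_1_tendsto_1:
  assumes "r > 0"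
  shows "(\<lambda>n. flat_exp 1 (real n * r - 1)) \<longlonglongrightarrow> 1"
proof -
  have lim: "filterlim (\<lambda>n. real n * r - 1) at_top sequentially"
  proof -
    have "filterlim (\<lambda>n. - 1 + real n * r) at_top sequentially"
      by (intro filterlim_tendsto_add_at_top[OF tendsto_const] filterlim_at_top_mult_tendsto_pos[OF tendsto_const assms] filterlim_real_sequentially)
    then show ?thesis by (simp add: algebra_simps)
  qed
  have "(\<lambda>n. exp (- inverse (real n * r - 1))) \<longlonglongrightarrow> exp (- 0)"
    by (intro tendsto_intros filterlim_compose[OF tendsto_inverse_0_at_top lim] filterlim_ident)
  then have 1: "(\<lambda>n. exp (- inverse (real n * r - 1))) \<longlonglongrightarrow> 1" by simp
  have "eventually (\<lambda>n. real n * r - 1 > 0) sequentially"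
    using lim unfolding filterlim_at_top_dense by blast
  then have "eventually (\<lambda>n. exp (- inverse (real n * r - 1)) = flat_exp 1 (real n * r - 1)) sequentially"
    by eventually_elim (auto simp: flat_exp_def divide_inverse)
  with 1 show ?thesis by (rule Lim_transform_eventually)
qed

lemma cutoff_tendsto_indicator: "(\<lambda>n. cutoff c d n x) \<longlonglongrightarrow> indicator {c<..<d} x"
proof (cases "x \<in> {c<..<d}")
  case True
  then have "(\<lambda>n. cutoff c d n x) \<longlonglongrightarrow> 1 * 1"
    unfolding cutoff_def by (intro tendsto_mult flat_exp_1_tendsto_1) auto
  with True show ?thesis by simp
next
  case False
  have "cutoff c d n x = 0" for n
  proof (cases "n = 0")
    case True then show ?thesis by (simp add: cutoff_def flat_exp_def)
  next
    case n: False
    have "0 < 1 / real n" using n by simp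
    then have "x \<notin> {c + 1 / real n..d - 1 / real n}" using False by (smt (verit) atLeastAtMost_iff greaterThanLessThan_iff)
    with n show ?thesis by (intro cutoff_eq_0) auto
  qed
  with False show ?thesis by simp
qed

lemma test_fun_cutoff:
  assumes "a < b" "a \<le> c" "d \<le> b" "n > 0"
  shows "test_fun a b (cutoff c d n)"
  unfolding test_fun_def
proof (intro conjI allI smooth_gen_differentiable smooth_gen_cutoff)
  show "\<exists>c' d'. a < c' \<and> c' \<le> d' \<and> d' < b \<and> (\<forall>x. x \<notin> {c'..d'} \<longrightarrow> cutoff c d n x = 0)"
  proof (cases "c + 1 / n \<le> d - 1 / n")
    case True
    have "0 < 1 / real n" using assms by simp
    then have "a < c + 1 / n" "d - 1 / n < b" using assms by linarith+
    then show ?thesis using True cutoff_eq_0[OF assms(4)] by blast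
  next
    \<comment> \<open>The supporting interval is empty, so the cutoff vanishes identically and a
      single interior point can serve as its support.\<close>
    case False
    then have "cutoff c d n x = 0" for x by (intro cutoff_eq_0 assms) auto
    then show ?thesis using assms(1) by (intro exI[of _ "(a + b) / 2"]) auto
  qed
qed

section \<open>Signed measures are determined by smooth test functions\<close>

lemma sint_cutoff_tendsto:
  assumes "smeas a b D"
  shows "(\<lambda>n. sint D (cutoff c d n)) \<longlonglongrightarrow> sval D {c<..<d}"
proof -
  have "(\<lambda>n. \<integral>x. cutoff c d n x \<partial>M) \<longlonglongrightarrow> measure M {c<..<d}" if M: "fin_meas_on a b M" for M
  proof -
    interpret M: finite_measure M by (rule fin_meas_onD(3)[OF M])
    have "(\<lambda>n. \<integral>x. cutoff c d n x \<partial>M) \<longlonglongrightarrow> (\<integral>x. indicator {c<..<d} x \<partial>M)"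
      using cutoff_bounds borel_measurable_fin_meas[OF M, where 'b = real]
      by (intro integral_dominated_convergence[where w = "\<lambda>_. 1"])
        (auto intro: cutoff_tendsto_indicator simp: fin_meas_onD(1)[OF M])
    then show ?thesis using fin_meas_onD[OF M] by simp
  qed
  then show ?thesis
    using assms unfolding smeas_def sint_def sval_def by (intro tendsto_diff) auto
qed

text \<open>The cutoffs recover the values on the intervals (c, b), hence on all right half lines,
  as no mass lies outside (a, b). Half lines determine a finite positive measure, so this is applied
  to the crosswise sums of the components.\<close>

lemma sval_unique:
  assumes ab: "a < b" and D: "smeas a b D1" "smeas a b D2"
    and eq: "\<And>c n. a \<le> c \<Longrightarrow> n > 0 \<Longrightarrow> sint D1 (cutoff c b n) = sint D2 (cutoff c b n)"
    and A: "A \<in> sets borel"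
  shows "sval D1 A = sval D2 A"
proof -
  have M: "fin_meas_on a b (fst D1)" "fin_meas_on a b (snd D1)" "fin_meas_on a b (fst D2)" "fin_meas_on a b (snd D2)"
    using D by (auto simp: smeas_def)
  have 1: "sval D1 {c<..<b} = sval D2 {c<..<b}" if "a \<le> c" for c
  proof (rule LIMSEQ_unique[OF sint_cutoff_tendsto[OF D(1)]])
    have "\<forall>\<^sub>F n in sequentially. sint D2 (cutoff c b n) = sint D1 (cutoff c b n)"
      using eventually_gt_at_top[of 0] by eventually_elim (simp add: eq that)
    then show "(\<lambda>n. sint D1 (cutoff c b n)) \<longlonglongrightarrow> sval D2 {c<..<b}"
      by (rule Lim_transform_eventually[OF sint_cutoff_tendsto[OF D(2)]])
  qed
  have Int_eq: "{x<..} \<inter> {a<..<b} = {max a x<..<b}" for x by auto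
  have 2: "sval D {x<..} = sval D {max a x<..<b}" if "smeas a b D" for D x
    using that measure_fin_meas_Int[of a b "fst D" "{x<..}"] measure_fin_meas_Int[of a b "snd D" "{x<..}"]
    by (simp add: sval_def smeas_def Int_eq)
  let ?P = "add_meas (fst D1) (snd D2)" and ?Q = "add_meas (fst D2) (snd D1)"
  note P = fin_meas_on_add_meas[OF M(1,4)] and Q = fin_meas_on_add_meas[OF M(3,2)]
  interpret P: finite_measure ?P by (rule fin_meas_onD(3)[OF P])
  interpret Q: finite_measure ?Q by (rule fin_meas_onD(3)[OF Q])
  have "?P = ?Q"
  proof (rule measure_eqI_lessThan)
    fix x
    have "sval D1 {x<..} = sval D2 {x<..}" using 1[of "max a x"] 2 D by simp
    then have "measure ?P {x<..} = measure ?Q {x<..}"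
      by (simp add: measure_add_meas[OF M(1,4)] measure_add_meas[OF M(3,2)] sval_def)
    then show "emeasure ?P {x<..} = emeasure ?Q {x<..}"
      by (simp add: P.emeasure_eq_measure Q.emeasure_eq_measure)
    show "emeasure ?P {x<..} < \<infinity>" by (simp add: P.emeasure_eq_measure)
  qed (use fin_meas_onD(1) P Q in auto)
  then have "measure ?P A = measure ?Q A" by simp
  then show ?thesis
    by (simp add: measure_add_meas[OF M(1,4) A] measure_add_meas[OF M(3,2) A] sval_def)
qed

text \<open>The sets where \<open>g\<close> is positive and where it is negative are both
  admissible; a vanishing integral over each of them kills the two parts of
  \<open>g\<close>.\<close>

lemma AE_zero_if_dens_null:
  assumes g: "L1 a b g" and 0: "\<And>A. A \<in> sets borel \<Longrightarrow> sval (dens a b g) A = 0"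
  shows "AE x in lborel. x \<in> {a<..<b} \<longrightarrow> g x = 0"
proof -
  define g0 where "g0 = (\<lambda>x. indicator {a<..<b} x * g x :: real)"
  have i: "integrable lborel g0" using g by (simp add: L1_iff g0_def)
  have [measurable]: "g0 \<in> borel_measurable borel" using i by auto
  have int0: "(\<integral>x. indicator A x * g0 x \<partial>lborel) = 0" if "A \<in> sets borel" for A
    using 0[OF that] sval_dens[OF g that]
    by (simp add: set_lebesgue_integral_def g0_def indicator_inter_arith mult.assoc)
  have "(\<integral>x. max 0 (s * g0 x) \<partial>lborel) = 0" if "s = 1 \<or> s = -1" for s
  proof -
    have "{x. 0 < s * g0 x} \<in> sets borel" by measurable
    from int0[OF this] have "s * (\<integral>x. indicator {x. 0 < s * g0 x} x * g0 x \<partial>lborel) = 0" by simp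
    also have "s * (\<integral>x. indicator {x. 0 < s * g0 x} x * g0 x \<partial>lborel) = (\<integral>x. s * (indicator {x. 0 < s * g0 x} x * g0 x) \<partial>lborel)"
      by simp
    also have "\<dots> = (\<integral>x. max 0 (s * g0 x) \<partial>lborel)"
      by (intro Bochner_Integration.integral_cong) (auto split: split_indicator split_max)
    finally show ?thesis .
  qed
  from this[of 1] this[of "-1"] have z: "(\<integral>x. max 0 (g0 x) \<partial>lborel) = 0" "(\<integral>x. max 0 (- g0 x) \<partial>lborel) = 0"
    by simp_all
  have "AE x in lborel. max 0 (g0 x) = 0"
    using z(1) i by (subst (asm) integral_nonneg_eq_0_iff_AE) auto
  moreover have "AE x in lborel. max 0 (- g0 x) = 0"
    using z(2) i by (subst (asm) integral_nonneg_eq_0_iff_AE) auto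
  ultimately show ?thesis by eventually_elim (auto simp: g0_def max_def split: if_splits)
qed

lemma test_fun_props:
  assumes "test_fun a b \<phi>"
  obtains c d C where "a < c" "c \<le> d" "d < b" "\<And>x. x \<notin> {c..d} \<Longrightarrow> \<phi> x = 0"
    "\<And>x. x \<notin> {c..d} \<Longrightarrow> deriv \<phi> x = 0" "0 < C" "\<And>x. \<bar>\<phi> x\<bar> \<le> C" "\<And>x. \<bar>deriv \<phi> x\<bar> \<le> C"
    "continuous_on UNIV \<phi>" "continuous_on UNIV (deriv \<phi>)"
    "\<And>x. (\<phi> has_field_derivative deriv \<phi> x) (at x)"
proof -
  have diff: "((deriv ^^ n) \<phi>) field_differentiable (at x)" for n x
    using assms by (simp add: test_fun_def)
  obtain c d where cd: "a < c" "c \<le> d" "d < b" "\<And>x. x \<notin> {c..d} \<Longrightarrow> \<phi> x = 0"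
    using assms unfolding test_fun_def by blast
  have der: "(\<phi> has_field_derivative deriv \<phi> x) (at x)" for x
    using diff[of 0 x] by (simp add: field_differentiable_derivI)
  have c0: "continuous_on UNIV \<phi>"
    using der by (meson DERIV_isCont continuous_at_imp_continuous_on)
  have c1: "continuous_on UNIV (deriv \<phi>)"
    using diff[of 1] by (auto intro!: continuous_at_imp_continuous_on field_differentiable_imp_continuous_at)
  have z: "deriv \<phi> x = 0" if "x \<notin> {c..d}" for x
  proof -
    have "\<forall>\<^sub>F y in nhds x. y \<in> - {c..d}"
      using that by (intro eventually_nhds_in_open) auto
    then have "\<forall>\<^sub>F y in nhds x. \<phi> y = 0" by eventually_elim (use cd(4) in auto)
    then have "(\<phi> has_field_derivative 0) (at x)" by (subst DERIV_cong_ev[OF refl _ refl]) auto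
    then show ?thesis by (rule DERIV_imp_deriv)
  qed
  have "bounded (\<phi> ` {c..d})" "bounded (deriv \<phi> ` {c..d})"
    using c0 c1 by (auto intro!: compact_imp_bounded compact_continuous_image intro: continuous_on_subset)
  then obtain B1 B2 where "0 < B1" "\<And>x. x \<in> {c..d} \<Longrightarrow> \<bar>\<phi> x\<bar> \<le> B1" "0 < B2" "\<And>x. x \<in> {c..d} \<Longrightarrow> \<bar>deriv \<phi> x\<bar> \<le> B2"
    unfolding bounded_pos by (metis (no_types, lifting) imageI real_norm_def)
  then have "\<bar>\<phi> x\<bar> \<le> max B1 B2" "\<bar>deriv \<phi> x\<bar> \<le> max B1 B2" "0 < max B1 B2" for x
    using cd(4)[of x] z[of x] by (cases "x \<in> {c..d}"; fastforce simp: le_max_iff_disj)+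
  with that[OF cd(1-3)] cd(4) z c0 c1 der show thesis by blast
qed

section \<open>Integration by parts and the du Bois-Reymond lemma\<close>

lemma sval_bounded:
  assumes "smeas a b D" "A \<in> sets borel"
  shows "\<bar>sval D A\<bar> \<le> measure (fst D) UNIV + measure (snd D) UNIV"
proof -
  interpret M: finite_measure "fst D" using assms fin_meas_onD(3) by (auto simp: smeas_def)
  interpret N: finite_measure "snd D" using assms fin_meas_onD(3) by (auto simp: smeas_def)
  have "space (fst D) = UNIV" "space (snd D) = UNIV" using assms fin_meas_onD(2) by (auto simp: smeas_def)
  then have "measure (fst D) A \<le> measure (fst D) UNIV" "measure (snd D) A \<le> measure (snd D) UNIV"
    using M.bounded_measure N.bounded_measure by metis+
  then show ?thesis unfolding sval_def using measure_nonneg[of "fst D" A] measure_nonneg[of "snd D" A] by linarith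
qed

lemma measurable_le_kernel[measurable]:
  "(\<lambda>(y, x). indicator {..x} y :: real) \<in> borel_measurable (borel \<Otimes>\<^sub>M (borel :: real measure))"
proof -
  have "(\<lambda>(y, x). indicator {..x} y :: real) = indicator {z. fst z \<le> (snd z :: real)}"
    by (auto simp: fun_eq_iff split: split_indicator)
  moreover have "{z \<in> space (borel \<Otimes>\<^sub>M borel). fst z \<le> (snd z :: real)} \<in> sets (borel \<Otimes>\<^sub>M borel)" by measurable
  then have "{z. fst z \<le> (snd z :: real)} \<in> sets (borel \<Otimes>\<^sub>M borel)" by (simp add: space_pair_measure)
  ultimately show ?thesis by simp
qed

lemma measurable_sval_atMost:
  assumes "smeas a b D"
  shows "(\<lambda>x. sval D {..x}) \<in> borel_measurable borel"
  using measurable_sint_kernel[OF assms measurable_le_kernel] sint_indicator[OF assms] by simp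

text \<open>As \<phi>(y) is minus the integral of \<phi>' over (y, b), this is Fubini's theorem on
  the region y \<le> x. It exhibits the distribution function of \<open>D\<close> as a primitive of
  \<open>D\<close>.\<close>

lemma sint_by_parts:
  assumes "smeas a b D" "test_fun a b \<phi>"
  shows "sint D \<phi> = - (\<integral>x\<in>{a<..<b}. sval D {..x} * deriv \<phi> x \<partial>lborel)"
proof -
  obtain c d C where p: "a < c" "c \<le> d" "d < b" "\<And>x. x \<notin> {c..d} \<Longrightarrow> \<phi> x = 0"
    "\<And>x. x \<notin> {c..d} \<Longrightarrow> deriv \<phi> x = 0" "0 < C" "\<And>x. \<bar>\<phi> x\<bar> \<le> C" "\<And>x. \<bar>deriv \<phi> x\<bar> \<le> C"
    "continuous_on UNIV \<phi>" "continuous_on UNIV (deriv \<phi>)"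
    "\<And>x. (\<phi> has_field_derivative deriv \<phi> x) (at x)"
    using test_fun_props[OF assms(2)] by blast
  have [measurable]: "deriv \<phi> \<in> borel_measurable borel"
    using p(10) by (rule borel_measurable_continuous_onI)
  have cont: "isCont (deriv \<phi>) x" for x using p(10) by (simp add: continuous_on_eq_continuous_at)
  let ?w = "\<lambda>x. indicator {a<..<b} x * deriv \<phi> x"
  have w: "integrable lborel ?w"
    by (rule Bochner_Integration.integrable_bound[where f = "\<lambda>x. C * indicator {a<..<b} x"])
      (use p in \<open>auto intro!: AE_I2 split: split_indicator\<close>)
  have inner: "(\<integral>x. indicator {..x} y * ?w x \<partial>lborel) = - \<phi> y" for y
  proof (cases "y < b")
    case True
    have "(\<integral>x. indicator {..x} y * ?w x \<partial>lborel) = (\<integral>x. deriv \<phi> x * indicator {max y a..b} x \<partial>lborel)"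
      using p by (intro Bochner_Integration.integral_cong) (auto split: split_indicator)
    also have "\<dots> = \<phi> b - \<phi> (max y a)"
      using True p cont by (intro integral_FTC_Icc_real) auto
    also have "\<dots> = - \<phi> y" using p by (auto simp: max_def)
    finally show ?thesis .
  next
    case False
    then have "indicator {..x} y * ?w x = 0" for x by (auto split: split_indicator)
    then have "(\<integral>x. indicator {..x} y * ?w x \<partial>lborel) = 0"
      by (simp only: Bochner_Integration.integral_zero)
    then show ?thesis using p False by simp
  qed
  have "- sint D \<phi> = sint D (\<lambda>y. \<integral>x. indicator {..x} y * ?w x \<partial>lborel)"
    unfolding inner by (simp add: sint_def)
  also have "\<dots> = (\<integral>x. sint D (\<lambda>y. indicator {..x} y) * ?w x \<partial>lborel)"
    by (rule Fubini_sint(1)[OF assms(1) measurable_le_kernel _ w, where C = 1]) (auto split: split_indicator)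
  also have "\<dots> = (\<integral>x\<in>{a<..<b}. sval D {..x} * deriv \<phi> x \<partial>lborel)"
    using sint_indicator[OF assms(1)] unfolding set_lebesgue_integral_def
    by (intro Bochner_Integration.integral_cong) auto
  finally show ?thesis by simp
qed

lemma L1_bounded:
  assumes "f \<in> borel_measurable borel" "\<And>x. x \<in> {a<..<b} \<Longrightarrow> \<bar>f x\<bar> \<le> C"
  shows "L1 a b f"
  unfolding L1_iff
proof (rule Bochner_Integration.integrable_bound)
  show "integrable lborel (\<lambda>x. C * indicator {a<..<b} x :: real)"
    using emeasure_lborel_box_finite[of a b] by (intro integrable_mult_right integrable_real_indicator) auto
  show "(\<lambda>x. indicator {a<..<b} x * f x) \<in> borel_measurable lborel" using assms(1) by measurable
  show "AE x in lborel. norm (indicator {a<..<b} x * f x) \<le> norm (C * indicator {a<..<b} x :: real)"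
    using assms(2) by (intro AE_I2) (force split: split_indicator)
qed

lemma L1_add: "L1 a b f \<Longrightarrow> L1 a b g \<Longrightarrow> L1 a b (\<lambda>x. f x + g x)"
  by (simp add: L1_iff distrib_left)

lemma L1_diff: "L1 a b f \<Longrightarrow> L1 a b g \<Longrightarrow> L1 a b (\<lambda>x. f x - g x)"
  by (simp add: L1_iff right_diff_distrib)

lemma L1_cmult: "L1 a b f \<Longrightarrow> L1 a b (\<lambda>x. c * f x)"
  by (auto simp: L1_iff mult.left_commute)

text \<open>The primitive starting at \<open>a\<close> vanishes to the left of the support because
  nothing has been integrated yet, and to the right because the total integral is zero. Hence its
  support is again compact in (a, b).\<close>

lemma smooth_gen_antiderivative:
  assumes f: "smooth_gen f" and cd: "a < c" "d < b" "c \<le> d" and z: "\<And>x. x \<notin> {c..d} \<Longrightarrow> f x = 0"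
    and 0: "(\<integral>x\<in>{a<..<b}. f x \<partial>lborel) = 0"
  obtains F where "test_fun a b F" "deriv F = f"
proof -
  define F where "F = (\<lambda>x. integral {a..x} f)"
  have cont: "continuous_on A f" for A by (rule continuous_smooth_gen[OF f])
  have [measurable]: "f \<in> borel_measurable borel" by (rule borel_measurable_continuous_onI[OF cont])
  have int: "set_integrable lborel {a..x} f" for x
    by (intro borel_integrable_atLeastAtMost') (rule cont)
  have F0: "F x = 0" if "x \<notin> {c..d}" for x
  proof (cases "x < c")
    case True
    have "integral {a..x} f = integral {a..x} (\<lambda>_. 0)"
      using True z by (intro integral_cong) auto
    then show ?thesis by (simp add: F_def)
  next
    case False
    then have x: "d < x" using that by auto
    have "F x = (\<integral>t\<in>{a..x}. f t \<partial>lborel)"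
      unfolding F_def by (rule set_borel_integral_eq_integral(2)[OF int, symmetric])
    also have "\<dots> = (\<integral>t\<in>{a<..<b}. f t \<partial>lborel)"
      unfolding set_lebesgue_integral_def
      using x cd z by (intro Bochner_Integration.integral_cong) (auto split: split_indicator)
    finally show ?thesis using 0 by simp
  qed
  have der: "(F has_field_derivative f x) (at x)" for x
  proof (cases "x \<in> {c..d}")
    case True
    have "(F has_field_derivative f x) (at x within {a..b})"
      unfolding F_def using True cd by (intro integral_has_real_derivative cont) auto
    moreover have "at x within {a..b} = at x"
      using True cd by (intro at_within_interior) auto
    ultimately show ?thesis by simp
  next
    case False
    have "\<forall>\<^sub>F y in nhds x. y \<in> - {c..d}"
      using False by (intro eventually_nhds_in_open) auto
    then have "\<forall>\<^sub>F y in nhds x. F y = 0" by eventually_elim (use F0 in auto)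
    then show ?thesis using z[OF False] by (subst DERIV_cong_ev[OF refl _ refl]) auto
  qed
  have "test_fun a b F"
    unfolding test_fun_def
    using smooth_antiderivative_differentiable[OF f der] F0 cd by blast
  moreover have "deriv F = f" using der by (auto intro: DERIV_imp_deriv)
  ultimately show thesis by (rule that)
qed

text \<open>A cutoff becomes the derivative of a test function once a multiple of one fixed cutoff
  is subtracted to make its integral zero. Hence \<open>k\<close> and a constant have the same
  integrals against all the cutoffs that determine a measure.\<close>

lemma du_Bois_Reymond:
  assumes ab: "a < b" and k: "L1 a b k"
    and 0: "\<And>\<phi>. test_fun a b \<phi> \<Longrightarrow> (\<integral>x\<in>{a<..<b}. k x * deriv \<phi> x \<partial>lborel) = 0"
  shows "\<exists>c. AE x in lborel. x \<in> {a<..<b} \<longrightarrow> k x = c"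
proof -
  let ?I = "\<lambda>f. \<integral>x\<in>{a<..<b}. f x \<partial>lborel"
  have L: "L1 a b (cutoff c d n)" for c d n
    using cutoff_bounds by (intro L1_bounded[where C = 1]) auto
  have Lk: "L1 a b (\<lambda>x. k x * cutoff c d n x)" for c d n
    using cutoff_bounds by (intro L1_mult_bounded[OF k, where C = 1]) auto
  have add: "?I (\<lambda>x. f x - r * g x) = ?I f - r * ?I g" if "L1 a b f" "L1 a b g" for f g r
    using that unfolding L1_def by simp
  have d1: "L1 a b (\<lambda>_. 1)" by (intro L1_bounded[where C = 1]) auto
  \<comment> \<open>These integrals tend to b - a > 0, which supplies a reference cutoff with
    positive integral.\<close>
  have "(\<lambda>n. ?I (cutoff a b n)) \<longlonglongrightarrow> sval (dens a b (\<lambda>_. 1)) {a<..<b}"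
  proof -
    have "sint (dens a b (\<lambda>_. 1)) (cutoff a b n) = ?I (cutoff a b n)" for n
      using cutoff_bounds by (subst sint_dens[OF d1, where C = 1]) auto
    then show ?thesis using sint_cutoff_tendsto[OF smeas_dens[OF d1], of a b] by simp
  qed
  moreover have "sval (dens a b (\<lambda>_. 1)) {a<..<b} = b - a"
    using ab by (simp add: sval_dens[OF d1] set_lebesgue_integral_def)
  ultimately have "\<forall>\<^sub>F n in sequentially. 0 < ?I (cutoff a b n)"
    using ab by (auto intro: order_tendstoD(1))
  then have "\<forall>\<^sub>F n in sequentially. 0 < ?I (cutoff a b n) \<and> n > 0"
    using eventually_gt_at_top[of 0] by eventually_elim auto
  then obtain m where m: "?I (cutoff a b m) > 0" "m > 0"
    unfolding eventually_sequentially by blast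
  \<comment> \<open>The only possible value: testing \<open>k = K\<close> with the reference cutoff
    forces it.\<close>
  define K where "K = ?I (\<lambda>x. k x * cutoff a b m x) / ?I (cutoff a b m)"
  have main: "?I (\<lambda>x. k x * cutoff c b n x) = K * ?I (cutoff c b n)" if c: "a \<le> c" and n: "n > 0" for c n
  proof -
    define r where "r = ?I (cutoff c b n) / ?I (cutoff a b m)"
    define f where "f = (\<lambda>x. cutoff c b n x - r * cutoff a b m x)"
    have sf: "smooth_gen f"
    proof -
      have eq: "f = (\<lambda>x. cutoff c b n x + (- r) * cutoff a b m x)" by (auto simp: f_def)
      show ?thesis unfolding eq by (intro smooth_gen.intros(2-4) smooth_gen_cutoff)
    qed
    obtain c1 d1 c2 d2 where s: "a < c1" "c1 \<le> d1" "d1 < b" "\<And>x. x \<notin> {c1..d1} \<Longrightarrow> cutoff c b n x = 0"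
      "a < c2" "c2 \<le> d2" "d2 < b" "\<And>x. x \<notin> {c2..d2} \<Longrightarrow> cutoff a b m x = 0"
      using test_fun_cutoff[OF ab c order_refl n] test_fun_cutoff[OF ab order_refl order_refl m(2)]
      unfolding test_fun_def by blast
    have fz: "f x = 0" if "x \<notin> {min c1 c2..max d1 d2}" for x
    proof -
      have "x \<notin> {c1..d1}" "x \<notin> {c2..d2}" using that by auto
      then show ?thesis using s(4) s(8) by (simp add: f_def)
    qed
    have "?I f = 0" unfolding f_def using m(1) by (subst add[OF L L]) (simp add: r_def)
    then obtain F where F: "test_fun a b F" "deriv F = f"
      using smooth_gen_antiderivative[OF sf, of a "min c1 c2" "max d1 d2" b] s fz by (auto simp: le_max_iff_disj min_le_iff_disj)
    have "0 = ?I (\<lambda>x. k x * f x)" using 0[OF F(1)] F(2) by simp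
    also have "\<dots> = ?I (\<lambda>x. k x * cutoff c b n x - r * (k x * cutoff a b m x))"
      by (simp add: f_def algebra_simps)
    also have "\<dots> = ?I (\<lambda>x. k x * cutoff c b n x) - r * ?I (\<lambda>x. k x * cutoff a b m x)"
      by (rule add[OF Lk Lk])
    finally show ?thesis by (simp add: r_def K_def)
  qed
  have dK: "L1 a b (\<lambda>_. K)" by (intro L1_bounded[where C = "\<bar>K\<bar>"]) auto
  have kK: "L1 a b (\<lambda>x. k x - K)" by (rule L1_diff[OF k dK])
  have "sval (dens a b (\<lambda>x. k x - K)) A = sval (dens a b (\<lambda>_. 0)) A" if A: "A \<in> sets borel" for A
  proof (rule sval_unique[OF ab smeas_dens[OF kK] smeas_dens _ A])
    show L0: "L1 a b (\<lambda>_. 0)" by (intro L1_bounded[where C = 0]) auto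
    fix c and n :: nat assume cn: "a \<le> c" "n > 0"
    have b: "\<bar>cutoff c b n x\<bar> \<le> 1" for x using cutoff_bounds[of c b n x] by simp
    have "sint (dens a b (\<lambda>x. k x - K)) (cutoff c b n) = ?I (\<lambda>x. k x * cutoff c b n x - K * cutoff c b n x)"
      using sint_dens[OF kK borel_measurable_cutoff b] by (simp add: left_diff_distrib)
    also have "\<dots> = 0" using main[OF cn] by (simp add: add Lk L)
    finally show "sint (dens a b (\<lambda>x. k x - K)) (cutoff c b n) = sint (dens a b (\<lambda>_. 0)) (cutoff c b n)"
      using sint_dens[OF L0 borel_measurable_cutoff b] by simp
  qed
  moreover have "sval (dens a b (\<lambda>_. 0)) A = 0" if "A \<in> sets borel" for A
    using that by (subst sval_dens) (auto intro: L1_bounded[where C = 0])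
  ultimately have "AE x in lborel. x \<in> {a<..<b} \<longrightarrow> k x - K = 0"
    by (intro AE_zero_if_dens_null[OF kK]) auto
  then show ?thesis by (intro exI[of _ K]) auto
qed

text \<open>By \<open>sint_by_parts\<close> the distribution function of \<open>D\<close> has the
  same distributional derivative as \<open>u\<close>, so the two differ by a constant. Functions of
  bounded variation are handled through this right-continuous representative from here on.\<close>

lemma meas_deriv_primitive:
  assumes "a < b" "meas_deriv a b u D"
  shows "\<exists>c. AE x in lborel. x \<in> {a<..<b} \<longrightarrow> u x = c + sval D {..x}"
proof -
  have u: "L1 a b u" and D: "smeas a b D" using assms(2) by (auto simp: meas_deriv_def)
  note [measurable] = measurable_sval_atMost[OF D]
  have w: "L1 a b (\<lambda>x. sval D {..x})"
    by (rule L1_bounded[OF _ sval_bounded[OF D]]) auto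
  have "\<exists>c. AE x in lborel. x \<in> {a<..<b} \<longrightarrow> u x - sval D {..x} = c"
  proof (rule du_Bois_Reymond[OF assms(1) L1_diff[OF u w]])
    fix \<phi> assume \<phi>: "test_fun a b \<phi>"
    obtain C where C: "\<And>x. \<bar>deriv \<phi> x\<bar> \<le> C" and m: "deriv \<phi> \<in> borel_measurable borel"
      using test_fun_props[OF \<phi>] borel_measurable_continuous_onI by metis
    have "(\<integral>x\<in>{a<..<b}. u x * deriv \<phi> x \<partial>lborel) = (\<integral>x\<in>{a<..<b}. sval D {..x} * deriv \<phi> x \<partial>lborel)"
      using assms(2) \<phi> sint_by_parts[OF D \<phi>] by (simp add: meas_deriv_def)
    moreover have "L1 a b (\<lambda>x. u x * deriv \<phi> x)" "L1 a b (\<lambda>x. sval D {..x} * deriv \<phi> x)"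
      using L1_mult_bounded[OF _ m C] u w by auto
    ultimately show "(\<integral>x\<in>{a<..<b}. (u x - sval D {..x}) * deriv \<phi> x \<partial>lborel) = 0"
      by (simp add: left_diff_distrib L1_def)
  qed
  then show ?thesis by (simp add: diff_eq_eq)
qed

section \<open>Jumps of functions of bounded variation\<close>

text \<open>\<open>S r\<close> stands for the window of length r to the right or to the left of a
  point, so that both one-sided approximate limits are treated at once.\<close>

lemma average_deviation_tendsto_0:
  fixes S :: "real \<Rightarrow> real set"
  assumes S: "\<And>r. r > 0 \<Longrightarrow> S r \<in> sets borel" "\<And>r. r > 0 \<Longrightarrow> emeasure lborel (S r) = ennreal r"
    and u: "\<And>e. e > 0 \<Longrightarrow> \<forall>\<^sub>F r in at_right 0. AE t in lborel. t \<in> S r \<longrightarrow> \<bar>u t - l\<bar> \<le> e"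
  shows "((\<lambda>r. (\<integral>t\<in>S r. \<bar>u t - l\<bar> \<partial>lborel) / r) \<longlongrightarrow> 0) (at_right 0)"
proof (rule tendstoI)
  fix e :: real assume e: "e > 0"
  have pos: "\<forall>\<^sub>F r in at_right (0::real). r > 0" by (simp add: eventually_at_filter)
  show "\<forall>\<^sub>F r in at_right 0. dist ((\<integral>t\<in>S r. \<bar>u t - l\<bar> \<partial>lborel) / r) 0 < e"
    using u[OF half_gt_zero[OF e]] pos
  proof eventually_elim
    case (elim r)
    have m: "measure lborel (S r) = r" using S(2)[of r] elim by (simp add: measure_def)
    have "(\<integral>t\<in>S r. \<bar>u t - l\<bar> \<partial>lborel) \<le> (\<integral>t. e / 2 * indicator (S r) t \<partial>lborel)"
      unfolding set_lebesgue_integral_def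
    proof (rule integral_mono_AE')
      show "integrable lborel (\<lambda>t. e / 2 * indicator (S r) t :: real)"
        using S[of r] elim by (intro integrable_mult_right) (auto intro!: integrable_real_indicator)
      show "AE t in lborel. indicator (S r) t *\<^sub>R \<bar>u t - l\<bar> \<le> e / 2 * indicator (S r) t"
        using elim(1) by eventually_elim (auto split: split_indicator)
    qed (use e in auto)
    also have "\<dots> = e / 2 * r" using S(1)[of r] elim m by simp
    finally have "(\<integral>t\<in>S r. \<bar>u t - l\<bar> \<partial>lborel) / r \<le> e / 2"
      using elim by (simp add: field_simps)
    moreover have "0 \<le> (\<integral>t\<in>S r. \<bar>u t - l\<bar> \<partial>lborel) / r"
      using elim by (auto intro!: divide_nonneg_pos integral_nonneg simp: set_lebesgue_integral_def)
    ultimately show ?case using e unfolding dist_real_def by linarith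
  qed
qed

text \<open>Gives the definite descriptions in \<open>jump\<close> their meaning: |l1 - l2| is at
  most the sum of the two average deviations, and both tend to 0.\<close>

lemma average_deviation_unique:
  fixes S :: "real \<Rightarrow> real set"
  assumes S: "\<And>r. r > 0 \<Longrightarrow> S r \<in> sets borel" "\<And>r. r > 0 \<Longrightarrow> emeasure lborel (S r) = ennreal r"
    and u: "\<forall>\<^sub>F r in at_right 0. set_integrable lborel (S r) u"
    and 1: "((\<lambda>r. (\<integral>t\<in>S r. \<bar>u t - l1\<bar> \<partial>lborel) / r) \<longlongrightarrow> 0) (at_right 0)"
    and 2: "((\<lambda>r. (\<integral>t\<in>S r. \<bar>u t - l2\<bar> \<partial>lborel) / r) \<longlongrightarrow> 0) (at_right 0)"
  shows "l1 = l2"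
proof -
  have pos: "\<forall>\<^sub>F r in at_right (0::real). r > 0" by (simp add: eventually_at_filter)
  have "\<bar>l1 - l2\<bar> \<le> 0"
  proof (rule tendsto_le[OF _ tendsto_add[OF 1 2, simplified] tendsto_const])
    show "\<forall>\<^sub>F r in at_right 0. \<bar>l1 - l2\<bar> \<le>
        (\<integral>t\<in>S r. \<bar>u t - l1\<bar> \<partial>lborel) / r + (\<integral>t\<in>S r. \<bar>u t - l2\<bar> \<partial>lborel) / r"
      using u pos
    proof eventually_elim
      case (elim r)
      have m: "measure lborel (S r) = r" using S(2)[of r] elim by (simp add: measure_def)
      have c: "set_integrable lborel (S r) (\<lambda>_. l)" for l :: real
        unfolding set_integrable_def using S[of r] elim by (intro integrable_scaleR_left) (auto intro!: integrable_real_indicator)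
      have i: "set_integrable lborel (S r) (\<lambda>t. \<bar>u t - l\<bar>)" for l :: real
        by (intro set_integrable_abs set_integral_diff elim c)
      have "\<bar>l1 - l2\<bar> * r = (\<integral>t\<in>S r. \<bar>l1 - l2\<bar> \<partial>lborel)"
        using S(1)[of r] elim m by (simp add: set_lebesgue_integral_def)
      also have "\<dots> \<le> (\<integral>t\<in>S r. \<bar>u t - l1\<bar> + \<bar>u t - l2\<bar> \<partial>lborel)"
        by (intro set_integral_mono c set_integral_add i) auto
      also have "\<dots> = (\<integral>t\<in>S r. \<bar>u t - l1\<bar> \<partial>lborel) + (\<integral>t\<in>S r. \<bar>u t - l2\<bar> \<partial>lborel)"
        by (intro set_integral_add i)
      finally show ?case using elim by (simp add: field_simps)
    qed
  qed auto
  then show ?thesis by simp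
qed

text \<open>The distribution function is right continuous and has left limits, and these ordinary
  one-sided limits are the approximate ones. They differ by the mass of the point.\<close>

lemma jumps_of_primitive:
  assumes ab: "a < b" and D: "meas_deriv a b u D"
  shows "jset a b u = {x \<in> {a<..<b}. sval D {x} \<noteq> 0}"
    and "x \<in> {a<..<b} \<Longrightarrow> jump u x = sval D {x}"
proof -
  have u: "L1 a b u" and sm: "smeas a b D" using D by (auto simp: meas_deriv_def)
  obtain c where c: "AE x in lborel. x \<in> {a<..<b} \<longrightarrow> u x = c + sval D {..x}"
    using meas_deriv_primitive[OF ab D] by blast
  have fb: "finite_borel_measure (fst D)" "finite_borel_measure (snd D)"
    using sm fin_meas_onD(1,3)
    by (auto simp: smeas_def finite_borel_measure_def finite_borel_measure_axioms_def)
  have R: "((\<lambda>t. c + sval D {..t}) \<longlongrightarrow> c + sval D {..x}) (at_right x)" for x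
    using finite_borel_measure.cdf_is_right_cont[OF fb(1), of x] finite_borel_measure.cdf_is_right_cont[OF fb(2), of x]
    unfolding sval_def continuous_within cdf_def by (intro tendsto_intros)
  have L: "((\<lambda>t. c + sval D {..t}) \<longlongrightarrow> c + sval D {..<x}) (at_left x)" for x
    using finite_borel_measure.cdf_at_left[OF fb(1), of x] finite_borel_measure.cdf_at_left[OF fb(2), of x]
    unfolding sval_def cdf_def by (intro tendsto_intros)
  have sub: "set_integrable lborel S u" if "S \<subseteq> {a<..<b}" "S \<in> sets borel" for S
    using set_integrable_subset[OF u[unfolded L1_def]] that by simp
  have main: "aplim_right u x l \<longleftrightarrow> l = c + sval D {..x}" "aplim_left u x l \<longleftrightarrow> l = c + sval D {..<x}"
    if x: "x \<in> {a<..<b}" for x l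
  proof -
    have er: "\<forall>\<^sub>F r in at_right (0::real). x + r < b \<and> a < x - r"
    proof -
      have "\<forall>\<^sub>F r in at_right (0::real). r \<in> {0<..<min (b - x) (x - a)}"
        using x by (intro eventually_at_right_real) auto
      then show ?thesis by eventually_elim auto
    qed
    have SR: "\<forall>\<^sub>F r in at_right 0. set_integrable lborel {x<..<x+r} u"
      and SL: "\<forall>\<^sub>F r in at_right 0. set_integrable lborel {x-r<..<x} u"
      using er x by (auto elim!: eventually_mono intro!: sub)
    have 1: "aplim_right u x (c + sval D {..x})"
      unfolding aplim_right_def
    proof (rule average_deviation_tendsto_0)
      fix e :: real assume "e > 0"
      then have "\<forall>\<^sub>F t in at_right x. \<bar>(c + sval D {..t}) - (c + sval D {..x})\<bar> < e"
        using tendstoD[OF R, of e x] by (simp add: dist_real_def)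
      then obtain \<delta> where \<delta>: "\<delta> > x" "\<And>t. x < t \<Longrightarrow> t < \<delta> \<Longrightarrow> \<bar>(c + sval D {..t}) - (c + sval D {..x})\<bar> < e"
        unfolding eventually_at_right_field by blast
      have "\<forall>\<^sub>F r in at_right 0. r < \<delta> - x"
        using \<delta>(1) by (intro eventually_at_rightI[of 0 "\<delta> - x"]) auto
      with er show "\<forall>\<^sub>F r in at_right 0. AE t in lborel. t \<in> {x<..<x + r} \<longrightarrow> \<bar>u t - (c + sval D {..x})\<bar> \<le> e"
      proof eventually_elim
        case (elim r)
        show ?case using c
        proof eventually_elim
          case (elim t)
          then show ?case using \<open>x + r < b \<and> a < x - r\<close> \<open>r < \<delta> - x\<close> \<delta>(2)[of t] x by auto
        qed
      qed
    qed auto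
    have 2: "aplim_left u x (c + sval D {..<x})"
      unfolding aplim_left_def
    proof (rule average_deviation_tendsto_0)
      fix e :: real assume "e > 0"
      then have "\<forall>\<^sub>F t in at_left x. \<bar>(c + sval D {..t}) - (c + sval D {..<x})\<bar> < e"
        using tendstoD[OF L, of e x] by (simp add: dist_real_def)
      then obtain \<delta> where \<delta>: "\<delta> < x" "\<And>t. \<delta> < t \<Longrightarrow> t < x \<Longrightarrow> \<bar>(c + sval D {..t}) - (c + sval D {..<x})\<bar> < e"
        unfolding eventually_at_left_field by blast
      have "\<forall>\<^sub>F r in at_right 0. r < x - \<delta>"
        using \<delta>(1) by (intro eventually_at_rightI[of 0 "x - \<delta>"]) auto
      with er show "\<forall>\<^sub>F r in at_right 0. AE t in lborel. t \<in> {x - r<..<x} \<longrightarrow> \<bar>u t - (c + sval D {..<x})\<bar> \<le> e"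
      proof eventually_elim
        case (elim r)
        show ?case using c
        proof eventually_elim
          case (elim t)
          then show ?case using \<open>x + r < b \<and> a < x - r\<close> \<open>r < x - \<delta>\<close> \<delta>(2)[of t] x by auto
        qed
      qed
    qed auto
    show "aplim_right u x l \<longleftrightarrow> l = c + sval D {..x}"
      using 1 average_deviation_unique[where S = "\<lambda>r. {x<..<x + r}", OF _ _ SR]
      unfolding aplim_right_def by fastforce
    show "aplim_left u x l \<longleftrightarrow> l = c + sval D {..<x}"
      using 2 average_deviation_unique[where S = "\<lambda>r. {x - r<..<x}", OF _ _ SL]
      unfolding aplim_left_def by fastforce
  qed
  have pt: "sval D {..x} = sval D {..<x} + sval D {x}" for x
  proof -
    have "measure M {..x} = measure M {..<x} + measure M {x}" if M: "fin_meas_on a b M" for M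
    proof -
      interpret finite_measure M by (rule fin_meas_onD(3)[OF M])
      have "measure M ({..<x} \<union> {x}) = measure M {..<x} + measure M {x}"
        using fin_meas_onD(1)[OF M] by (intro finite_measure_Union) auto
      moreover have "{..<x} \<union> {x} = {..x}" by auto
      ultimately show ?thesis by simp
    qed
    then show ?thesis using sm by (simp add: sval_def smeas_def)
  qed
  show "jset a b u = {x \<in> {a<..<b}. sval D {x} \<noteq> 0}"
    unfolding jset_def using main pt by (intro Collect_cong) fastforce
  assume x: "x \<in> {a<..<b}"
  show "jump u x = sval D {x}"
    using main[OF x] pt[of x] by (simp add: jump_def)
qed

section \<open>The limit energy in terms of the total variation\<close>

definition polar :: "real \<Rightarrow> real \<Rightarrow> smeasure \<Rightarrow> real measure \<Rightarrow> (real \<Rightarrow> real) \<Rightarrow> bool" where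
  "polar a b \<gamma> \<tau> \<sigma> \<longleftrightarrow> smeas a b \<gamma> \<and> fin_meas_on a b \<tau> \<and> \<sigma> \<in> borel_measurable borel \<and> (\<forall>x. \<bar>\<sigma> x\<bar> = 1) \<and>
     (\<forall>\<phi> C. \<phi> \<in> borel_measurable borel \<longrightarrow> (\<forall>x. \<bar>\<phi> x\<bar> \<le> C) \<longrightarrow> sint \<gamma> \<phi> = (\<integral>x. \<phi> x * \<sigma> x \<partial>\<tau>))"

lemma ex_polar:
  assumes "smeas a b \<gamma>"
  shows "\<exists>\<tau> \<sigma>. polar a b \<gamma> \<tau> \<sigma>"
proof (rule polar_decomposition[OF assms])
  fix \<tau> \<sigma>
  assume "fin_meas_on a b \<tau>" "\<sigma> \<in> borel_measurable borel" "\<And>x. \<bar>\<sigma> x\<bar> = 1"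
    "\<And>\<phi> C. \<phi> \<in> borel_measurable borel \<Longrightarrow> (\<And>x. \<bar>\<phi> x\<bar> \<le> C) \<Longrightarrow> sint \<gamma> \<phi> = (\<integral>x. \<phi> x * \<sigma> x \<partial>\<tau>)"
  then have "polar a b \<gamma> \<tau> \<sigma>" using assms by (auto simp: polar_def)
  then show ?thesis by blast
qed

lemma polarD:
  assumes "polar a b \<gamma> \<tau> \<sigma>"
  shows "smeas a b \<gamma>" "fin_meas_on a b \<tau>" "\<sigma> \<in> borel_measurable borel" "\<bar>\<sigma> x\<bar> = 1"
    "finite_measure \<tau>" "sets \<tau> = sets borel" "space \<tau> = UNIV"
    "\<And>\<phi> C. \<phi> \<in> borel_measurable borel \<Longrightarrow> (\<And>x. \<bar>\<phi> x\<bar> \<le> C) \<Longrightarrow> sint \<gamma> \<phi> = (\<integral>x. \<phi> x * \<sigma> x \<partial>\<tau>)"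
  using assms fin_meas_onD[of a b \<tau>] unfolding polar_def by blast+

lemma sval_polar:
  assumes "polar a b \<gamma> \<tau> \<sigma>" "A \<in> sets borel"
  shows "sval \<gamma> A = (\<integral>x. indicator A x * \<sigma> x \<partial>\<tau>)"
  using polarD(8)[OF assms(1), of "indicator A" 1] sint_indicator[OF polarD(1)[OF assms(1)] assms(2)] assms(2)
  by (simp add: indicator_def)

lemma abs_sint_le:
  assumes p: "polar a b \<gamma> \<tau> \<sigma>" and \<phi>: "\<phi> \<in> borel_measurable borel" "\<And>x. \<bar>\<phi> x\<bar> \<le> C"
  shows "\<bar>sint \<gamma> \<phi>\<bar> \<le> (\<integral>x. \<bar>\<phi> x\<bar> \<partial>\<tau>)"
proof -
  have "\<bar>sint \<gamma> \<phi>\<bar> \<le> (\<integral>x. \<bar>\<phi> x * \<sigma> x\<bar> \<partial>\<tau>)"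
    unfolding polarD(8)[OF p \<phi>] by (rule integral_abs_bound)
  then show ?thesis by (simp add: abs_mult polarD(4)[OF p])
qed

lemma abs_sval_le:
  assumes "polar a b \<gamma> \<tau> \<sigma>" "A \<in> sets borel"
  shows "\<bar>sval \<gamma> A\<bar> \<le> measure \<tau> A"
proof -
  have "\<bar>sint \<gamma> (indicator A)\<bar> \<le> (\<integral>x. \<bar>indicator A x :: real\<bar> \<partial>\<tau>)"
    using assms(2) by (intro abs_sint_le[OF assms(1), where C = 1]) (auto simp: indicator_def)
  also have "(\<integral>x. \<bar>indicator A x :: real\<bar> \<partial>\<tau>) = (\<integral>x. indicator A x \<partial>\<tau>)"
    by (intro Bochner_Integration.integral_cong) (auto simp: indicator_def)
  also have "\<dots> = measure \<tau> A" using assms(2) polarD(6,7)[OF assms(1)] by simp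
  finally show ?thesis by (simp add: sint_indicator[OF polarD(1)[OF assms(1)] assms(2)])
qed

text \<open>On a single point \<open>\<sigma>\<close> is constant, so there is no cancellation. This
  is why the sizes of the jumps are the atoms of \<open>\<tau>\<close>.\<close>

lemma abs_sval_singleton:
  assumes "polar a b \<gamma> \<tau> \<sigma>"
  shows "\<bar>sval \<gamma> {x}\<bar> = measure \<tau> {x}"
proof -
  have "sval \<gamma> {x} = (\<integral>y. indicator {x} y * \<sigma> y \<partial>\<tau>)" by (rule sval_polar[OF assms]) auto
  also have "\<dots> = (\<integral>y. indicator {x} y * \<sigma> x \<partial>\<tau>)"
    by (intro Bochner_Integration.integral_cong) (auto split: split_indicator)
  also have "\<dots> = measure \<tau> {x} * \<sigma> x"
    using polarD(6,7)[OF assms] by simp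
  finally show ?thesis using polarD(4)[OF assms] by (simp add: abs_mult)
qed

section \<open>The capped total variation and the limit energy from below\<close>

definition qcap :: "real \<Rightarrow> real" where "qcap t = (if t \<le> 2 then 1 else 2 / t)"

lemma qcap_bounds: "0 \<le> qcap t" "qcap t \<le> 1" by (auto simp: qcap_def)

lemma qcap_mult: "t \<ge> 0 \<Longrightarrow> t * qcap t = min t 2" by (auto simp: qcap_def)

lemma qcap_antimono: "s \<le> t \<Longrightarrow> qcap t \<le> qcap s"
  by (auto simp: qcap_def field_simps)

lemma qcap_measurable[measurable]: "qcap \<in> borel_measurable borel"
  unfolding qcap_def[abs_def] by measurable

lemma fcap_eq: "t \<ge> 0 \<Longrightarrow> 2 * fcap c0 (t / 2) = c0 * min t 2"
  by (auto simp: fcap_def)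

text \<open>Up to the factor \<open>c0\<close>, the part of the limit energy that depends on \<open>\<gamma>\<close>, with \<open>\<tau>\<close> its total variation.\<close>
definition capped :: "real measure \<Rightarrow> ennreal" where
  "capped \<tau> = (\<integral>\<^sup>+x. ennreal (qcap (measure \<tau> {x})) \<partial>\<tau>)"

text \<open>The mass of a point is a difference of two monotone functions.\<close>

lemma measurable_atom_mass:
  assumes "fin_meas_on a b \<tau>"
  shows "(\<lambda>x. measure \<tau> {x}) \<in> borel_measurable borel"
proof -
  interpret finite_measure \<tau> by (rule fin_meas_onD(3)[OF assms])
  note s = fin_meas_onD(1)[OF assms]
  have [measurable]: "(\<lambda>x. measure \<tau> {..x}) \<in> borel_measurable borel" "(\<lambda>x. measure \<tau> {..<x}) \<in> borel_measurable borel"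
  proof -
    have "mono (\<lambda>x. measure \<tau> {..x})" "mono (\<lambda>x. measure \<tau> {..<x})"
      by (intro monoI finite_measure_mono; use s in force)+
    then show "(\<lambda>x. measure \<tau> {..x}) \<in> borel_measurable borel" "(\<lambda>x. measure \<tau> {..<x}) \<in> borel_measurable borel"
      by (simp_all add: borel_measurable_mono)
  qed
  have "measure \<tau> {x} = measure \<tau> {..x} - measure \<tau> {..<x}" for x
  proof -
    have "measure \<tau> ({..x} - {..<x}) = measure \<tau> {..x} - measure \<tau> {..<x}"
      using s by (intro finite_measure_Diff) auto
    moreover have "{..x} - {..<x} = {x}" by auto
    ultimately show ?thesis by simp
  qed
  then show ?thesis by simp
qed

text \<open>Off the atoms the weight is \<open>qcap 0 = 1\<close>; on the countable set of atoms,
  mass times weight is the minimum with 2 by \<open>qcap_mult\<close>. This separates the diffuse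
  cost from the jump cost.\<close>

lemma capped_eq:
  assumes "fin_meas_on a b \<tau>" and J: "J = {x. measure \<tau> {x} \<noteq> 0}"
  shows "J \<in> sets borel" "countable J"
    "capped \<tau> = emeasure \<tau> (UNIV - J) + (\<integral>\<^sup>+x. ennreal (min (measure \<tau> {x}) 2) \<partial>count_space J)"
proof -
  interpret finite_measure \<tau> by (rule fin_meas_onD(3)[OF assms(1)])
  have s[measurable_cong]: "sets \<tau> = sets borel" by (rule fin_meas_onD(1)[OF assms(1)])
  have sp: "space \<tau> = UNIV" by (rule fin_meas_onD(2)[OF assms(1)])
  note [measurable] = measurable_atom_mass[OF assms(1)]
  show cJ: "countable J" unfolding J using countable_support by simp
  then show J': "J \<in> sets borel" by (simp add: sets.countable)
  define \<nu> where "\<nu> = density \<tau> (\<lambda>x. ennreal (qcap (measure \<tau> {x})))"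
  have "capped \<tau> = emeasure \<nu> UNIV"
    unfolding \<nu>_def capped_def using s sp by (subst emeasure_density) auto
  also have "\<dots> = emeasure \<nu> (UNIV - J) + emeasure \<nu> J"
    using J' s by (subst plus_emeasure) (auto simp: \<nu>_def)
  also have "emeasure \<nu> (UNIV - J) = (\<integral>\<^sup>+x. indicator (UNIV - J) x \<partial>\<tau>)"
  proof -
    have nz: "x \<notin> J \<Longrightarrow> qcap (measure \<tau> {x}) = 1" for x by (simp add: J qcap_def)
    have "emeasure \<nu> (UNIV - J) = (\<integral>\<^sup>+x. ennreal (qcap (measure \<tau> {x})) * indicator (UNIV - J) x \<partial>\<tau>)"
      unfolding \<nu>_def using J' s by (subst emeasure_density) auto
    also have "\<dots> = (\<integral>\<^sup>+x. indicator (UNIV - J) x \<partial>\<tau>)"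
      by (intro nn_integral_cong) (auto simp: nz split: split_indicator)
    finally show ?thesis .
  qed
  also have "\<dots> = emeasure \<tau> (UNIV - J)" using J' s by simp
  also have "emeasure \<nu> J = (\<integral>\<^sup>+x. emeasure \<nu> {x} \<partial>count_space J)"
    using cJ s by (intro emeasure_countable_singleton) (auto simp: \<nu>_def)
  also have "\<dots> = (\<integral>\<^sup>+x. ennreal (min (measure \<tau> {x}) 2) \<partial>count_space J)"
  proof (rule nn_integral_cong)
    fix x
    have "emeasure \<nu> {x} = (\<integral>\<^sup>+y. ennreal (qcap (measure \<tau> {x})) * indicator {x} y \<partial>\<tau>)"
      unfolding \<nu>_def using s by (subst emeasure_density) (auto intro!: nn_integral_cong split: split_indicator)
    also have "\<dots> = ennreal (qcap (measure \<tau> {x}) * measure \<tau> {x})"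
      using s by (simp add: nn_integral_cmult_indicator emeasure_eq_measure ennreal_mult qcap_bounds)
    finally show "emeasure \<nu> {x} = ennreal (min (measure \<tau> {x}) 2)"
      using qcap_mult[of "measure \<tau> {x}"] by (simp add: mult.commute)
  qed
  finally show "capped \<tau> = emeasure \<tau> (UNIV - J) + (\<integral>\<^sup>+x. ennreal (min (measure \<tau> {x}) 2) \<partial>count_space J)" .
qed

text \<open>In the applications \<open>D\<close> and \<open>\<gamma>\<close> differ by an absolutely
  continuous measure and therefore have the same atoms. The factor 2 in front and the 1/2 inside
  \<open>fcap\<close> combine to c0 times the minimum with 2.\<close>

lemma jump_energy_eq:
  assumes ab: "a < b" and D: "meas_deriv a b u D" and p: "polar a b \<gamma> \<tau> \<sigma>" and c0: "c0 \<ge> 0"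
    and eq: "\<And>x. sval D {x} = sval \<gamma> {x}"
  shows "jset a b u = {x. measure \<tau> {x} \<noteq> 0}"
    and "2 * (\<integral>\<^sup>+x. ennreal (fcap c0 (\<bar>jump u x\<bar> / 2)) \<partial>count_space (jset a b u)) =
      ennreal c0 * (\<integral>\<^sup>+x. ennreal (min (measure \<tau> {x}) 2) \<partial>count_space {x. measure \<tau> {x} \<noteq> 0})"
proof -
  have out: "measure \<tau> {x} = 0" if "x \<notin> {a<..<b}" for x
    using that by (intro measure_fin_meas_null[OF polarD(2)[OF p]]) auto
  show J: "jset a b u = {x. measure \<tau> {x} \<noteq> 0}"
  proof (rule set_eqI)
    fix x
    show "x \<in> jset a b u \<longleftrightarrow> x \<in> {x. measure \<tau> {x} \<noteq> 0}"
      unfolding jumps_of_primitive(1)[OF ab D] mem_Collect_eq eq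
      using abs_sval_singleton[OF p, of x] out[of x] by (metis abs_eq_0)
  qed
  have "2 * (\<integral>\<^sup>+x. ennreal (fcap c0 (\<bar>jump u x\<bar> / 2)) \<partial>count_space (jset a b u)) =
     (\<integral>\<^sup>+x. 2 * ennreal (fcap c0 (\<bar>jump u x\<bar> / 2)) \<partial>count_space (jset a b u))"
    by (simp add: nn_integral_cmult)
  also have "\<dots> = (\<integral>\<^sup>+x. ennreal c0 * ennreal (min (measure \<tau> {x}) 2) \<partial>count_space (jset a b u))"
  proof (rule nn_integral_cong)
    fix x assume "x \<in> space (count_space (jset a b u))"
    then have "x \<in> {a<..<b}" by (simp add: jset_def)
    then have "\<bar>jump u x\<bar> = measure \<tau> {x}"
      using jumps_of_primitive(2)[OF ab D] abs_sval_singleton[OF p] eq by simp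
    then have "2 * fcap c0 (\<bar>jump u x\<bar> / 2) = c0 * min (measure \<tau> {x}) 2"
      using fcap_eq[of "measure \<tau> {x}" c0] by simp
    moreover have "2 * ennreal (fcap c0 (\<bar>jump u x\<bar> / 2)) = ennreal (2 * fcap c0 (\<bar>jump u x\<bar> / 2))"
      using c0 by (subst ennreal_mult') auto
    ultimately show "2 * ennreal (fcap c0 (\<bar>jump u x\<bar> / 2)) = ennreal c0 * ennreal (min (measure \<tau> {x}) 2)"
      using c0 by (simp add: ennreal_mult)
  qed
  also have "\<dots> = ennreal c0 * (\<integral>\<^sup>+x. ennreal (min (measure \<tau> {x}) 2) \<partial>count_space {x. measure \<tau> {x} \<noteq> 0})"
    by (simp add: nn_integral_cmult J)
  finally show "2 * (\<integral>\<^sup>+x. ennreal (fcap c0 (\<bar>jump u x\<bar> / 2)) \<partial>count_space (jset a b u)) =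
      ennreal c0 * (\<integral>\<^sup>+x. ennreal (min (measure \<tau> {x}) 2) \<partial>count_space {x. measure \<tau> {x} \<noteq> 0})" .
qed

lemma set_integral_abs_eq_nn_integral:
  assumes "L1 a b g"
  shows "(\<integral>\<^sup>+x\<in>{a<..<b}. ennreal \<bar>g x\<bar> \<partial>lborel) = ennreal (\<integral>x\<in>{a<..<b}. \<bar>g x\<bar> \<partial>lborel)"
proof -
  have "integrable lborel (\<lambda>x. \<bar>indicator {a<..<b} x * g x\<bar>)"
    using assms by (intro integrable_abs) (simp add: L1_iff)
  moreover have "\<bar>indicator {a<..<b} x * g x\<bar> = indicator {a<..<b} x * \<bar>g x\<bar>" for x
    by (auto split: split_indicator)
  ultimately have "ennreal (\<integral>x\<in>{a<..<b}. \<bar>g x\<bar> \<partial>lborel) = (\<integral>\<^sup>+x. ennreal (indicator {a<..<b} x * \<bar>g x\<bar>) \<partial>lborel)"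
    by (subst nn_integral_eq_integral) (auto simp: set_lebesgue_integral_def)
  also have "\<dots> = (\<integral>\<^sup>+x\<in>{a<..<b}. ennreal \<bar>g x\<bar> \<partial>lborel)"
    by (intro nn_integral_cong) (auto split: split_indicator)
  finally show ?thesis by simp
qed

text \<open>Off the atoms \<open>\<tau>\<close> is recovered from \<open>\<gamma>\<close> by
  splitting along the sign of \<open>\<sigma>\<close>. On either piece \<open>\<gamma>\<close> is
  \<open>Ds\<close> plus g dx; the first is controlled by its variation and the second by the
  integral of |g|. The bound is stated for an arbitrary witness because \<open>Elim\<close> is an
  infimum.\<close>

lemma Elim_witness_ge:
  assumes ab: "a < b" and c0: "c0 \<ge> 0" and p: "polar a b \<gamma> \<tau> \<sigma>"
    and BV: "BV_decomp a b u Du v Ds" and g: "L1 a b g"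
    and \<gamma>: "\<And>A. A \<in> sets borel \<Longrightarrow> sval \<gamma> A = sval Ds A + (\<integral>x\<in>A \<inter> {a<..<b}. g x \<partial>lborel)"
  shows "ennreal c0 * capped \<tau> \<le> ennreal c0 * (\<integral>\<^sup>+x\<in>{a<..<b}. ennreal \<bar>g x\<bar> \<partial>lborel)
          + 2 * (\<integral>\<^sup>+x. ennreal (fcap c0 (\<bar>jump u x\<bar> / 2)) \<partial>count_space (jset a b u))
          + ennreal c0 * tvar (\<lambda>A. sval Ds (A - jset a b u)) {a<..<b}"
proof -
  have D: "meas_deriv a b u Du" and v: "L1 a b v" and sD: "smeas a b Ds" 
    and Du: "\<And>A. A \<in> sets borel \<Longrightarrow> sval Du A = (\<integral>x\<in>A \<inter> {a<..<b}. v x \<partial>lborel) + sval Ds A"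
    using BV by (auto simp: BV_decomp_def)
  have pt: "(\<integral>x\<in>{y} \<inter> {a<..<b}. f x \<partial>lborel) = 0" for f :: "real \<Rightarrow> real" and y
  proof -
    have "emeasure lborel ({y} \<inter> {a<..<b}) = 0"
      by (rule emeasure_eq_0[of "{y}"]) auto
    then have "AE x in lborel. x \<notin> {y} \<inter> {a<..<b}" by (intro AE_not_in null_setsI) auto
    then have "AE x in lborel. indicator ({y} \<inter> {a<..<b}) x *\<^sub>R f x = 0" by eventually_elim simp
    then show ?thesis unfolding set_lebesgue_integral_def by (rule integral_eq_zero_AE)
  qed
  have eq: "sval Du {x} = sval \<gamma> {x}" for x
    using Du[of "{x}"] \<gamma>[of "{x}"] by (simp add: pt)
  define J where "J = jset a b u"
  have J: "J = {x. measure \<tau> {x} \<noteq> 0}" unfolding J_def by (rule jump_energy_eq(1)[OF ab D p c0 eq])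
  note cap = capped_eq[OF polarD(2)[OF p] J]
  interpret finite_measure \<tau> by (rule polarD(5)[OF p])
  note [measurable] = polarD(3)[OF p] cap(1)
  define P where "P = {x. \<sigma> x = 1}"
  have Pm[measurable]: "P \<in> sets borel" unfolding P_def by measurable
  have \<sigma>: "\<sigma> x = (if x \<in> P then 1 else -1)" for x
    using polarD(4)[OF p, of x] by (auto simp: P_def abs_if split: if_splits)
  let ?Q = "(UNIV - P) :: real set"
  \<comment> \<open>Since \<sigma>^2 = 1, one factor can be read as the sign of the piece while the
    other turns \<open>\<tau>\<close> back into \<open>\<gamma>\<close>.\<close>
  have "measure \<tau> (UNIV - J) = (\<integral>x. (indicator (UNIV - J) x * \<sigma> x) * \<sigma> x \<partial>\<tau>)"
  proof -
    have "\<sigma> x * \<sigma> x = 1" for x by (simp add: \<sigma>)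
    then show ?thesis using cap(1) polarD(6,7)[OF p] by (simp add: mult.assoc)
  qed
  also have "\<dots> = (\<integral>x. indicator (P - J) x * \<sigma> x - indicator (?Q - J) x * \<sigma> x \<partial>\<tau>)"
    by (intro Bochner_Integration.integral_cong) (auto simp: \<sigma> split: split_indicator)
  also have "\<dots> = sval \<gamma> (P - J) - sval \<gamma> (?Q - J)"
    using polarD(3,4)[OF p]
    by (subst Bochner_Integration.integral_diff)
       (auto simp: sval_polar[OF p] abs_mult intro!: integrable_fin_meas[OF polarD(2)[OF p], where C = 1] split: split_indicator)
  also have "\<dots> = (sval Ds (P - J) - sval Ds (?Q - J)) + ((\<integral>x\<in>(P - J) \<inter> {a<..<b}. g x \<partial>lborel) - (\<integral>x\<in>(?Q - J) \<inter> {a<..<b}. g x \<partial>lborel))"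
    by (simp add: \<gamma>)
  also have "\<dots> \<le> (\<bar>sval Ds (P - J)\<bar> + \<bar>sval Ds (?Q - J)\<bar>) + (\<integral>x\<in>{a<..<b}. \<bar>g x\<bar> \<partial>lborel)"
  proof -
    have gi: "set_integrable lborel {a<..<b} g" using g by (simp add: L1_def)
    have s1: "set_integrable lborel ((P - J) \<inter> {a<..<b}) g" "set_integrable lborel ((?Q - J) \<inter> {a<..<b}) g"
      by (rule set_integrable_subset[OF gi]; auto)+
    have "(\<integral>x\<in>(P - J) \<inter> {a<..<b}. g x \<partial>lborel) - (\<integral>x\<in>(?Q - J) \<inter> {a<..<b}. g x \<partial>lborel) =
        (\<integral>x. indicator ((P - J) \<inter> {a<..<b}) x * g x - indicator ((?Q - J) \<inter> {a<..<b}) x * g x \<partial>lborel)"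
      using s1 by (simp add: set_lebesgue_integral_def set_integrable_def)
    also have "\<dots> \<le> (\<integral>x\<in>{a<..<b}. \<bar>g x\<bar> \<partial>lborel)"
      unfolding set_lebesgue_integral_def
    proof (rule integral_mono)
      show "integrable lborel (\<lambda>x. indicator ((P - J) \<inter> {a<..<b}) x * g x - indicator ((?Q - J) \<inter> {a<..<b}) x * g x)"
        using s1 by (simp add: set_integrable_def)
      show "integrable lborel (\<lambda>x. indicator {a<..<b} x *\<^sub>R \<bar>g x\<bar>)"
        using set_integrable_abs[OF gi] by (simp add: set_integrable_def)
    qed (auto split: split_indicator)
    finally show ?thesis by linarith
  qed
  finally have 1: "measure \<tau> (UNIV - J) \<le> (\<bar>sval Ds (P - J)\<bar> + \<bar>sval Ds (?Q - J)\<bar>) + (\<integral>x\<in>{a<..<b}. \<bar>g x\<bar> \<partial>lborel)" .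
  have 2: "ennreal (\<bar>sval Ds (P - J)\<bar> + \<bar>sval Ds (?Q - J)\<bar>) \<le> tvar (\<lambda>A. sval Ds (A - J)) {a<..<b}"
  proof -
    \<comment> \<open>\<open>tvar\<close> ranges over sequences of sets, so the partition into two
      sets is padded with empty ones.\<close>
    define A where "A = (\<lambda>n::nat. if n = 0 then P \<inter> {a<..<b} else if n = 1 then ?Q \<inter> {a<..<b} else {})"
    have loc: "sval Ds (B \<inter> {a<..<b} - J) = sval Ds (B - J)" if "B \<in> sets borel" for B
    proof -
      have "(B - J) \<inter> {a<..<b} = B \<inter> {a<..<b} - J" by auto
      then show ?thesis
        using that cap(1) sD measure_fin_meas_Int[of a b "fst Ds" "B - J"] measure_fin_meas_Int[of a b "snd Ds" "B - J"]
        by (simp add: sval_def smeas_def)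
    qed
    have "(\<Sum>n. ennreal \<bar>sval Ds (A n - J)\<bar>) = (\<Sum>n\<in>{0, 1}. ennreal \<bar>sval Ds (A n - J)\<bar>)"
      by (rule suminf_finite) (auto simp: A_def sval_def)
    also have "\<dots> = ennreal (\<bar>sval Ds (P - J)\<bar> + \<bar>sval Ds (?Q - J)\<bar>)"
      using loc[of P] loc[of ?Q] by (simp add: A_def ennreal_plus)
    finally have "(\<Sum>n. ennreal \<bar>sval Ds (A n - J)\<bar>) = ennreal (\<bar>sval Ds (P - J)\<bar> + \<bar>sval Ds (?Q - J)\<bar>)" .
    moreover have "disjoint_family A" "\<And>n. A n \<in> sets borel \<and> A n \<subseteq> {a<..<b}"
      by (auto simp: A_def disjoint_family_on_def split: if_splits)
    ultimately show ?thesis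
      unfolding tvar_def by (intro SUP_upper2[of A]) auto
  qed
  have "emeasure \<tau> (UNIV - J) \<le> tvar (\<lambda>A. sval Ds (A - J)) {a<..<b} + (\<integral>\<^sup>+x\<in>{a<..<b}. ennreal \<bar>g x\<bar> \<partial>lborel)"
  proof -
    have "emeasure \<tau> (UNIV - J) \<le> ennreal ((\<bar>sval Ds (P - J)\<bar> + \<bar>sval Ds (?Q - J)\<bar>) + (\<integral>x\<in>{a<..<b}. \<bar>g x\<bar> \<partial>lborel))"
      unfolding emeasure_eq_measure using 1 by (rule ennreal_leI)
    also have "\<dots> = ennreal (\<bar>sval Ds (P - J)\<bar> + \<bar>sval Ds (?Q - J)\<bar>) + ennreal (\<integral>x\<in>{a<..<b}. \<bar>g x\<bar> \<partial>lborel)"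
      by (intro ennreal_plus) (auto simp: set_lebesgue_integral_def)
    finally show ?thesis unfolding set_integral_abs_eq_nn_integral[OF g] using 2 by (meson add_right_mono order_trans)
  qed
  then have "ennreal c0 * capped \<tau> \<le> ennreal c0 * ((tvar (\<lambda>A. sval Ds (A - J)) {a<..<b} + (\<integral>\<^sup>+x\<in>{a<..<b}. ennreal \<bar>g x\<bar> \<partial>lborel)) +
     (\<integral>\<^sup>+x. ennreal (min (measure \<tau> {x}) 2) \<partial>count_space J))"
    unfolding cap(3) by (intro mult_left_mono add_right_mono) auto
  also have "\<dots> = ennreal c0 * (\<integral>\<^sup>+x\<in>{a<..<b}. ennreal \<bar>g x\<bar> \<partial>lborel)
          + 2 * (\<integral>\<^sup>+x. ennreal (fcap c0 (\<bar>jump u x\<bar> / 2)) \<partial>count_space (jset a b u))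
          + ennreal c0 * tvar (\<lambda>A. sval Ds (A - jset a b u)) {a<..<b}"
    unfolding jump_energy_eq(2)[OF ab D p c0 eq]
    unfolding J[symmetric] J_def[symmetric] by (simp add: distrib_left ac_simps)
  finally show ?thesis .
qed

section \<open>Lebesgue decomposition and the limit energy from above\<close>

lemma integrable_indicator_fin_meas:
  assumes "fin_meas_on a b M" "A \<in> sets borel"
  shows "integrable M (indicator A :: real \<Rightarrow> real)"
  using assms(2) by (intro integrable_fin_meas[OF assms(1), where C = 1]) (auto simp: indicator_def)

lemma emeasure_density_indicator:
  assumes "sets M = sets borel" "A \<in> sets borel" "N \<in> sets borel"
  shows "emeasure (density M (\<lambda>x. ennreal (indicator N x))) A = emeasure M (A \<inter> N)"
proof -
  have "emeasure (density M (\<lambda>x. ennreal (indicator N x))) A = (\<integral>\<^sup>+x. ennreal (indicator N x) * indicator A x \<partial>M)"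
    using assms by (subst emeasure_density) auto
  also have "\<dots> = (\<integral>\<^sup>+x. indicator (A \<inter> N) x \<partial>M)"
    by (intro nn_integral_cong) (auto split: split_indicator)
  finally show ?thesis using assms by simp
qed

text \<open>Exhaustion: the supremum of \<open>\<tau>\<close> over Lebesgue null sets is attained by
  a countable union of nearly optimal ones, and a null set with mass outside that union would exceed
  the supremum.\<close>

lemma maximal_null_set:
  assumes "fin_meas_on a b \<tau>"
  obtains N where "N \<in> sets borel" "emeasure lborel N = 0"
    "\<And>A. A \<in> sets borel \<Longrightarrow> emeasure lborel A = 0 \<Longrightarrow> measure \<tau> (A - N) = 0"
proof -
  interpret finite_measure \<tau> by (rule fin_meas_onD(3)[OF assms])
  have s: "sets \<tau> = sets borel" by (rule fin_meas_onD(1)[OF assms])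
  define S where "S = {measure \<tau> A | A. A \<in> sets borel \<and> emeasure lborel A = 0}"
  have bdd: "bdd_above S" unfolding S_def by (intro bdd_aboveI[of _ "measure \<tau> (space \<tau>)"]) (auto intro: bounded_measure)
  have ne: "S \<noteq> {}" unfolding S_def by (auto intro: exI[of _ "{}"])
  have "\<exists>A. A \<in> sets borel \<and> emeasure lborel A = 0 \<and> Sup S - 1 / Suc n < measure \<tau> A" for n
    using less_cSupD[OF ne, of "Sup S - 1 / Suc n"] unfolding S_def by auto
  then obtain A where A: "\<And>n. A n \<in> sets borel" "\<And>n. emeasure lborel (A n) = 0"
    "\<And>n. Sup S - 1 / Suc n < measure \<tau> (A n)" by metis
  define N where "N = (\<Union>n. A n)"
  have N: "N \<in> sets borel" "emeasure lborel N = 0"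
    unfolding N_def using A by (auto intro!: emeasure_UN_eq_0)
  have "Sup S \<le> measure \<tau> N"
  proof (rule field_le_epsilon)
    fix e :: real assume "e > 0"
    then obtain n where "1 / Suc n < e" using nat_approx_posE by blast
    moreover have "measure \<tau> (A n) \<le> measure \<tau> N" using N s by (intro finite_measure_mono) (auto simp: N_def)
    ultimately show "Sup S \<le> measure \<tau> N + e" using A(3)[of n] by linarith
  qed
  moreover have "measure \<tau> (B - N) + measure \<tau> N \<le> Sup S" if B: "B \<in> sets borel" "emeasure lborel B = 0" for B
  proof -
    have "measure \<tau> (B - N) + measure \<tau> N = measure \<tau> ((B - N) \<union> N)"
      using B N s by (intro finite_measure_Union[symmetric]) auto
    moreover have "emeasure lborel ((B - N) \<union> N) = 0"
      using B N null_sets.Un[of B lborel N] by (auto simp: null_sets_def)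
    ultimately show ?thesis
      using B N by (intro cSup_upper bdd) (auto simp: S_def)
  qed
  ultimately have "measure \<tau> (B - N) = 0" if "B \<in> sets borel" "emeasure lborel B = 0" for B
    using that measure_nonneg[of \<tau> "B - N"] by (smt (verit))
  with that N show thesis by blast
qed

text \<open>It suffices to decompose the positive measure \<open>\<tau>\<close>: off a maximal null
  set it is absolutely continuous with a density \<open>r\<close>, and \<open>r\<close> times
  \<open>\<sigma>\<close> is the density of \<open>\<gamma>\<close> there.\<close>

lemma Lebesgue_decomposition:
  assumes p: "polar a b \<gamma> \<tau> \<sigma>"
  obtains N g where "N \<in> sets borel" "emeasure lborel N = 0" "L1 a b g"
    "\<And>A. A \<in> sets borel \<Longrightarrow> sval \<gamma> (A - N) = (\<integral>x\<in>A \<inter> {a<..<b}. g x \<partial>lborel)"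
proof -
  obtain N where N: "N \<in> sets borel" "emeasure lborel N = 0"
    "\<And>A. A \<in> sets borel \<Longrightarrow> emeasure lborel A = 0 \<Longrightarrow> measure \<tau> (A - N) = 0"
    using maximal_null_set[OF polarD(2)[OF p]] by blast
  interpret \<tau>: finite_measure \<tau> by (rule polarD(5)[OF p])
  have s: "sets \<tau> = sets borel" and sp: "space \<tau> = UNIV" using polarD(6,7)[OF p] by auto
  note [measurable] = polarD(3)[OF p] N(1)
  define M where "M = density \<tau> (\<lambda>x. ennreal (indicator (UNIV - N) x))"
  have M: "fin_meas_on a b M" unfolding M_def
    using s N(1) AE_fin_meas[OF polarD(2)[OF p]]
    by (intro fin_meas_on_density integrable_indicator_fin_meas[OF polarD(2)[OF p]]) auto
  have eM: "emeasure M A = emeasure \<tau> (A - N)" if "A \<in> sets borel" for A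
    unfolding M_def using that N(1) s by (subst emeasure_density_indicator) (auto simp: Diff_eq)
  have ac: "absolutely_continuous lborel M"
    unfolding absolutely_continuous_def null_sets_def
    using N(3) eM fin_meas_onD(1)[OF M] by (auto simp: \<tau>.emeasure_eq_measure)
  have sM: "sets M = sets lborel" using fin_meas_onD(1)[OF M] by simp
  obtain r where r: "r \<in> borel_measurable lborel" "AE x in lborel. RN_deriv lborel M x = ennreal (r x)" "\<And>x. 0 \<le> r x"
    using sigma_finite_measure.real_RN_deriv[OF sigma_finite_lborel fin_meas_onD(3)[OF M] ac sM] by metis
  have "density lborel (RN_deriv lborel M) = density lborel (\<lambda>x. ennreal (r x))"
    using r by (intro density_cong) auto
  then have Mr: "M = density lborel (\<lambda>x. ennreal (r x))"
    using sigma_finite_measure.density_RN_deriv[OF sigma_finite_lborel ac sM] by simp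
  have [measurable]: "r \<in> borel_measurable borel" using r(1) by simp
  have "(\<integral>\<^sup>+x. ennreal (r x) \<partial>lborel) = emeasure M UNIV"
    by (subst Mr, subst emeasure_density) auto
  also have "\<dots> < \<infinity>" using M by (simp add: fin_meas_on_def top.not_eq_extremum)
  finally have ri: "integrable lborel r" using r by (intro integrableI_nonneg) auto
  define g where "g = (\<lambda>x. r x * \<sigma> x)"
  have gi: "integrable lborel g"
    unfolding g_def
    by (rule Bochner_Integration.integrable_bound[OF ri]) (use polarD(4)[OF p] in \<open>auto simp: abs_mult\<close>)
  have g: "L1 a b g" unfolding L1_def using gi by (intro integrable_mult_indicator[folded set_integrable_def]) auto
  have "sval \<gamma> (A - N) = (\<integral>x\<in>A \<inter> {a<..<b}. g x \<partial>lborel)" if A[measurable]: "A \<in> sets borel" for A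
  proof -
    have "(A - N) \<inter> {a<..<b} = A \<inter> {a<..<b} - N" by auto
    then have "sval \<gamma> (A - N) = sval \<gamma> (A \<inter> {a<..<b} - N)"
      using polarD(1)[OF p] measure_fin_meas_Int[of a b "fst \<gamma>" "A - N"] measure_fin_meas_Int[of a b "snd \<gamma>" "A - N"]
        A N(1) by (simp add: sval_def smeas_def)
    also have "\<dots> = (\<integral>x. indicator (A \<inter> {a<..<b} - N) x * \<sigma> x \<partial>\<tau>)"
      by (rule sval_polar[OF p]) auto
    also have "\<dots> = (\<integral>x. indicator (UNIV - N) x * (indicator (A \<inter> {a<..<b}) x * \<sigma> x) \<partial>\<tau>)"
      by (intro Bochner_Integration.integral_cong) (auto split: split_indicator)
    also have "\<dots> = (\<integral>x. indicator (A \<inter> {a<..<b}) x * \<sigma> x \<partial>M)"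
      unfolding M_def using s N(1) by (subst integral_density) (auto simp: measurable_cong_sets[OF s refl])
    also have "\<dots> = (\<integral>x. r x * (indicator (A \<inter> {a<..<b}) x * \<sigma> x) \<partial>lborel)"
      unfolding Mr using r(3) by (subst integral_density) auto
    also have "\<dots> = (\<integral>x\<in>A \<inter> {a<..<b}. g x \<partial>lborel)"
      unfolding set_lebesgue_integral_def by (intro Bochner_Integration.integral_cong) (auto simp: g_def)
    finally show ?thesis .
  qed
  with that N(1,2) g show thesis by blast
qed

definition restrict_smeas :: "smeasure \<Rightarrow> real set \<Rightarrow> smeasure" where
  "restrict_smeas \<gamma> N = (density (fst \<gamma>) (\<lambda>x. ennreal (indicator N x)), density (snd \<gamma>) (\<lambda>x. ennreal (indicator N x)))"

lemma restrict_smeas: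
  assumes "smeas a b \<gamma>" "N \<in> sets borel"
  shows "smeas a b (restrict_smeas \<gamma> N)"
    and "A \<in> sets borel \<Longrightarrow> sval (restrict_smeas \<gamma> N) A = sval \<gamma> (A \<inter> N)"
proof -
  have M: "fin_meas_on a b (density M (\<lambda>x. ennreal (indicator N x)))" if M: "fin_meas_on a b M" for M
    using fin_meas_onD(1)[OF M] assms(2) AE_fin_meas[OF M]
    by (intro fin_meas_on_density integrable_indicator_fin_meas[OF M]) auto
  then show "smeas a b (restrict_smeas \<gamma> N)" using assms(1) by (simp add: smeas_def restrict_smeas_def)
  assume A: "A \<in> sets borel"
  have "measure (density M (\<lambda>x. ennreal (indicator N x))) A = measure M (A \<inter> N)" if M: "fin_meas_on a b M" for M
    using emeasure_density_indicator[OF fin_meas_onD(1)[OF M] A assms(2)] by (simp add: measure_def)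
  then show "sval (restrict_smeas \<gamma> N) A = sval \<gamma> (A \<inter> N)"
    using assms(1) by (simp add: sval_def restrict_smeas_def smeas_def)
qed

text \<open>Counterpart of \<open>Elim_witness_ge\<close>. The witness takes the part of
  \<open>\<gamma>\<close> on a maximal null set as singular part, the density \<open>g\<close> of
  the rest, and g + h as approximate derivative; its energy is bounded by distributing
  \<open>\<tau>\<close> over the atoms, the rest of the null set and its complement.\<close>

lemma Elim_le:
  assumes ab: "a < b" and c0: "c0 \<ge> 0" and p: "polar a b \<gamma> \<tau> \<sigma>"
    and u: "L1 a b u" "ess_bdd a b K u" and h: "L1 a b h" "L1 a b (\<lambda>x. (h x)\<^sup>2)"
    and der: "\<And>\<phi>. test_fun a b \<phi> \<Longrightarrow> (\<integral>x\<in>{a<..<b}. u x * deriv \<phi> x \<partial>lborel) =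
        - (sint \<gamma> \<phi> + (\<integral>x\<in>{a<..<b}. h x * \<phi> x \<partial>lborel))"
  shows "Elim a b K c0 u \<gamma> \<le> (\<integral>\<^sup>+x\<in>{a<..<b}. ennreal ((h x)\<^sup>2) \<partial>lborel) + ennreal c0 * capped \<tau>"
proof -
  obtain N g where N: "N \<in> sets borel" "emeasure lborel N = 0" and g: "L1 a b g"
    and gN: "\<And>A. A \<in> sets borel \<Longrightarrow> sval \<gamma> (A - N) = (\<integral>x\<in>A \<inter> {a<..<b}. g x \<partial>lborel)"
    using Lebesgue_decomposition[OF p] by blast
  interpret \<tau>: finite_measure \<tau> by (rule polarD(5)[OF p])
  note sm = polarD(1)[OF p] and s = polarD(6)[OF p]
  define Ds where "Ds = restrict_smeas \<gamma> N"
  define Du where "Du = add_smeas \<gamma> (dens a b h)"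
  have sDs: "smeas a b Ds" and vDs: "\<And>A. A \<in> sets borel \<Longrightarrow> sval Ds A = sval \<gamma> (A \<inter> N)"
    unfolding Ds_def using restrict_smeas[OF sm N(1)] by auto
  have split: "sval \<gamma> A = sval \<gamma> (A \<inter> N) + sval \<gamma> (A - N)" if A: "A \<in> sets borel" for A
  proof -
    have "measure M A = measure M (A \<inter> N) + measure M (A - N)" if M: "fin_meas_on a b M" for M
    proof -
      interpret finite_measure M by (rule fin_meas_onD(3)[OF M])
      have "measure M (A \<inter> N \<union> (A - N)) = measure M (A \<inter> N) + measure M (A - N)"
        using A N(1) fin_meas_onD(1)[OF M] by (intro finite_measure_Union) auto
      then show ?thesis by (simp add: Int_Diff_Un)
    qed
    then show ?thesis using sm by (simp add: sval_def smeas_def)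
  qed
  have D: "meas_deriv a b u Du"
    unfolding meas_deriv_def
  proof (intro conjI allI impI u(1))
    show "smeas a b Du" unfolding Du_def by (intro smeas_add sm smeas_dens h)
    fix \<phi> assume \<phi>: "test_fun a b \<phi>"
    obtain C where C: "\<And>x. \<bar>\<phi> x\<bar> \<le> C" and m: "\<phi> \<in> borel_measurable borel"
      using test_fun_props[OF \<phi>] borel_measurable_continuous_onI by metis
    show "(\<integral>x\<in>{a<..<b}. u x * deriv \<phi> x \<partial>lborel) = - sint Du \<phi>"
      unfolding Du_def der[OF \<phi>] sint_add[OF sm smeas_dens[OF h(1)] m C] sint_dens[OF h(1) m C] ..
  qed
  have vg: "L1 a b (\<lambda>x. g x + h x)" by (intro L1_add g h)
  have BV: "BV_decomp a b u Du (\<lambda>x. g x + h x) Ds"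
    unfolding BV_decomp_def
  proof (intro conjI D vg sDs bexI[of _ N] ballI N)
    fix A :: "real set" assume A: "A \<in> sets borel"
    show "sval Ds A = sval Ds (A \<inter> N)" using A N by (simp add: vDs Int_assoc)
    have gi: "set_integrable lborel (A \<inter> {a<..<b}) g" "set_integrable lborel (A \<inter> {a<..<b}) h"
      using g h(1) A by (auto simp: L1_def intro: set_integrable_subset)
    show "sval Du A = (\<integral>x\<in>A \<inter> {a<..<b}. g x + h x \<partial>lborel) + sval Ds A"
      using gi A split[OF A] gN[OF A]
      by (simp add: Du_def sval_add[OF sm smeas_dens[OF h(1)]] sval_dens[OF h(1)] vDs)
  qed
  have \<gamma>: "sval \<gamma> A = sval Ds A + (\<integral>x\<in>A \<inter> {a<..<b}. g x \<partial>lborel)" if "A \<in> sets borel" for A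
    using split[OF that] gN[OF that] vDs[OF that] by simp
  define J where "J = jset a b u"
  have null_int: "(\<integral>x\<in>A. f x \<partial>lborel) = 0" if "A \<in> sets borel" "emeasure lborel A = 0" for A and f :: "real \<Rightarrow> real"
  proof -
    have "AE x in lborel. x \<notin> A" using that by (intro AE_not_in null_setsI) auto
    then have "AE x in lborel. indicator A x *\<^sub>R f x = 0" by eventually_elim simp
    then show ?thesis unfolding set_lebesgue_integral_def by (rule integral_eq_zero_AE)
  qed
  have pt: "sval (dens a b h) {x} = 0" for x
    unfolding sval_dens[OF h(1) borel_singleton[OF sets.empty_sets]]
    by (rule null_int) (auto intro: emeasure_eq_0[of "{x}"])
  have eq: "sval Du {x} = sval \<gamma> {x}" for x
    by (simp add: Du_def sval_add[OF sm smeas_dens[OF h(1)]] pt)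
  have J: "J = {x. measure \<tau> {x} \<noteq> 0}" unfolding J_def by (rule jump_energy_eq(1)[OF ab D p c0 eq])
  note cap = capped_eq[OF polarD(2)[OF p] J]
  have J0: "emeasure lborel J = 0" using cap(2) by (rule emeasure_lborel_countable)
  have 1: "tvar (\<lambda>A. sval Ds (A - J)) {a<..<b} \<le> emeasure \<tau> (N - J)"
    unfolding tvar_def
  proof (rule SUP_least)
    fix A :: "nat \<Rightarrow> real set" assume "A \<in> {A. disjoint_family A \<and> (\<forall>n. A n \<in> sets borel \<and> A n \<subseteq> {a<..<b})}"
    then have A: "disjoint_family A" "\<And>n. A n \<in> sets borel" by auto
    have "(\<Sum>n. ennreal \<bar>sval Ds (A n - J)\<bar>) \<le> (\<Sum>n. emeasure \<tau> ((A n - J) \<inter> N))"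
    proof (rule suminf_le)
      fix n
      have "\<bar>sval Ds (A n - J)\<bar> \<le> measure \<tau> ((A n - J) \<inter> N)"
        using A(2)[of n] cap(1) N(1) abs_sval_le[OF p, of "(A n - J) \<inter> N"] by (simp add: vDs)
      then show "ennreal \<bar>sval Ds (A n - J)\<bar> \<le> emeasure \<tau> ((A n - J) \<inter> N)"
        by (simp add: \<tau>.emeasure_eq_measure)
    qed auto
    also have "\<dots> = emeasure \<tau> (\<Union>n. (A n - J) \<inter> N)"
      using A cap(1) N(1) s by (intro suminf_emeasure) (auto simp: disjoint_family_on_def)
    also have "\<dots> \<le> emeasure \<tau> (N - J)"
      using cap(1) N(1) s by (intro emeasure_mono) auto
    finally show "(\<Sum>n. ennreal \<bar>sval Ds (A n - J)\<bar>) \<le> emeasure \<tau> (N - J)" .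
  qed
  \<comment> \<open>The null sets \<open>N\<close> and \<open>J\<close> do not affect integrals of
    \<open>g\<close>, so the sign sets of \<open>g\<close> may be moved off both; there
    \<open>\<gamma>\<close> has density \<open>g\<close> and is dominated by
    \<open>\<tau>\<close>.\<close>
  have 2: "(\<integral>\<^sup>+x\<in>{a<..<b}. ennreal \<bar>g x\<bar> \<partial>lborel) \<le> emeasure \<tau> (UNIV - N - J)"
  proof -
    define g0 where "g0 = (\<lambda>x. indicator {a<..<b} x * g x :: real)"
    have g0i: "integrable lborel g0" using g by (simp add: g0_def L1_iff)
    have [measurable]: "g0 \<in> borel_measurable borel" using g0i by auto
    note [measurable] = cap(1) N(1)
    define P where "P = {x. 0 \<le> g0 x}"
    have P[measurable]: "P \<in> sets borel" unfolding P_def by measurable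
    let ?Q = "(UNIV - P) :: real set"
    have int: "sval \<gamma> (A - J - N) = (\<integral>x. indicator A x * g0 x \<partial>lborel)" if A[measurable]: "A \<in> sets borel" for A
    proof -
      have "sval \<gamma> (A - J - N) = (\<integral>x. indicator (A - J) x * g0 x \<partial>lborel)"
        using gN[of "A - J"] by (simp add: set_lebesgue_integral_def g0_def indicator_inter_arith mult.assoc)
      also have "\<dots> = (\<integral>x. indicator A x * g0 x \<partial>lborel)"
      proof (rule integral_cong_AE)
        have "AE x in lborel. x \<notin> J" using J0 cap(1) by (intro AE_not_in null_setsI) auto
        then show "AE x in lborel. indicator (A - J) x * g0 x = indicator A x * g0 x"
          by eventually_elim (auto split: split_indicator)
      qed auto
      finally show ?thesis .
    qed
    have "(\<integral>x\<in>{a<..<b}. \<bar>g x\<bar> \<partial>lborel) = (\<integral>x. indicator P x * g0 x - indicator ?Q x * g0 x \<partial>lborel)"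
      unfolding set_lebesgue_integral_def
      by (intro Bochner_Integration.integral_cong) (auto simp: g0_def P_def split: split_indicator)
    also have "\<dots> = sval \<gamma> (P - J - N) - sval \<gamma> (?Q - J - N)"
      unfolding int[OF P] int[OF sets.compl_sets[OF P, unfolded space_borel]]
      using g0i by (intro Bochner_Integration.integral_diff integrable_mult_indicator[where 'b = real, simplified]) auto
    also have "\<dots> \<le> measure \<tau> (P - J - N) + measure \<tau> (?Q - J - N)"
      using abs_sval_le[OF p, of "P - J - N"] abs_sval_le[OF p, of "?Q - J - N"] by (simp add: abs_le_iff)
    also have "\<dots> = measure \<tau> ((P - J - N) \<union> (?Q - J - N))"
      using s by (intro \<tau>.finite_measure_Union[symmetric]) auto
    also have "(P - J - N) \<union> (?Q - J - N) = UNIV - N - J" by auto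
    finally show ?thesis
      unfolding set_integral_abs_eq_nn_integral[OF g] \<tau>.emeasure_eq_measure by (rule ennreal_leI)
  qed
  have 3: "emeasure \<tau> (UNIV - N - J) + emeasure \<tau> (N - J) = emeasure \<tau> (UNIV - J)"
  proof -
    have "(UNIV - N - J) \<union> (N - J) = UNIV - J" by auto
    then show ?thesis using cap(1) N(1) s by (subst plus_emeasure) auto
  qed
  have "Elim a b K c0 u \<gamma> \<le> (\<integral>\<^sup>+x\<in>{a<..<b}. ennreal (((g x + h x) - g x)\<^sup>2) \<partial>lborel)
          + ennreal c0 * (\<integral>\<^sup>+x\<in>{a<..<b}. ennreal \<bar>g x\<bar> \<partial>lborel)
          + 2 * (\<integral>\<^sup>+x. ennreal (fcap c0 (\<bar>jump u x\<bar> / 2)) \<partial>count_space (jset a b u))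
          + ennreal c0 * tvar (\<lambda>A. sval Ds (A - jset a b u)) {a<..<b}"
    unfolding Elim_def
    by (rule INF_lower2[of "(Du, \<lambda>x. g x + h x, Ds, g)"]) (use BV u sm g \<gamma> h in auto)
  also have "\<dots> = (\<integral>\<^sup>+x\<in>{a<..<b}. ennreal ((h x)\<^sup>2) \<partial>lborel) + ennreal c0 * ((\<integral>\<^sup>+x\<in>{a<..<b}. ennreal \<bar>g x\<bar> \<partial>lborel)
       + tvar (\<lambda>A. sval Ds (A - J)) {a<..<b} + (\<integral>\<^sup>+x. ennreal (min (measure \<tau> {x}) 2) \<partial>count_space J))"
    unfolding jump_energy_eq(2)[OF ab D p c0 eq]
    unfolding J[symmetric] J_def[symmetric] by (simp add: distrib_left ac_simps)
  also have "\<dots> \<le> (\<integral>\<^sup>+x\<in>{a<..<b}. ennreal ((h x)\<^sup>2) \<partial>lborel) + ennreal c0 * (emeasure \<tau> (UNIV - N - J)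
       + emeasure \<tau> (N - J) + (\<integral>\<^sup>+x. ennreal (min (measure \<tau> {x}) 2) \<partial>count_space J))"
    by (intro add_left_mono mult_left_mono add_right_mono add_mono 1 2) auto
  also have "\<dots> = (\<integral>\<^sup>+x\<in>{a<..<b}. ennreal ((h x)\<^sup>2) \<partial>lborel) + ennreal c0 * capped \<tau>"
    unfolding cap(3) 3 ..
  finally show ?thesis .
qed

section \<open>Steklov averages\<close>

text \<open>Half-open windows make window masses exact differences of distribution functions, with
  no correction at atoms.\<close>

lemma measurable_window_kernel[measurable]:
  "(\<lambda>(y, x). indicator {x - p<..x + q} y :: real) \<in> borel_measurable (borel \<Otimes>\<^sub>M (borel :: real measure))"
proof -
  have "(\<lambda>(y, x). indicator {x - p<..x + q} y :: real) = indicator {z. snd z - p < fst z \<and> fst z \<le> snd z + q}"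
    by (auto simp: fun_eq_iff split: split_indicator)
  moreover have "{z \<in> space (borel \<Otimes>\<^sub>M borel). snd z - p < fst z \<and> fst z \<le> (snd z :: real) + q} \<in> sets (borel \<Otimes>\<^sub>M borel)"
    by measurable
  then have "{z. snd z - p < fst z \<and> fst z \<le> (snd z :: real) + q} \<in> sets (borel \<Otimes>\<^sub>M borel)"
    by (simp add: space_pair_measure)
  ultimately show ?thesis by simp
qed

text \<open>A positive measure counts as a signed one with zero second component, which makes
  \<open>Fubini_sint\<close> and \<open>sval_Ioc\<close> available for it.\<close>

lemma smeas_single:
  assumes "fin_meas_on a b M"
  shows "smeas a b (M, null_measure borel)" "sint (M, null_measure borel) \<phi> = (\<integral>x. \<phi> x \<partial>M)"
    "sval (M, null_measure borel) A = measure M A"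
  using assms by (auto simp: smeas_def fin_meas_on_def sint_def sval_def integral_null_measure measure_def)

text \<open>A point y lies in the window of x exactly when x is in [y - q, y + p), a set of length p
  + q. The set \<open>T\<close> contains every point that the windows of points of \<open>S\<close>
  can reach.\<close>

lemma window_Fubini:
  assumes M: "fin_meas_on a b M" and S: "S \<in> sets borel" "emeasure lborel S < \<infinity>" and T: "T \<in> sets borel"
    and pq: "0 \<le> p + q" and ST: "\<And>x y. x \<in> S \<Longrightarrow> x - p < y \<Longrightarrow> y \<le> x + q \<Longrightarrow> y \<in> T"
  shows "integrable lborel (\<lambda>x. indicator S x * measure M {x - p<..x + q})"
    and "(\<integral>x. indicator S x * measure M {x - p<..x + q} \<partial>lborel) \<le> (p + q) * measure M T"
proof -
  note F = Fubini_sint[OF smeas_single(1)[OF M] measurable_window_kernel[of p q], of 1 "indicator S"]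
  have k: "\<bar>indicator {x - p<..x + q} y :: real\<bar> \<le> 1" for x y by (auto split: split_indicator)
  have Si: "integrable lborel (indicator S :: real \<Rightarrow> real)" using S by (intro integrable_real_indicator) auto
  have m: "(\<integral>y. indicator {x - p<..x + q} y \<partial>M) = measure M {x - p<..x + q}" for x
    using fin_meas_onD(1,2)[OF M] by simp
  show "integrable lborel (\<lambda>x. indicator S x * measure M {x - p<..x + q})"
    using F(2)[OF k Si] by (simp add: smeas_single[OF M] m mult.commute fin_meas_onD(2)[OF M])
  have "(\<integral>x. indicator S x * measure M {x - p<..x + q} \<partial>lborel) =
     (\<integral>y. (\<integral>x. indicator {x - p<..x + q} y * indicator S x \<partial>lborel) \<partial>M)"
    using F(1)[OF k Si] by (simp add: smeas_single[OF M] m mult.commute fin_meas_onD(2)[OF M])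
  also have "\<dots> \<le> (\<integral>y. (p + q) * indicator T y \<partial>M)"
  proof (rule integral_mono')
    show "integrable M (\<lambda>y. (p + q) * indicator T y :: real)"
      using integrable_indicator_fin_meas[OF M T] by simp
    fix y
    show "(\<integral>x. indicator {x - p<..x + q} y * indicator S x \<partial>lborel) \<le> (p + q) * indicator T y"
    proof (cases "y \<in> T")
      case True
      have "(\<integral>x. indicator {x - p<..x + q} y * indicator S x \<partial>lborel) \<le> (\<integral>x. (indicator {y - q..<y + p} x :: real) \<partial>lborel)"
        using pq by (intro integral_mono') (auto split: split_indicator)
      also have "\<dots> = p + q" using pq by simp
      finally show ?thesis using True by simp
    next
      case False
      have "indicator {x - p<..x + q} y * indicator S x = (0 :: real)" for x
        using ST[of x y] False by (auto split: split_indicator)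
      then have "(\<integral>x. indicator {x - p<..x + q} y * indicator S x \<partial>lborel) = (0 :: real)"
        by (simp only: Bochner_Integration.integral_zero)
      then show ?thesis using False by simp
    qed
    show "0 \<le> (p + q) * indicator T y" using pq by simp
  qed
  also have "\<dots> = (p + q) * measure M T"
    using T fin_meas_onD(1,2)[OF M] by simp
  finally show "(\<integral>x. indicator S x * measure M {x - p<..x + q} \<partial>lborel) \<le> (p + q) * measure M T" .
qed

lemma measurable_sval_window:
  assumes "smeas a b D"
  shows "(\<lambda>x. sval D {x - p<..x + q}) \<in> borel_measurable borel"
  using measurable_sint_kernel[OF assms measurable_window_kernel[of p q]] sint_indicator[OF assms] by simp

lemma sval_Ioc:
  assumes "smeas a b D" "x \<le> y"
  shows "sval D {x<..y} = sval D {..y} - sval D {..x}"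
proof -
  have "measure M {..y} = measure M {..x} + measure M {x<..y}" if M: "fin_meas_on a b M" for M
  proof -
    interpret finite_measure M by (rule fin_meas_onD(3)[OF M])
    have "measure M ({..x} \<union> {x<..y}) = measure M {..x} + measure M {x<..y}"
      using fin_meas_onD(1)[OF M] by (intro finite_measure_Union) auto
    moreover have "{..x} \<union> {x<..y} = {..y}" using assms(2) by auto
    ultimately show ?thesis by simp
  qed
  then show ?thesis using assms(1) by (simp add: sval_def smeas_def)
qed

lemma abs_sval_le_add_meas:
  assumes "smeas a b D" "A \<in> sets borel"
  shows "\<bar>sval D A\<bar> \<le> measure (add_meas (fst D) (snd D)) A"
proof -
  have "measure (add_meas (fst D) (snd D)) A = measure (fst D) A + measure (snd D) A"
    using assms by (intro measure_add_meas[of a b]) (auto simp: smeas_def)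
  then show ?thesis
    unfolding sval_def using measure_nonneg[of "fst D" A] measure_nonneg[of "snd D" A] by linarith
qed

text \<open>The window lies to the right, so that the derivative of the average is the mass of (x, x
  + \<eta>] divided by \<eta>. Near \<open>b\<close> the window leaves the interval, but the
  distribution functions are defined there too, and constant.\<close>

definition steklov :: "real \<Rightarrow> (real \<Rightarrow> real) \<Rightarrow> real \<Rightarrow> real" where
  "steklov \<eta> f x = (\<integral>t. indicator {x<..x + \<eta>} t * f t \<partial>lborel) / \<eta>"

lemma integrable_window:
  fixes f :: "real \<Rightarrow> real"
  assumes "f \<in> borel_measurable borel" "\<And>x. \<bar>f x\<bar> \<le> C"
  shows "integrable lborel (\<lambda>t. indicator {x<..y} t * f t)"
proof (cases "x \<le> y")
  case True
  show ?thesis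
  proof (rule Bochner_Integration.integrable_bound)
    show "integrable lborel (\<lambda>t. C * indicator {x<..y} t :: real)"
      using True by (intro integrable_mult_right integrable_real_indicator) auto
    show "(\<lambda>t. indicator {x<..y} t * f t) \<in> borel_measurable lborel" using assms(1) by measurable
    show "AE t in lborel. norm (indicator {x<..y} t * f t) \<le> norm (C * indicator {x<..y} t :: real)"
      by (intro AE_I2) (auto split: split_indicator intro: order.trans[OF assms(2)])
  qed
qed simp

lemma steklov_measurable:
  assumes "f \<in> borel_measurable borel"
  shows "steklov \<eta> f \<in> borel_measurable borel"
proof -
  have "(\<lambda>z. indicator {fst z<..fst z + \<eta>} (snd z) * f (snd z) :: real) \<in> borel_measurable (borel \<Otimes>\<^sub>M lborel)"
  proof -
    have [measurable]: "(\<lambda>z. indicator {fst z<..fst z + \<eta>} (snd z) :: real) \<in> borel_measurable (borel \<Otimes>\<^sub>M lborel)"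
    proof -
      have "(\<lambda>z. (snd z, fst z)) \<in> borel \<Otimes>\<^sub>M lborel \<rightarrow>\<^sub>M borel \<Otimes>\<^sub>M (borel :: real measure)" by measurable
      from measurable_compose[OF this measurable_window_kernel[of 0 \<eta>]] show ?thesis by simp
    qed
    show ?thesis using assms by measurable
  qed
  then have "(\<lambda>x. \<integral>t. indicator {x<..x + \<eta>} t * f t \<partial>lborel) \<in> borel_measurable borel"
    by (intro lborel.borel_measurable_lebesgue_integral) (simp add: case_prod_beta)
  then show ?thesis unfolding steklov_def[abs_def] by measurable
qed

lemma steklov_bounded_AE:
  assumes \<eta>: "\<eta> > 0" and f: "AE t in lborel. t \<in> {x<..x + \<eta>} \<longrightarrow> \<bar>f t\<bar> \<le> C" and C: "0 \<le> C"
  shows "\<bar>steklov \<eta> f x\<bar> \<le> C"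
proof -
  have "\<bar>\<integral>t. indicator {x<..x + \<eta>} t * f t \<partial>lborel\<bar> \<le> (\<integral>t. \<bar>indicator {x<..x + \<eta>} t * f t\<bar> \<partial>lborel)"
    by (rule integral_abs_bound)
  also have "\<dots> \<le> (\<integral>t. C * indicator {x<..x + \<eta>} t \<partial>lborel)"
  proof (rule integral_mono_AE')
    show "integrable lborel (\<lambda>t. C * indicator {x<..x + \<eta>} t :: real)"
      using \<eta> by (intro integrable_mult_right integrable_real_indicator) auto
    show "AE t in lborel. \<bar>indicator {x<..x + \<eta>} t * f t\<bar> \<le> C * indicator {x<..x + \<eta>} t"
      using f by eventually_elim (auto split: split_indicator)
  qed (use C in auto)
  also have "\<dots> = C * \<eta>" using \<eta> by simp
  finally show ?thesis using \<eta> by (simp add: steklov_def field_simps)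
qed

lemma steklov_deviation:
  assumes \<eta>: "\<eta> > 0" and f: "f \<in> borel_measurable borel" "\<And>x. \<bar>f x\<bar> \<le> C"
    and d: "\<And>t. t \<in> {x<..x + \<eta>} \<Longrightarrow> \<bar>f t - l\<bar> \<le> B" and B: "0 \<le> B"
  shows "\<bar>steklov \<eta> f x - l\<bar> \<le> B"
proof -
  have "steklov \<eta> (\<lambda>t. f t - l) x = ((\<integral>t. indicator {x<..x + \<eta>} t * f t \<partial>lborel) - (\<integral>t. indicator {x<..x + \<eta>} t * l \<partial>lborel)) / \<eta>"
    unfolding steklov_def using integrable_window[OF f, of x "x + \<eta>"] \<eta>
    by (simp add: right_diff_distrib)
  also have "\<dots> = steklov \<eta> f x - l" using \<eta> by (simp add: steklov_def diff_divide_distrib)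
  finally show ?thesis using steklov_bounded_AE[OF \<eta>, of x "\<lambda>t. f t - l" B] d B by auto
qed

lemma primitive_props:
  assumes "smeas a b D"
  shows "(\<lambda>x. c + sval D {..x}) \<in> borel_measurable borel"
    and "\<bar>c + sval D {..x}\<bar> \<le> \<bar>c\<bar> + (measure (fst D) UNIV + measure (snd D) UNIV)"
  using measurable_sval_atMost[OF assms] sval_bounded[OF assms, of "{..x}"] by auto

lemma test_fun_integral_deriv:
  assumes "a < b" "test_fun a b \<phi>"
  shows "(\<integral>x\<in>{a<..<b}. deriv \<phi> x \<partial>lborel) = 0"
proof -
  obtain c d where p: "a < c" "c \<le> d" "d < b" "\<And>x. x \<notin> {c..d} \<Longrightarrow> \<phi> x = 0"
    "\<And>x. x \<notin> {c..d} \<Longrightarrow> deriv \<phi> x = 0" "continuous_on UNIV (deriv \<phi>)"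
    "\<And>x. (\<phi> has_field_derivative deriv \<phi> x) (at x)"
    using test_fun_props[OF assms(2)] by metis
  have "(\<integral>x\<in>{a<..<b}. deriv \<phi> x \<partial>lborel) = (\<integral>x. deriv \<phi> x * indicator {a..b} x \<partial>lborel)"
    unfolding set_lebesgue_integral_def using p
    by (intro Bochner_Integration.integral_cong) (auto split: split_indicator)
  also have "\<dots> = \<phi> b - \<phi> a"
    using assms(1) p by (intro integral_FTC_Icc_real) (auto simp: continuous_on_eq_continuous_at)
  finally show ?thesis using p by simp
qed

text \<open>Integrating the difference quotient of the distribution function from \<open>a\<close>
  to x and translating one of the two integrals leaves the average at x minus the average at
  \<open>a\<close>. So the average is a primitive of its candidate derivative, and integration by
  parts applies.\<close>

lemma weak_deriv_steklov:
  assumes ab: "a < b" and D: "smeas a b D" and \<eta>: "\<eta> > 0"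
  shows "weak_deriv a b (steklov \<eta> (\<lambda>x. c + sval D {..x})) (\<lambda>x. sval D {x<..x + \<eta>} / \<eta>)"
proof -
  define f where "f = (\<lambda>x. c + sval D {..x})"
  define C where "C = \<bar>c\<bar> + (measure (fst D) UNIV + measure (snd D) UNIV)"
  have f[measurable]: "f \<in> borel_measurable borel" and fb: "\<bar>f x\<bar> \<le> C" for x
    unfolding f_def C_def using primitive_props[OF D] by auto
  have C0: "0 \<le> C" unfolding C_def by (auto intro: measure_nonneg)
  let ?v = "\<lambda>x. sval D {x<..x + \<eta>} / \<eta>"
  have vm[measurable]: "?v \<in> borel_measurable borel"
    using measurable_sval_window[OF D, of 0 \<eta>] by simp
  have vL: "L1 a b ?v"
    using \<eta> by (intro L1_bounded[OF vm, where C = "(measure (fst D) UNIV + measure (snd D) UNIV) / \<eta>"])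
      (auto simp: divide_right_mono sval_bounded[OF D])
  have sm: "steklov \<eta> f \<in> borel_measurable borel" by (rule steklov_measurable[OF f])
  have sb: "\<bar>steklov \<eta> f x\<bar> \<le> C" for x by (rule steklov_bounded_AE[OF \<eta> _ C0]) (use fb in auto)
  have sL: "L1 a b (steklov \<eta> f)" by (rule L1_bounded[OF sm sb])
  have prim: "steklov \<eta> f x = steklov \<eta> f a + sval (dens a b ?v) {..x}" if x: "x \<in> {a<..<b}" for x
  proof -
    have "sval (dens a b ?v) {..x} = (\<integral>t. indicator ({..x} \<inter> {a<..<b}) t * ?v t \<partial>lborel)"
      by (simp add: sval_dens[OF vL] set_lebesgue_integral_def)
    also have "\<dots> = (\<integral>t. indicator {a<..x} t * f (\<eta> + 1 * t) / \<eta> - indicator {a<..x} t * f t / \<eta> \<partial>lborel)"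
    proof (intro Bochner_Integration.integral_cong refl)
      fix t
      have "sval D {t<..t + \<eta>} = f (\<eta> + 1 * t) - f t"
        using sval_Ioc[OF D, of t "t + \<eta>"] \<eta> by (simp add: f_def add.commute)
      then show "indicator ({..x} \<inter> {a<..<b}) t * ?v t = indicator {a<..x} t * f (\<eta> + 1 * t) / \<eta> - indicator {a<..x} t * f t / \<eta>"
        using x by (auto simp: diff_divide_distrib split: split_indicator)
    qed
    also have "\<dots> = ((\<integral>t. indicator {a<..x} t * f (\<eta> + 1 * t) \<partial>lborel) - (\<integral>t. indicator {a<..x} t * f t \<partial>lborel)) / \<eta>"
    proof -
      have "integrable lborel (\<lambda>t. indicator {a<..x} t * f (\<eta> + 1 * t))"
        by (rule integrable_window[where C = C]) (use fb in auto)
      then show ?thesis using integrable_window[OF f fb, of a x] by (simp add: diff_divide_distrib)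
    qed
    also have "(\<integral>t. indicator {a<..x} t * f (\<eta> + 1 * t) \<partial>lborel) = (\<integral>t. indicator {a + \<eta><..x + \<eta>} t * f t \<partial>lborel)"
    proof -
      have "(\<integral>t. indicator {a + \<eta><..x + \<eta>} t * f t \<partial>lborel) =
         (\<integral>t. indicator {a + \<eta><..x + \<eta>} (\<eta> + 1 * t) * f (\<eta> + 1 * t) \<partial>lborel)"
        using lborel_integral_real_affine[of 1 "\<lambda>t. indicator {a + \<eta><..x + \<eta>} t * f t" \<eta>] by simp
      also have "\<dots> = (\<integral>t. indicator {a<..x} t * f (\<eta> + 1 * t) \<partial>lborel)"
        by (intro Bochner_Integration.integral_cong) (auto split: split_indicator)
      finally show ?thesis by simp
    qed
    \<comment> \<open>The common part cancels pointwise, whether or not x exceeds a +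
      \<eta>.\<close>
    also have "(\<integral>t. indicator {a + \<eta><..x + \<eta>} t * f t \<partial>lborel) - (\<integral>t. indicator {a<..x} t * f t \<partial>lborel) =
       (\<integral>t. indicator {x<..x + \<eta>} t * f t \<partial>lborel) - (\<integral>t. indicator {a<..a + \<eta>} t * f t \<partial>lborel)"
    proof -
      have "(\<integral>t. indicator {a + \<eta><..x + \<eta>} t * f t - indicator {a<..x} t * f t \<partial>lborel) =
          (\<integral>t. indicator {x<..x + \<eta>} t * f t - indicator {a<..a + \<eta>} t * f t \<partial>lborel)"
        using x \<eta> by (intro Bochner_Integration.integral_cong) (auto split: split_indicator)
      then show ?thesis using integrable_window[OF f fb] by simp
    qed
    finally show ?thesis by (simp add: steklov_def diff_divide_distrib)
  qed
  show ?thesis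
    unfolding weak_deriv_def f_def[symmetric]
  proof (intro conjI allI impI sL vL)
    fix \<phi> assume \<phi>: "test_fun a b \<phi>"
    obtain B where B: "\<And>x. \<bar>\<phi> x\<bar> \<le> B" "\<And>x. \<bar>deriv \<phi> x\<bar> \<le> B" and m: "\<phi> \<in> borel_measurable borel" "deriv \<phi> \<in> borel_measurable borel"
      using test_fun_props[OF \<phi>] borel_measurable_continuous_onI by metis
    let ?w = "\<lambda>x. sval (dens a b ?v) {..x}"
    have w: "L1 a b (\<lambda>x. ?w x * deriv \<phi> x)"
      by (intro L1_mult_bounded[OF L1_bounded[OF measurable_sval_atMost[OF smeas_dens[OF vL]] sval_bounded[OF smeas_dens[OF vL]]] m(2) B(2)]) auto
    have d: "L1 a b (\<lambda>x. steklov \<eta> f a * deriv \<phi> x)"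
      by (intro L1_cmult L1_bounded[OF m(2) B(2)])
    have "(\<integral>x\<in>{a<..<b}. steklov \<eta> f x * deriv \<phi> x \<partial>lborel) =
        (\<integral>x\<in>{a<..<b}. steklov \<eta> f a * deriv \<phi> x + ?w x * deriv \<phi> x \<partial>lborel)"
      using prim by (intro set_lebesgue_integral_cong) (auto simp: distrib_right)
    also have "\<dots> = steklov \<eta> f a * (\<integral>x\<in>{a<..<b}. deriv \<phi> x \<partial>lborel) + (\<integral>x\<in>{a<..<b}. ?w x * deriv \<phi> x \<partial>lborel)"
      using w d by (subst set_integral_add) (auto simp: L1_def)
    also have "\<dots> = - sint (dens a b ?v) \<phi>"
      using sint_by_parts[OF smeas_dens[OF vL] \<phi>] test_fun_integral_deriv[OF ab \<phi>] by simp
    also have "\<dots> = - (\<integral>x\<in>{a<..<b}. ?v x * \<phi> x \<partial>lborel)"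
      by (simp add: sint_dens[OF vL m(1) B(1)])
    finally show "(\<integral>x\<in>{a<..<b}. steklov \<eta> f x * deriv \<phi> x \<partial>lborel) = - (\<integral>x\<in>{a<..<b}. ?v x * \<phi> x \<partial>lborel)" .
  qed
qed

text \<open>Inside its window the representative moves by at most the dominating mass of that
  window, and these masses integrate to \<eta> times the total mass.\<close>

lemma steklov_L1_dist:
  assumes D: "smeas a b D" and \<eta>: "\<eta> > 0" and u: "AE x in lborel. x \<in> {a<..<b} \<longrightarrow> u x = c + sval D {..x}"
  shows "(\<integral>x\<in>{a<..<b}. \<bar>steklov \<eta> (\<lambda>x. c + sval D {..x}) x - u x\<bar> \<partial>lborel)
    \<le> \<eta> * measure (add_meas (fst D) (snd D)) UNIV"
proof -
  define \<Lambda> where "\<Lambda> = add_meas (fst D) (snd D)"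
  have \<Lambda>: "fin_meas_on a b \<Lambda>" unfolding \<Lambda>_def using D by (auto simp: smeas_def intro: fin_meas_on_add_meas)
  interpret finite_measure \<Lambda> by (rule fin_meas_onD(3)[OF \<Lambda>])
  have dev: "\<bar>steklov \<eta> (\<lambda>x. c + sval D {..x}) x - (c + sval D {..x})\<bar> \<le> measure \<Lambda> {x<..x + \<eta>}" for x
  proof (rule steklov_deviation[OF \<eta> primitive_props[OF D] _ measure_nonneg])
    fix t assume t: "t \<in> {x<..x + \<eta>}"
    have "\<bar>c + sval D {..t} - (c + sval D {..x})\<bar> = \<bar>sval D {x<..t}\<bar>"
      using t sval_Ioc[OF D, of x t] by simp
    also have "\<dots> \<le> measure \<Lambda> {x<..t}" unfolding \<Lambda>_def by (rule abs_sval_le_add_meas[OF D]) auto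
    also have "\<dots> \<le> measure \<Lambda> {x<..x + \<eta>}"
      using t fin_meas_onD(1)[OF \<Lambda>] by (intro finite_measure_mono) auto
    finally show "\<bar>c + sval D {..t} - (c + sval D {..x})\<bar> \<le> measure \<Lambda> {x<..x + \<eta>}" .
  qed
  have S: "emeasure lborel {a<..<b} < \<infinity>" using emeasure_lborel_box_finite[of a b] by simp
  note W = window_Fubini[OF \<Lambda> _ S, of UNIV 0 \<eta>]
  have "(\<integral>x\<in>{a<..<b}. \<bar>steklov \<eta> (\<lambda>x. c + sval D {..x}) x - u x\<bar> \<partial>lborel)
     \<le> (\<integral>x. indicator {a<..<b} x * measure \<Lambda> {x - 0<..x + \<eta>} \<partial>lborel)"
    unfolding set_lebesgue_integral_def
  proof (rule integral_mono_AE')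
    show "integrable lborel (\<lambda>x. indicator {a<..<b} x * measure \<Lambda> {x - 0<..x + \<eta>})"
      using W(1) \<eta> by auto
    show "AE x in lborel. indicator {a<..<b} x *\<^sub>R \<bar>steklov \<eta> (\<lambda>x. c + sval D {..x}) x - u x\<bar>
        \<le> indicator {a<..<b} x * measure \<Lambda> {x - 0<..x + \<eta>}"
      using u
    proof eventually_elim
      case (elim x)
      then show ?case using dev[of x] by (auto split: split_indicator)
    qed
  qed auto
  also have "\<dots> \<le> (0 + \<eta>) * measure \<Lambda> UNIV" using W(2) \<eta> by auto
  finally show ?thesis by (simp add: \<Lambda>_def)
qed

text \<open>Averages near \<open>b\<close> see values beyond \<open>b\<close>, where the
  representative equals its left limit at \<open>b\<close>. The bound passes to this limit, since a
  violation would persist on an interval of positive length.\<close>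

lemma primitive_bounded_right:
  assumes ab: "a < b" and D: "smeas a b D"
    and bd: "AE x in lborel. x \<in> {a<..<b} \<longrightarrow> \<bar>c + sval D {..x}\<bar> \<le> K"
  shows "AE x in lborel. a < x \<longrightarrow> \<bar>c + sval D {..x}\<bar> \<le> K"
proof -
  have fb: "finite_borel_measure (fst D)" "finite_borel_measure (snd D)"
    using D fin_meas_onD(1,3)
    by (auto simp: smeas_def finite_borel_measure_def finite_borel_measure_axioms_def)
  have L: "((\<lambda>t. c + sval D {..t}) \<longlongrightarrow> c + sval D {..<b}) (at_left b)"
    using finite_borel_measure.cdf_at_left[OF fb(1), of b] finite_borel_measure.cdf_at_left[OF fb(2), of b]
    unfolding sval_def cdf_def by (intro tendsto_intros)
  have le: "\<bar>c + sval D {..<b}\<bar> \<le> K"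
  proof (rule ccontr)
    assume "\<not> ?thesis"
    then have "\<forall>\<^sub>F t in at_left b. K < \<bar>c + sval D {..t}\<bar>"
      using order_tendstoD(1)[OF tendsto_rabs[OF L], of K] by simp
    then obtain \<delta> where \<delta>: "\<delta> < b" "\<And>t. \<delta> < t \<Longrightarrow> t < b \<Longrightarrow> K < \<bar>c + sval D {..t}\<bar>"
      unfolding eventually_at_left_field by blast
    have "AE t in lborel. t \<notin> {max a \<delta><..<b}"
      using bd by eventually_elim (use \<delta>(2) in force)
    then have "emeasure lborel {max a \<delta><..<b} = 0"
      by (subst (asm) AE_iff_null_sets[symmetric]) auto
    then show False using ab \<delta>(1) by simp
  qed
  have "sval D {..x} = sval D {..<b}" if "b \<le> x" for x
  proof -
    have "measure M {..x} = measure M {..<b}" if M: "fin_meas_on a b M" for M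
    proof -
      have "{..x} \<inter> {a<..<b} = {..<b} \<inter> {a<..<b}" using \<open>b \<le> x\<close> by auto
      then show ?thesis using measure_fin_meas_Int[OF M, of "{..x}"] measure_fin_meas_Int[OF M, of "{..<b}"] by simp
    qed
    then show ?thesis using D by (simp add: sval_def smeas_def)
  qed
  then have "\<bar>c + sval D {..x}\<bar> \<le> K" if "b \<le> x" for x using le that by simp
  then show ?thesis using bd by (auto elim!: eventually_mono) (metis not_le)
qed

section \<open>Flat distance and square norm of averaged measures\<close>

lemma flat_test_props:
  assumes "flat_test a b \<phi>"
  shows "\<phi> \<in> borel_measurable borel" "\<And>x. \<bar>\<phi> x\<bar> \<le> 1" "\<And>x y. \<bar>\<phi> x - \<phi> y\<bar> \<le> \<bar>x - y\<bar>" "\<And>x. x \<notin> {a<..<b} \<Longrightarrow> \<phi> x = 0"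
proof -
  show l: "\<And>x. \<bar>\<phi> x\<bar> \<le> 1" "\<And>x y. \<bar>\<phi> x - \<phi> y\<bar> \<le> \<bar>x - y\<bar>" "\<And>x. x \<notin> {a<..<b} \<Longrightarrow> \<phi> x = 0"
    using assms unfolding flat_test_def by blast+
  have "1-lipschitz_on UNIV \<phi>" using l(2) by (intro lipschitz_onI) (auto simp: dist_real_def)
  then show "\<phi> \<in> borel_measurable borel"
    by (intro borel_measurable_continuous_onI lipschitz_on_continuous_on)
qed

text \<open>Fubini's theorem moves the averaging from the measure to the test function, and
  averaging moves a 1-Lipschitz function by at most \<eta>.\<close>

lemma flat_dist_window:
  assumes p: "polar a b \<gamma> \<tau> \<sigma>" and \<eta>: "\<eta> > 0"
  shows "L1 a b (\<lambda>x. sval \<gamma> {x<..x + \<eta>} / \<eta>)"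
    and "\<bar>flat_dist a b (dens a b (\<lambda>x. sval \<gamma> {x<..x + \<eta>} / \<eta>)) \<gamma>\<bar> \<le> \<eta> * measure \<tau> UNIV"
proof -
  let ?g = "\<lambda>x. sval \<gamma> {x<..x + \<eta>} / \<eta>"
  note sm = polarD(1)[OF p]
  interpret \<tau>: finite_measure \<tau> by (rule polarD(5)[OF p])
  have gm: "?g \<in> borel_measurable borel" using measurable_sval_window[OF sm, of 0 \<eta>] by simp
  show gL: "L1 a b ?g"
    using \<eta> by (intro L1_bounded[OF gm, where C = "(measure (fst \<gamma>) UNIV + measure (snd \<gamma>) UNIV) / \<eta>"])
      (auto simp: divide_right_mono sval_bounded[OF sm])
  have bound: "\<bar>sint (dens a b ?g) \<phi> - sint \<gamma> \<phi>\<bar> \<le> \<eta> * measure \<tau> UNIV" if \<phi>: "flat_test a b \<phi>" for \<phi>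
  proof -
    note f = flat_test_props[OF \<phi>]
    have \<phi>i: "integrable lborel (\<lambda>x. \<phi> x / \<eta>)"
    proof -
      have "L1 a b \<phi>" by (rule L1_bounded[OF f(1,2)])
      moreover have "indicator {a<..<b} x * \<phi> x = \<phi> x" for x using f(4)[of x] by (auto split: split_indicator)
      ultimately show ?thesis by (simp add: L1_iff)
    qed
    \<comment> \<open>A window to the right for the measure becomes, up to endpoints, the window (y
      - \<eta>, y] to the left for the test function.\<close>
    define \<psi> where "\<psi> = (\<lambda>y. steklov \<eta> \<phi> (y - \<eta>))"
    have \<psi>m: "\<psi> \<in> borel_measurable borel"
      unfolding \<psi>_def by (rule measurable_compose[OF _ steklov_measurable[OF f(1)]]) measurable
    have \<psi>d: "\<bar>\<psi> y - \<phi> y\<bar> \<le> \<eta>" for y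
      unfolding \<psi>_def
    proof (rule steklov_deviation[OF \<eta> f(1,2)])
      fix t assume "t \<in> {y - \<eta><..y - \<eta> + \<eta>}"
      then show "\<bar>\<phi> t - \<phi> y\<bar> \<le> \<eta>" using f(3)[of t y] by auto
    qed (use \<eta> in auto)
    have \<psi>b: "\<bar>\<psi> y\<bar> \<le> 1 + \<eta>" for y using \<psi>d[of y] f(2)[of y] by linarith
    have inner: "(\<integral>x. indicator {x - 0<..x + \<eta>} y * (\<phi> x / \<eta>) \<partial>lborel) = \<psi> y" for y
    proof -
      have "(\<integral>x. indicator {x - 0<..x + \<eta>} y * (\<phi> x / \<eta>) \<partial>lborel) = (\<integral>t. indicator {y - \<eta><..y} t * \<phi> t / \<eta> \<partial>lborel)"
      proof (rule integral_cong_AE)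
        have "(\<lambda>x. indicator {x - 0<..x + \<eta>} y * (\<phi> x / \<eta>)) = (\<lambda>x. indicator {y - \<eta>..<y} x * (\<phi> x / \<eta>))"
          by (auto simp: fun_eq_iff split: split_indicator)
        then show "(\<lambda>x. indicator {x - 0<..x + \<eta>} y * (\<phi> x / \<eta>)) \<in> borel_measurable lborel"
          using f(1) by simp
        show "(\<lambda>t. indicator {y - \<eta><..y} t * \<phi> t / \<eta>) \<in> borel_measurable lborel" using f(1) by simp
        show "AE x in lborel. indicator {x - 0<..x + \<eta>} y * (\<phi> x / \<eta>) = indicator {y - \<eta><..y} x * \<phi> x / \<eta>"
          using AE_lborel_singleton[of y] AE_lborel_singleton[of "y - \<eta>"]
          by eventually_elim (auto split: split_indicator)
      qed
      also have "\<dots> = \<psi> y" by (simp add: \<psi>_def steklov_def)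
      finally show ?thesis .
    qed
    have "sint (dens a b ?g) \<phi> = (\<integral>x\<in>{a<..<b}. ?g x * \<phi> x \<partial>lborel)" by (rule sint_dens[OF gL f(1,2)])
    also have "\<dots> = (\<integral>x. sint \<gamma> (\<lambda>y. indicator {x - 0<..x + \<eta>} y) * (\<phi> x / \<eta>) \<partial>lborel)"
      unfolding set_lebesgue_integral_def
    proof (intro Bochner_Integration.integral_cong refl)
      fix x
      have "sint \<gamma> (\<lambda>y. indicator {x - 0<..x + \<eta>} y) = sval \<gamma> {x<..x + \<eta>}"
        using sint_indicator[OF sm, of "{x - 0<..x + \<eta>}"] by simp
      then show "indicator {a<..<b} x *\<^sub>R (?g x * \<phi> x) = sint \<gamma> (\<lambda>y. indicator {x - 0<..x + \<eta>} y) * (\<phi> x / \<eta>)"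
        using f(4)[of x] by (auto split: split_indicator)
    qed
    also have "\<dots> = sint \<gamma> (\<lambda>y. \<integral>x. indicator {x - 0<..x + \<eta>} y * (\<phi> x / \<eta>) \<partial>lborel)"
      by (rule Fubini_sint(1)[OF sm measurable_window_kernel _ \<phi>i, where C = 1, symmetric]) (auto split: split_indicator)
    also have "\<dots> = sint \<gamma> \<psi>" unfolding inner ..
    finally have "sint (dens a b ?g) \<phi> - sint \<gamma> \<phi> = sint \<gamma> \<psi> - sint \<gamma> \<phi>" by simp
    also have "\<dots> = (\<integral>x. \<psi> x * \<sigma> x \<partial>\<tau>) - (\<integral>x. \<phi> x * \<sigma> x \<partial>\<tau>)"
      by (simp add: polarD(8)[OF p \<psi>m \<psi>b] polarD(8)[OF p f(1,2)])
    also have "\<dots> = (\<integral>x. (\<psi> x - \<phi> x) * \<sigma> x \<partial>\<tau>)"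
    proof -
      have "integrable \<tau> (\<lambda>x. \<psi> x * \<sigma> x)" "integrable \<tau> (\<lambda>x. \<phi> x * \<sigma> x)"
        using polarD(3,4)[OF p] \<psi>b f \<psi>m
        by (auto intro!: integrable_fin_meas[OF polarD(2)[OF p]] simp: abs_mult)
      then show ?thesis by (simp add: left_diff_distrib)
    qed
    finally have "\<bar>sint (dens a b ?g) \<phi> - sint \<gamma> \<phi>\<bar> \<le> (\<integral>x. \<bar>(\<psi> x - \<phi> x) * \<sigma> x\<bar> \<partial>\<tau>)"
      using integral_abs_bound by metis
    also have "\<dots> \<le> (\<integral>x. \<eta> \<partial>\<tau>)"
      using \<psi>d \<eta> polarD(4)[OF p] by (intro integral_mono') (auto simp: abs_mult)
    also have "\<dots> = \<eta> * measure \<tau> UNIV" using polarD(7)[OF p] by simp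
    finally show ?thesis .
  qed
  let ?S = "{sint (dens a b ?g) \<phi> - sint \<gamma> \<phi> |\<phi>. flat_test a b \<phi>}"
  have z: "flat_test a b (\<lambda>_. 0)" by (simp add: flat_test_def)
  have up: "s \<le> \<eta> * measure \<tau> UNIV" if "s \<in> ?S" for s using that bound by (auto simp: abs_le_iff)
  \<comment> \<open>The zero test function makes the supremum nonnegative, so an upper bound for it
    bounds the absolute value.\<close>
  have "0 \<in> ?S" using z by (auto simp: sint_def intro!: exI[of _ "\<lambda>_. 0"])
  then have "0 \<le> Sup ?S" "Sup ?S \<le> \<eta> * measure \<tau> UNIV"
    using up by (auto intro!: cSup_upper cSup_least bdd_aboveI[of ?S "\<eta> * measure \<tau> UNIV"])
  then show "\<bar>flat_dist a b (dens a b ?g) \<gamma>\<bar> \<le> \<eta> * measure \<tau> UNIV" by (simp add: flat_dist_def)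
qed

lemma window_L2:
  assumes h: "L1 a b h" "L1 a b (\<lambda>x. (h x)\<^sup>2)" and \<eta>: "\<eta> > 0"
  shows "(\<integral>\<^sup>+x\<in>{a<..<b}. ennreal ((sval (dens a b h) {x<..x + \<eta>} / \<eta>)\<^sup>2) \<partial>lborel) \<le> (\<integral>\<^sup>+x\<in>{a<..<b}. ennreal ((h x)\<^sup>2) \<partial>lborel)"
proof -
  define h0 where "h0 = (\<lambda>x. indicator {a<..<b} x * h x :: real)"
  have sq: "indicator {a<..<b} x * (h x)\<^sup>2 = (h0 x)\<^sup>2" for x by (auto simp: h0_def split: split_indicator)
  have i1: "integrable lborel h0" and i2: "integrable lborel (\<lambda>x. (h0 x)\<^sup>2)"
    using h by (simp_all add: L1_iff sq) (simp add: h0_def)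
  have [measurable]: "h0 \<in> borel_measurable borel" using i1 by auto
  define H where "H = density lborel (\<lambda>x. ennreal ((h0 x)\<^sup>2))"
  have H: "fin_meas_on a b H" unfolding H_def
    using i2 by (intro fin_meas_on_density) (auto simp: h0_def split: split_indicator)
  have mH: "measure H A = (\<integral>x. indicator A x * (h0 x)\<^sup>2 \<partial>lborel)" if A[measurable]: "A \<in> sets borel" for A
  proof -
    have "emeasure H A = (\<integral>\<^sup>+x. ennreal (indicator A x * (h0 x)\<^sup>2) \<partial>lborel)"
      unfolding H_def by (subst emeasure_density) (auto intro!: nn_integral_cong split: split_indicator)
    also have "\<dots> = ennreal (\<integral>x. indicator A x * (h0 x)\<^sup>2 \<partial>lborel)"
      using integrable_real_mult_indicator[OF _ i2, of A] by (intro nn_integral_eq_integral) (auto simp: mult.commute)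
    finally show ?thesis by (simp add: measure_def)
  qed
  have CS: "(sval (dens a b h) {x<..x + \<eta>} / \<eta>)\<^sup>2 \<le> measure H {x<..x + \<eta>} / \<eta>" for x
  proof -
    let ?I = "indicator {x<..x + \<eta>} :: real \<Rightarrow> real"
    define m where "m = sval (dens a b h) {x<..x + \<eta>}"
    have m: "m = (\<integral>t. ?I t * h0 t \<partial>lborel)"
      unfolding m_def by (simp add: sval_dens[OF h(1)] set_lebesgue_integral_def h0_def indicator_inter_arith mult.assoc)
    have j1: "integrable lborel (\<lambda>t. ?I t * h0 t)"
      using integrable_real_mult_indicator[OF _ i1, of "{x<..x + \<eta>}"] by (simp add: mult.commute)
    have j2: "integrable lborel (\<lambda>t. ?I t * (h0 t)\<^sup>2)"
      using integrable_real_mult_indicator[OF _ i2, of "{x<..x + \<eta>}"] by (simp add: mult.commute)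
    have j0: "integrable lborel ?I" using \<eta> by (intro integrable_real_indicator) auto
    \<comment> \<open>Jensen's inequality, as nonnegativity of the variance of \<open>h0\<close> on
      the window, where its mean is m / \<eta>.\<close>
    have "0 \<le> (\<integral>t. ?I t * (h0 t - m / \<eta>)\<^sup>2 \<partial>lborel)" by (intro integral_nonneg_AE) auto
    also have "\<dots> = (\<integral>t. ?I t * (h0 t)\<^sup>2 - 2 * (m / \<eta>) * (?I t * h0 t) + (m / \<eta>)\<^sup>2 * ?I t \<partial>lborel)"
      by (intro Bochner_Integration.integral_cong) (auto simp: power2_eq_square algebra_simps)
    also have "\<dots> = measure H {x<..x + \<eta>} - 2 * (m / \<eta>) * m + (m / \<eta>)\<^sup>2 * \<eta>"
      using j0 j1 j2 \<eta> by (simp add: mH m)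
    also have "\<dots> = measure H {x<..x + \<eta>} - m\<^sup>2 / \<eta>"
      using \<eta> by (simp add: power2_eq_square field_simps)
    finally have "m\<^sup>2 / \<eta> / \<eta> \<le> measure H {x<..x + \<eta>} / \<eta>" using \<eta> by (intro divide_right_mono) auto
    then show ?thesis by (simp add: m_def power2_eq_square)
  qed
  have S: "emeasure lborel {a<..<b} < \<infinity>" using emeasure_lborel_box_finite[of a b] by simp
  have Wi: "integrable lborel (\<lambda>x. indicator {a<..<b} x * measure H {x<..x + \<eta>})"
    and W: "(\<integral>x. indicator {a<..<b} x * measure H {x<..x + \<eta>} \<partial>lborel) \<le> \<eta> * measure H UNIV"
    using window_Fubini[OF H _ S, of UNIV 0 \<eta>] \<eta> by auto
  have "(\<integral>\<^sup>+x\<in>{a<..<b}. ennreal ((sval (dens a b h) {x<..x + \<eta>} / \<eta>)\<^sup>2) \<partial>lborel)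
      \<le> (\<integral>\<^sup>+x. ennreal (indicator {a<..<b} x * measure H {x<..x + \<eta>} / \<eta>) \<partial>lborel)"
    using CS by (intro nn_integral_mono) (auto split: split_indicator intro!: ennreal_leI)
  also have "\<dots> = ennreal (\<integral>x. indicator {a<..<b} x * measure H {x<..x + \<eta>} / \<eta> \<partial>lborel)"
    using Wi \<eta> by (intro nn_integral_eq_integral) auto
  also have "\<dots> \<le> ennreal (measure H UNIV)"
    using W \<eta> by (intro ennreal_leI) (simp add: field_simps)
  also have "\<dots> = (\<integral>\<^sup>+x. ennreal ((h0 x)\<^sup>2) \<partial>lborel)"
    using i2 by (subst nn_integral_eq_integral) (auto simp: mH)
  also have "\<dots> = (\<integral>\<^sup>+x\<in>{a<..<b}. ennreal ((h x)\<^sup>2) \<partial>lborel)"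
    by (intro nn_integral_cong) (auto simp: h0_def split: split_indicator)
  finally show ?thesis .
qed

section \<open>A measure with total mass \<open>capped \<tau>\<close>\<close>

definition capped_meas :: "real measure \<Rightarrow> real measure" where
  "capped_meas \<tau> = density \<tau> (\<lambda>x. ennreal (qcap (measure \<tau> {x})))"

text \<open>For the last claim, an atom of mass above 2 in \<open>A\<close> already contributes 2;
  without such an atom the weight is 1 on all of \<open>A\<close>. Truncated masses are not
  additive, but the right-hand side is, so that Fubini's theorem can be applied to it.\<close>

lemma capped_meas:
  assumes \<tau>: "fin_meas_on a b \<tau>"
  shows "fin_meas_on a b (capped_meas \<tau>)" "capped \<tau> = ennreal (measure (capped_meas \<tau>) UNIV)"
    "A \<in> sets borel \<Longrightarrow> min (measure \<tau> A) 2 \<le> measure (capped_meas \<tau>) A"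
proof -
  interpret finite_measure \<tau> by (rule fin_meas_onD(3)[OF \<tau>])
  have s[measurable_cong]: "sets \<tau> = sets borel" and sp: "space \<tau> = UNIV" using fin_meas_onD[OF \<tau>] by auto
  note [measurable] = measurable_atom_mass[OF \<tau>]
  show f: "fin_meas_on a b (capped_meas \<tau>)"
    unfolding capped_meas_def using s AE_fin_meas[OF \<tau>]
  proof (intro fin_meas_on_density)
    show "integrable \<tau> (\<lambda>x. qcap (measure \<tau> {x}))"
      by (rule integrable_fin_meas[OF \<tau>, where C = 1]) (auto simp: qcap_bounds)
    show "AE x in \<tau>. x \<notin> {a<..<b} \<longrightarrow> qcap (measure \<tau> {x}) = 0"
      using AE_fin_meas[OF \<tau>] by eventually_elim auto
  qed (auto simp: qcap_bounds)
  interpret \<nu>: finite_measure "capped_meas \<tau>" by (rule fin_meas_onD(3)[OF f])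
  have em: "emeasure (capped_meas \<tau>) A = (\<integral>\<^sup>+x. ennreal (qcap (measure \<tau> {x})) * indicator A x \<partial>\<tau>)" if "A \<in> sets borel" for A
    unfolding capped_meas_def using that s by (subst emeasure_density) auto
  have "emeasure (capped_meas \<tau>) UNIV = capped \<tau>" using em[of UNIV] by (simp add: capped_def)
  then show "capped \<tau> = ennreal (measure (capped_meas \<tau>) UNIV)" by (simp add: \<nu>.emeasure_eq_measure)
  assume A: "A \<in> sets borel"
  show "min (measure \<tau> A) 2 \<le> measure (capped_meas \<tau>) A"
  proof (cases "\<exists>y\<in>A. measure \<tau> {y} > 2")
    case True
    then obtain y where y: "y \<in> A" "measure \<tau> {y} > 2" by blast
    have "emeasure (capped_meas \<tau>) {y} = (\<integral>\<^sup>+x. ennreal (qcap (measure \<tau> {y})) * indicator {y} x \<partial>\<tau>)"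
      unfolding em[OF borel_singleton[OF sets.empty_sets]]
      by (intro nn_integral_cong) (auto split: split_indicator)
    also have "\<dots> = ennreal (qcap (measure \<tau> {y}) * measure \<tau> {y})"
      using s by (simp add: nn_integral_cmult_indicator emeasure_eq_measure ennreal_mult qcap_bounds)
    also have "\<dots> = ennreal 2" using y qcap_mult[of "measure \<tau> {y}"] by (simp add: mult.commute)
    finally have "measure (capped_meas \<tau>) {y} = 2" by (simp add: measure_def)
    moreover have "measure (capped_meas \<tau>) {y} \<le> measure (capped_meas \<tau>) A"
      using y A fin_meas_onD(1)[OF f] by (intro \<nu>.finite_measure_mono) auto
    ultimately show ?thesis by simp
  next
    case False
    have "emeasure (capped_meas \<tau>) A = (\<integral>\<^sup>+x. indicator A x \<partial>\<tau>)"
      unfolding em[OF A] using False by (intro nn_integral_cong) (auto simp: qcap_def not_less split: split_indicator)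
    also have "\<dots> = emeasure \<tau> A" using A s by simp
    finally show ?thesis by (simp add: measure_def)
  qed
qed

lemma fcap_props:
  assumes "c0 \<ge> 0"
  shows "s \<le> t \<Longrightarrow> fcap c0 s \<le> fcap c0 t" "0 \<le> t \<Longrightarrow> fcap c0 t \<le> c0 * t"
  using assms by (auto simp: fcap_def mult_left_mono mult_left_le) (metis mult.right_neutral mult_left_mono not_less)

section \<open>The recovery family\<close>

text \<open>In the interior \<epsilon> times the average is at most half the mass of an enlarged
  window, the capped measure bounds the truncated mass, and Fubini's theorem gives c0 / 2 times the
  window length 2 \<epsilon> + \<eta>. Near the endpoints the averaging interval is cut off; there
  only the linear bound on \<open>fcap\<close> is used, and the mass of a thin boundary layer is
  paid.\<close>

lemma window_energy:
  assumes ab: "a < b" and c0: "c0 \<ge> 0" and p: "polar a b \<gamma> \<tau> \<sigma>" and \<eta>: "\<eta> > 0" and \<epsilon>: "0 < \<epsilon>" "\<epsilon> \<le> b - a"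
  defines "g \<equiv> \<lambda>x. sval \<gamma> {x<..x + \<eta>} / \<eta>"
  shows "ennreal (1 / \<epsilon>) * (\<integral>\<^sup>+x\<in>{a<..<b}. ennreal (fcap c0 (\<epsilon> * avg_abs a b \<epsilon> g x)) \<partial>lborel)
    \<le> ennreal (c0 * (1 + \<eta> / (2 * \<epsilon>)) * measure (capped_meas \<tau>) UNIV
          + c0 * measure \<tau> {a<..a + (2 * \<epsilon> + \<eta>)} + c0 * measure \<tau> {b - 2 * \<epsilon><..<b})"
proof -
  note sm = polarD(1)[OF p] and \<tau> = polarD(2)[OF p]
  interpret \<tau>: finite_measure \<tau> by (rule polarD(5)[OF p])
  have s: "sets \<tau> = sets borel" by (rule polarD(6)[OF p])
  let ?\<nu> = "capped_meas \<tau>"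
  note \<nu> = capped_meas[OF \<tau>]
  \<comment> \<open>The values g t with t within \<epsilon> of x only see \<gamma> inside this
    window.\<close>
  define T where "T = (\<lambda>x. measure \<tau> {x - \<epsilon><..x + (\<epsilon> + \<eta>)})"
  define \<tau>1 where "\<tau>1 = measure \<tau> {a<..a + (2 * \<epsilon> + \<eta>)}"
  define \<tau>2 where "\<tau>2 = measure \<tau> {b - 2 * \<epsilon><..<b}"
  have T0: "0 \<le> T x" for x by (simp add: T_def)
  have finI: "emeasure lborel ({x - \<epsilon><..<x + \<epsilon>} \<inter> {a<..<b}) < \<infinity>" for x
  proof -
    have "emeasure lborel ({x - \<epsilon><..<x + \<epsilon>} \<inter> {a<..<b}) \<le> emeasure lborel {x - \<epsilon><..<x + \<epsilon>}"
      by (intro emeasure_mono) auto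
    also have "\<dots> < \<infinity>" using \<epsilon>(1) by simp
    finally show ?thesis .
  qed
  have gT: "(\<integral>t\<in>{x - \<epsilon><..<x + \<epsilon>} \<inter> {a<..<b}. \<bar>g t\<bar> \<partial>lborel) \<le> T x" for x
  proof -
    let ?S = "{x - \<epsilon><..<x + \<epsilon>} \<inter> {a<..<b}"
    have Wi: "integrable lborel (\<lambda>t. indicator ?S t * measure \<tau> {t<..t + \<eta>})"
      and W: "(\<integral>t. indicator ?S t * measure \<tau> {t<..t + \<eta>} \<partial>lborel) \<le> \<eta> * T x"
      using window_Fubini[OF \<tau> _ finI[of x], of "{x - \<epsilon><..x + (\<epsilon> + \<eta>)}" 0 \<eta>] \<eta> by (auto simp: T_def)
    have "(\<integral>t\<in>?S. \<bar>g t\<bar> \<partial>lborel) \<le> (\<integral>t. indicator ?S t * measure \<tau> {t<..t + \<eta>} / \<eta> \<partial>lborel)"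
      unfolding set_lebesgue_integral_def
    proof (rule integral_mono')
      show "integrable lborel (\<lambda>t. indicator ?S t * measure \<tau> {t<..t + \<eta>} / \<eta>)" using Wi by simp
      fix t
      have "\<bar>g t\<bar> \<le> measure \<tau> {t<..t + \<eta>} / \<eta>"
        using abs_sval_le[OF p, of "{t<..t + \<eta>}"] \<eta> by (simp add: g_def divide_right_mono)
      then show "indicator ?S t *\<^sub>R \<bar>g t\<bar> \<le> indicator ?S t * measure \<tau> {t<..t + \<eta>} / \<eta>"
        by (simp split: split_indicator)
    qed (use \<eta> in auto)
    also have "\<dots> \<le> T x" using W \<eta> by (simp add: field_simps)
    finally show ?thesis .
  qed
  have len: "{x - \<epsilon><..<x + \<epsilon>} \<inter> {a<..<b} = {max (x - \<epsilon>) a<..<min (x + \<epsilon>) b}" for x by auto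
  have mlen: "measure lborel ({x - \<epsilon><..<x + \<epsilon>} \<inter> {a<..<b}) = min (x + \<epsilon>) b - max (x - \<epsilon>) a" if "x \<in> {a<..<b}" for x
    unfolding len using that ab \<epsilon> by (subst measure_lborel_Ioo) auto
  \<comment> \<open>The interior bound plus a constant on each layer of width \<epsilon>; the
    division by \<epsilon> leaves the layer masses with factor c0.\<close>
  define R where "R = (\<lambda>x. c0 / 2 * measure ?\<nu> {x - \<epsilon><..x + (\<epsilon> + \<eta>)} + c0 * \<tau>1 * indicator {a<..<a + \<epsilon>} x + c0 * \<tau>2 * indicator {b - \<epsilon><..<b} x)"
  have TI: "T x = measure \<tau> ({x - \<epsilon><..x + (\<epsilon> + \<eta>)} \<inter> {a<..<b})" for x
    unfolding T_def by (rule measure_fin_meas_Int[OF \<tau>]) auto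
  have Tout: "T x \<le> \<tau>1" if "x < a + \<epsilon>" for x
    unfolding TI \<tau>1_def
    using that s by (intro \<tau>.finite_measure_mono) auto
  have Tout2: "T x \<le> \<tau>2" if "b - \<epsilon> < x" for x
    unfolding TI \<tau>2_def
    using that s by (intro \<tau>.finite_measure_mono) auto
  have \<nu>0: "0 \<le> c0 / 2 * measure ?\<nu> A" for A using c0 by simp
  have \<tau>12: "0 \<le> c0 * \<tau>1" "0 \<le> c0 * \<tau>2" using c0 by (auto simp: \<tau>1_def \<tau>2_def)
  have pw: "fcap c0 (\<epsilon> * avg_abs a b \<epsilon> g x) \<le> R x" if x: "x \<in> {a<..<b}" for x
  proof -
    let ?I = "\<integral>t\<in>{x - \<epsilon><..<x + \<epsilon>} \<inter> {a<..<b}. \<bar>g t\<bar> \<partial>lborel"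
    have I0: "0 \<le> ?I" by (simp add: set_lebesgue_integral_def)
    show ?thesis
    proof (cases "a + \<epsilon> \<le> x \<and> x \<le> b - \<epsilon>")
      case True
      then have "\<epsilon> * avg_abs a b \<epsilon> g x = ?I / 2"
        using mlen[OF x] \<epsilon> by (simp add: avg_abs_def min_absorb1 max_absorb1)
      also have "\<dots> \<le> T x / 2" using gT[of x] by simp
      finally have "fcap c0 (\<epsilon> * avg_abs a b \<epsilon> g x) \<le> fcap c0 (T x / 2)" by (rule fcap_props(1)[OF c0])
      also have "\<dots> = c0 / 2 * min (T x) 2" using fcap_eq[OF T0[of x], of c0] by simp
      also have "\<dots> \<le> c0 / 2 * measure ?\<nu> {x - \<epsilon><..x + (\<epsilon> + \<eta>)}"
        unfolding T_def using c0 by (intro mult_left_mono \<nu>(3)) auto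
      also have "\<dots> \<le> R x" using \<tau>12 by (auto simp: R_def split: split_indicator)
      finally show ?thesis .
    next
      case False
      \<comment> \<open>If one side is not cut off, that half of the interval alone has length
        \<epsilon>; if both are, the whole of (a, b) remains, of length at least \<epsilon>.\<close>
      have L: "\<epsilon> \<le> measure lborel ({x - \<epsilon><..<x + \<epsilon>} \<inter> {a<..<b})"
        unfolding mlen[OF x] using x \<epsilon> ab by (auto simp: min_def max_def)
      have "avg_abs a b \<epsilon> g x \<le> ?I / \<epsilon>"
        unfolding avg_abs_def using L I0 \<epsilon> by (intro divide_left_mono) (auto intro!: mult_pos_pos)
      then have le: "\<epsilon> * avg_abs a b \<epsilon> g x \<le> T x" using gT[of x] \<epsilon> by (simp add: field_simps)
      have "fcap c0 (\<epsilon> * avg_abs a b \<epsilon> g x) \<le> fcap c0 (T x)" by (rule fcap_props(1)[OF c0 le])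
      also have "\<dots> \<le> c0 * T x" by (rule fcap_props(2)[OF c0 T0])
      also have "\<dots> \<le> R x"
      proof (cases "x < a + \<epsilon>")
        case True
        then have "c0 * T x \<le> c0 * \<tau>1 * indicator {a<..<a + \<epsilon>} x" using x c0 Tout[of x] by (simp add: mult_left_mono)
        moreover have "0 \<le> c0 * \<tau>2 * indicator {b - \<epsilon><..<b} x" using \<tau>12 by (simp split: split_indicator)
        ultimately show ?thesis using \<nu>0[of "{x - \<epsilon><..x + (\<epsilon> + \<eta>)}"] unfolding R_def by linarith
      next
        case F2: False
        then have "b - \<epsilon> < x" using False by auto
        then have "c0 * T x \<le> c0 * \<tau>2 * indicator {b - \<epsilon><..<b} x" using x c0 Tout2[of x] by (simp add: mult_left_mono)
        moreover have "0 \<le> c0 * \<tau>1 * indicator {a<..<a + \<epsilon>} x" using \<tau>12 by (simp split: split_indicator)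
        ultimately show ?thesis using \<nu>0[of "{x - \<epsilon><..x + (\<epsilon> + \<eta>)}"] unfolding R_def by linarith
      qed
      finally show ?thesis .
    qed
  qed
  have S: "emeasure lborel {a<..<b} < \<infinity>" using emeasure_lborel_box_finite[of a b] by simp
  have Wi: "integrable lborel (\<lambda>x. indicator {a<..<b} x * measure ?\<nu> {x - \<epsilon><..x + (\<epsilon> + \<eta>)})"
    and W: "(\<integral>x. indicator {a<..<b} x * measure ?\<nu> {x - \<epsilon><..x + (\<epsilon> + \<eta>)} \<partial>lborel) \<le> (\<epsilon> + (\<epsilon> + \<eta>)) * measure ?\<nu> UNIV"
    using window_Fubini[OF \<nu>(1) _ S, of UNIV \<epsilon> "\<epsilon> + \<eta>"] \<epsilon> \<eta> by auto
  have e1: "(\<lambda>x. indicator {a<..<b} x * R x) = (\<lambda>x. c0 / 2 * (indicator {a<..<b} x * measure ?\<nu> {x - \<epsilon><..x + (\<epsilon> + \<eta>)})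
      + c0 * \<tau>1 * indicator {a<..<a + \<epsilon>} x + c0 * \<tau>2 * indicator {b - \<epsilon><..<b} x)"
    using \<epsilon> ab by (auto simp: R_def fun_eq_iff split: split_indicator)
  have Ri: "integrable lborel (\<lambda>x. indicator {a<..<b} x * R x)"
    unfolding e1 using Wi \<epsilon> by (intro Bochner_Integration.integrable_add integrable_mult_right) (auto intro!: integrable_real_indicator)
  have "(\<integral>x. indicator {a<..<b} x * R x \<partial>lborel) = c0 / 2 * (\<integral>x. indicator {a<..<b} x * measure ?\<nu> {x - \<epsilon><..x + (\<epsilon> + \<eta>)} \<partial>lborel)
      + c0 * \<tau>1 * \<epsilon> + c0 * \<tau>2 * \<epsilon>"
  proof -
    have "integrable lborel (indicator {a<..<a + \<epsilon>} :: real \<Rightarrow> real)" "integrable lborel (indicator {b - \<epsilon><..<b} :: real \<Rightarrow> real)"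
      using \<epsilon> by (auto intro!: integrable_real_indicator)
    then show ?thesis unfolding e1 using Wi \<epsilon> by simp
  qed
  also have "\<dots> \<le> c0 / 2 * ((\<epsilon> + (\<epsilon> + \<eta>)) * measure ?\<nu> UNIV) + c0 * \<tau>1 * \<epsilon> + c0 * \<tau>2 * \<epsilon>"
    using W c0 by (intro add_right_mono mult_left_mono) auto
  also have "\<dots> = \<epsilon> * (c0 * (1 + \<eta> / (2 * \<epsilon>)) * measure ?\<nu> UNIV + c0 * \<tau>1 + c0 * \<tau>2)"
  proof -
    have "\<epsilon> * (1 + \<eta> / (2 * \<epsilon>)) = (\<epsilon> + (\<epsilon> + \<eta>)) / 2" using \<epsilon> by (simp add: distrib_left add_divide_distrib)
    then have "\<epsilon> * (c0 * (1 + \<eta> / (2 * \<epsilon>)) * measure ?\<nu> UNIV) = c0 / 2 * ((\<epsilon> + (\<epsilon> + \<eta>)) * measure ?\<nu> UNIV)"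
      by (metis (no_types, opaque_lifting) mult.assoc mult.left_commute times_divide_eq_left times_divide_eq_right)
    then show ?thesis by (simp add: distrib_left mult.commute)
  qed
  finally have RI: "(\<integral>x. indicator {a<..<b} x * R x \<partial>lborel) / \<epsilon> \<le> c0 * (1 + \<eta> / (2 * \<epsilon>)) * measure ?\<nu> UNIV + c0 * \<tau>1 + c0 * \<tau>2"
    using \<epsilon> by (simp add: pos_divide_le_eq mult.commute)
  have R0: "0 \<le> R x" for x
    unfolding R_def using \<nu>0 \<tau>12 by (auto intro!: add_nonneg_nonneg split: split_indicator)
  have "ennreal (1 / \<epsilon>) * (\<integral>\<^sup>+x\<in>{a<..<b}. ennreal (fcap c0 (\<epsilon> * avg_abs a b \<epsilon> g x)) \<partial>lborel)
     \<le> ennreal (1 / \<epsilon>) * (\<integral>\<^sup>+x. ennreal (indicator {a<..<b} x * R x) \<partial>lborel)"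
    using pw by (intro mult_left_mono nn_integral_mono) (auto split: split_indicator intro!: ennreal_leI)
  also have "\<dots> = ennreal (1 / \<epsilon>) * ennreal (\<integral>x. indicator {a<..<b} x * R x \<partial>lborel)"
    using Ri R0 by (subst nn_integral_eq_integral) auto
  also have "\<dots> = ennreal ((\<integral>x. indicator {a<..<b} x * R x \<partial>lborel) / \<epsilon>)"
    using \<epsilon> R0 by (subst ennreal_mult[symmetric]) (auto intro!: integral_nonneg_AE)
  also have "\<dots> \<le> ennreal (c0 * (1 + \<eta> / (2 * \<epsilon>)) * measure ?\<nu> UNIV + c0 * \<tau>1 + c0 * \<tau>2)"
    by (rule ennreal_leI[OF RI])
  finally show ?thesis by (simp add: \<tau>1_def \<tau>2_def)
qed

text \<open>The layers exclude \<open>a\<close> and \<open>b\<close>, so they shrink to the empty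
  set. In terms of the distribution function this is right continuity at \<open>a\<close> and the
  left limit at \<open>b\<close>.\<close>

lemma boundary_mass_tendsto_0:
  assumes ab: "a < b" and \<tau>: "fin_meas_on a b \<tau>"
  shows "((\<lambda>\<epsilon>. measure \<tau> {a<..a + (2 * \<epsilon> + \<epsilon>\<^sup>2)}) \<longlongrightarrow> 0) (at_right 0)"
    and "((\<lambda>\<epsilon>. measure \<tau> {b - 2 * \<epsilon><..<b}) \<longlongrightarrow> 0) (at_right 0)"
proof -
  have fb: "finite_borel_measure \<tau>"
    using fin_meas_onD(1,3)[OF \<tau>] by (auto simp: finite_borel_measure_def finite_borel_measure_axioms_def)
  note sm = smeas_single[OF \<tau>]
  have pos: "\<forall>\<^sub>F \<epsilon> in at_right (0::real). 0 < \<epsilon>" by (simp add: eventually_at_filter)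
  have Ioc: "measure \<tau> {x<..y} = measure \<tau> {..y} - measure \<tau> {..x}" if "x \<le> y" for x y
    using sval_Ioc[OF sm(1) that] by (simp add: sm(3))
  have "filterlim (\<lambda>\<epsilon>. a + (2 * \<epsilon> + \<epsilon>\<^sup>2)) (at_right a) (at_right (0::real))"
    unfolding filterlim_at
  proof
    have "((\<lambda>\<epsilon>. a + (2 * \<epsilon> + \<epsilon>\<^sup>2)) \<longlongrightarrow> a + (2 * 0 + 0\<^sup>2)) (at_right (0::real))" by (intro tendsto_add tendsto_mult tendsto_power tendsto_ident_at tendsto_const)
    then show "((\<lambda>\<epsilon>. a + (2 * \<epsilon> + \<epsilon>\<^sup>2)) \<longlongrightarrow> a) (at_right (0::real))" by simp
    show "\<forall>\<^sub>F \<epsilon> in at_right 0. a + (2 * \<epsilon> + \<epsilon>\<^sup>2) \<in> {a<..} \<and> a + (2 * \<epsilon> + \<epsilon>\<^sup>2) \<noteq> a"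
      using pos by eventually_elim (smt (verit) greaterThan_iff zero_less_power)
  qed
  with finite_borel_measure.cdf_is_right_cont[OF fb, of a]
  have "((\<lambda>\<epsilon>. measure \<tau> {..a + (2 * \<epsilon> + \<epsilon>\<^sup>2)}) \<longlongrightarrow> measure \<tau> {..a}) (at_right 0)"
    unfolding continuous_within cdf_def by (rule filterlim_compose)
  then have "((\<lambda>\<epsilon>. measure \<tau> {..a + (2 * \<epsilon> + \<epsilon>\<^sup>2)} - measure \<tau> {..a}) \<longlongrightarrow> measure \<tau> {..a} - measure \<tau> {..a}) (at_right 0)"
    by (intro tendsto_intros)
  moreover have "\<forall>\<^sub>F \<epsilon> in at_right 0. measure \<tau> {..a + (2 * \<epsilon> + \<epsilon>\<^sup>2)} - measure \<tau> {..a} = measure \<tau> {a<..a + (2 * \<epsilon> + \<epsilon>\<^sup>2)}"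
    using pos by eventually_elim (subst Ioc, auto)
  ultimately show "((\<lambda>\<epsilon>. measure \<tau> {a<..a + (2 * \<epsilon> + \<epsilon>\<^sup>2)}) \<longlongrightarrow> 0) (at_right 0)"
    using Lim_transform_eventually by fastforce
  have "filterlim (\<lambda>\<epsilon>. b - 2 * \<epsilon>) (at_left b) (at_right (0::real))"
    unfolding filterlim_at
  proof
    have "((\<lambda>\<epsilon>. b - 2 * \<epsilon>) \<longlongrightarrow> b - 2 * 0) (at_right (0::real))" by (intro tendsto_diff tendsto_mult tendsto_ident_at tendsto_const)
    then show "((\<lambda>\<epsilon>. b - 2 * \<epsilon>) \<longlongrightarrow> b) (at_right (0::real))" by simp
    show "\<forall>\<^sub>F \<epsilon> in at_right 0. b - 2 * \<epsilon> \<in> {..<b} \<and> b - 2 * \<epsilon> \<noteq> b"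
      using pos by eventually_elim auto
  qed
  with finite_borel_measure.cdf_at_left[OF fb, of b]
  have "((\<lambda>\<epsilon>. measure \<tau> {..b - 2 * \<epsilon>}) \<longlongrightarrow> measure \<tau> {..<b}) (at_right 0)"
    unfolding cdf_def by (rule filterlim_compose)
  then have "((\<lambda>\<epsilon>. measure \<tau> {..<b} - measure \<tau> {..b - 2 * \<epsilon>}) \<longlongrightarrow> measure \<tau> {..<b} - measure \<tau> {..<b}) (at_right 0)"
    by (intro tendsto_intros)
  moreover have "\<forall>\<^sub>F \<epsilon> in at_right 0. measure \<tau> {..<b} - measure \<tau> {..b - 2 * \<epsilon>} = measure \<tau> {b - 2 * \<epsilon><..<b}"
    using pos
  proof eventually_elim
    case (elim \<epsilon>)
    interpret finite_measure \<tau> by (rule fin_meas_onD(3)[OF \<tau>])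
    have "measure \<tau> ({..<b} - {..b - 2 * \<epsilon>}) = measure \<tau> {..<b} - measure \<tau> {..b - 2 * \<epsilon>}"
      using fin_meas_onD(1)[OF \<tau>] elim by (intro finite_measure_Diff) auto
    moreover have "{..<b} - {..b - 2 * \<epsilon>} = {b - 2 * \<epsilon><..<b}" by auto
    ultimately show ?case by simp
  qed
  ultimately show "((\<lambda>\<epsilon>. measure \<tau> {b - 2 * \<epsilon><..<b}) \<longlongrightarrow> 0) (at_right 0)"
    using Lim_transform_eventually by fastforce
qed

text \<open>The width \<eta> = \<epsilon>^2 makes the L1 and flat distances of order \<epsilon>^2
  and the factor 1 + \<eta> / (2 \<epsilon>) tend to 1. Averaging is linear, so the derivative of
  the averaged \<open>u\<close> minus the averaged \<open>\<gamma>\<close> is exactly the averaged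
  \<open>h\<close>.\<close>

lemma recovery_family:
  assumes ab: "a < b" and c0: "c0 > 0" and K: "K > 0" and p: "polar a b \<gamma> \<tau> \<sigma>"
    and u: "meas_deriv a b u (add_smeas \<gamma> (dens a b h))" "ess_bdd a b K u"
    and h: "L1 a b h" "L1 a b (\<lambda>x. (h x)\<^sup>2)"
  shows "\<exists>(ue :: real \<Rightarrow> real \<Rightarrow> real) (ge :: real \<Rightarrow> smeasure).
      (\<forall>\<epsilon>>0. L1 a b (ue \<epsilon>) \<and> smeas a b (ge \<epsilon>)) \<and>
      ((\<lambda>\<epsilon>. \<integral>x\<in>{a<..<b}. \<bar>ue \<epsilon> x - u x\<bar> \<partial>lborel) \<longlongrightarrow> 0) (at_right 0) \<and>
      ((\<lambda>\<epsilon>. flat_dist a b (ge \<epsilon>) \<gamma>) \<longlongrightarrow> 0) (at_right 0) \<and>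
      Limsup (at_right 0) (\<lambda>\<epsilon>. Eeps a b K c0 \<epsilon> (ue \<epsilon>) (ge \<epsilon>))
        \<le> (\<integral>\<^sup>+x\<in>{a<..<b}. ennreal ((h x)\<^sup>2) \<partial>lborel) + ennreal c0 * capped \<tau>"
proof -
  note sm = polarD(1)[OF p] and \<tau> = polarD(2)[OF p] and sh = smeas_dens[OF h(1)]
  define D where "D = add_smeas \<gamma> (dens a b h)"
  have D: "smeas a b D" unfolding D_def by (intro smeas_add sm sh)
  obtain c where c: "AE x in lborel. x \<in> {a<..<b} \<longrightarrow> u x = c + sval D {..x}"
    using meas_deriv_primitive[OF ab u(1)] unfolding D_def by blast
  \<comment> \<open>\<open>K\<close> bounds \<open>u\<close> only almost everywhere on (a, b), while
    the averages also use values beyond \<open>b\<close>.\<close>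
  have bd: "AE x in lborel. a < x \<longrightarrow> \<bar>c + sval D {..x}\<bar> \<le> K"
  proof (rule primitive_bounded_right[OF ab D])
    show "AE x in lborel. x \<in> {a<..<b} \<longrightarrow> \<bar>c + sval D {..x}\<bar> \<le> K"
      using c u(2) unfolding ess_bdd_def by eventually_elim auto
  qed
  define ue where "ue = (\<lambda>\<epsilon>. steklov (\<epsilon>\<^sup>2) (\<lambda>x. c + sval D {..x}))"
  define g where "g = (\<lambda>\<epsilon> x. sval \<gamma> {x<..x + \<epsilon>\<^sup>2} / \<epsilon>\<^sup>2)"
  define ge where "ge = (\<lambda>\<epsilon>. dens a b (g \<epsilon>))"
  have pos: "\<forall>\<^sub>F \<epsilon> in at_right (0::real). 0 < \<epsilon>" by (simp add: eventually_at_filter)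
  have e2: "((\<lambda>\<epsilon>. \<epsilon>\<^sup>2 * C) \<longlongrightarrow> 0) (at_right 0)" for C :: real
  proof -
    have "((\<lambda>\<epsilon>. \<epsilon>\<^sup>2 * C) \<longlongrightarrow> 0\<^sup>2 * C) (at_right 0)" by (intro tendsto_mult tendsto_power tendsto_ident_at tendsto_const)
    then show ?thesis by simp
  qed
  have wd: "weak_deriv a b (ue \<epsilon>) (\<lambda>x. sval D {x<..x + \<epsilon>\<^sup>2} / \<epsilon>\<^sup>2)" if "\<epsilon> > 0" for \<epsilon>
    unfolding ue_def using weak_deriv_steklov[OF ab D, of "\<epsilon>\<^sup>2" c] that by simp
  have gL: "L1 a b (g \<epsilon>)" if "\<epsilon> > 0" for \<epsilon>
    unfolding g_def using flat_dist_window(1)[OF p, of "\<epsilon>\<^sup>2"] that by simp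
  have 1: "\<forall>\<epsilon>>0. L1 a b (ue \<epsilon>) \<and> smeas a b (ge \<epsilon>)"
    using wd gL by (auto simp: weak_deriv_def ge_def intro: smeas_dens)
  have 2: "((\<lambda>\<epsilon>. \<integral>x\<in>{a<..<b}. \<bar>ue \<epsilon> x - u x\<bar> \<partial>lborel) \<longlongrightarrow> 0) (at_right 0)"
  proof (rule tendsto_sandwich[OF _ _ tendsto_const e2])
    show "\<forall>\<^sub>F \<epsilon> in at_right 0. 0 \<le> (\<integral>x\<in>{a<..<b}. \<bar>ue \<epsilon> x - u x\<bar> \<partial>lborel)"
      by (simp add: set_lebesgue_integral_def)
    show "\<forall>\<^sub>F \<epsilon> in at_right 0. (\<integral>x\<in>{a<..<b}. \<bar>ue \<epsilon> x - u x\<bar> \<partial>lborel) \<le> \<epsilon>\<^sup>2 * measure (add_meas (fst D) (snd D)) UNIV"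
      using pos unfolding ue_def by eventually_elim (rule steklov_L1_dist[OF D _ c], simp)
  qed
  have 3: "((\<lambda>\<epsilon>. flat_dist a b (ge \<epsilon>) \<gamma>) \<longlongrightarrow> 0) (at_right 0)"
  proof (rule Lim_null_comparison[OF _ e2])
    show "\<forall>\<^sub>F \<epsilon> in at_right 0. norm (flat_dist a b (ge \<epsilon>) \<gamma>) \<le> \<epsilon>\<^sup>2 * measure \<tau> UNIV"
      using pos unfolding ge_def g_def real_norm_def by eventually_elim (rule flat_dist_window(2)[OF p], simp)
  qed
  define B where "B = (\<lambda>\<epsilon>. c0 * (1 + \<epsilon> / 2) * measure (capped_meas \<tau>) UNIV
          + c0 * measure \<tau> {a<..a + (2 * \<epsilon> + \<epsilon>\<^sup>2)} + c0 * measure \<tau> {b - 2 * \<epsilon><..<b})"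
  have lim: "(B \<longlongrightarrow> c0 * (1 + 0 / 2) * measure (capped_meas \<tau>) UNIV + c0 * 0 + c0 * 0) (at_right 0)"
    unfolding B_def by (intro tendsto_intros boundary_mass_tendsto_0[OF ab \<tau>]) simp
  have small: "\<forall>\<^sub>F \<epsilon> in at_right 0. \<epsilon> \<le> b - a"
    using ab by (intro eventually_at_rightI[of 0 "b - a"]) auto
  have "\<forall>\<^sub>F \<epsilon> in at_right 0. Eeps a b K c0 \<epsilon> (ue \<epsilon>) (ge \<epsilon>) \<le> (\<integral>\<^sup>+x\<in>{a<..<b}. ennreal ((h x)\<^sup>2) \<partial>lborel) + ennreal (B \<epsilon>)"
    using pos small
  proof eventually_elim
    case (elim \<epsilon>)
    let ?v = "\<lambda>x. sval D {x<..x + \<epsilon>\<^sup>2} / \<epsilon>\<^sup>2"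
    have \<eta>: "0 < \<epsilon>\<^sup>2" using elim by simp
    have vg: "?v x - g \<epsilon> x = sval (dens a b h) {x<..x + \<epsilon>\<^sup>2} / \<epsilon>\<^sup>2" for x
      unfolding D_def g_def by (simp add: sval_add[OF sm sh] add_divide_distrib)
    have ess: "ess_bdd a b K (ue \<epsilon>)"
      unfolding ess_bdd_def
    proof (rule AE_I2, rule impI)
      fix x assume x: "x \<in> {a<..<b}"
      show "\<bar>ue \<epsilon> x\<bar> \<le> K"
        unfolding ue_def
      proof (rule steklov_bounded_AE[OF \<eta>])
        show "AE t in lborel. t \<in> {x<..x + \<epsilon>\<^sup>2} \<longrightarrow> \<bar>c + sval D {..t}\<bar> \<le> K"
          using bd by eventually_elim (use x in auto)
      qed (use K in simp)
    qed
    have L2: "L1 a b (\<lambda>x. (?v x - g \<epsilon> x)\<^sup>2)"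
      unfolding vg
    proof (rule L1_bounded)
      show "(\<lambda>x. (sval (dens a b h) {x<..x + \<epsilon>\<^sup>2} / \<epsilon>\<^sup>2)\<^sup>2) \<in> borel_measurable borel"
        using measurable_sval_window[OF sh, of 0 "\<epsilon>\<^sup>2"] by simp
      fix x
      have "\<bar>sval (dens a b h) {x<..x + \<epsilon>\<^sup>2}\<bar> \<le> measure (fst (dens a b h)) UNIV + measure (snd (dens a b h)) UNIV"
        by (rule sval_bounded[OF sh]) auto
      then have "\<bar>sval (dens a b h) {x<..x + \<epsilon>\<^sup>2} / \<epsilon>\<^sup>2\<bar> \<le> (measure (fst (dens a b h)) UNIV + measure (snd (dens a b h)) UNIV) / \<epsilon>\<^sup>2"
        using \<eta> by (simp add: divide_right_mono)
      then show "\<bar>(sval (dens a b h) {x<..x + \<epsilon>\<^sup>2} / \<epsilon>\<^sup>2)\<^sup>2\<bar> \<le> ((measure (fst (dens a b h)) UNIV + measure (snd (dens a b h)) UNIV) / \<epsilon>\<^sup>2)\<^sup>2"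
        using power_mono[of "\<bar>sval (dens a b h) {x<..x + \<epsilon>\<^sup>2} / \<epsilon>\<^sup>2\<bar>" _ 2] by (simp only: power2_abs abs_power2 abs_ge_zero)
    qed
    have "Eeps a b K c0 \<epsilon> (ue \<epsilon>) (ge \<epsilon>) \<le> (\<integral>\<^sup>+x\<in>{a<..<b}. ennreal ((?v x - g \<epsilon> x)\<^sup>2) \<partial>lborel)
        + ennreal (1 / \<epsilon>) * (\<integral>\<^sup>+x\<in>{a<..<b}. ennreal (fcap c0 (\<epsilon> * avg_abs a b \<epsilon> (g \<epsilon>) x)) \<partial>lborel)"
      unfolding Eeps_def
    proof (rule INF_lower2[of "(?v, g \<epsilon>)"])
      show "(?v, g \<epsilon>) \<in> {(v, g). weak_deriv a b (ue \<epsilon>) v \<and> ess_bdd a b K (ue \<epsilon>) \<and> smeas a b (ge \<epsilon>) \<and> L1 a b g \<and>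
          (\<forall>A\<in>sets borel. sval (ge \<epsilon>) A = (\<integral>x\<in>A \<inter> {a<..<b}. g x \<partial>lborel)) \<and> L1 a b (\<lambda>x. (v x - g x)\<^sup>2)}"
        using wd[OF elim(1)] ess gL[OF elim(1)] L2 by (simp add: ge_def smeas_dens sval_dens)
    qed simp
    also have "\<dots> \<le> (\<integral>\<^sup>+x\<in>{a<..<b}. ennreal ((h x)\<^sup>2) \<partial>lborel) + ennreal (B \<epsilon>)"
    proof (rule add_mono)
      show "(\<integral>\<^sup>+x\<in>{a<..<b}. ennreal ((?v x - g \<epsilon> x)\<^sup>2) \<partial>lborel) \<le> (\<integral>\<^sup>+x\<in>{a<..<b}. ennreal ((h x)\<^sup>2) \<partial>lborel)"
        unfolding vg by (rule window_L2[OF h \<eta>])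
      have eq: "\<epsilon>\<^sup>2 / (2 * \<epsilon>) = \<epsilon> / 2" using elim by (simp add: power2_eq_square)
      show "ennreal (1 / \<epsilon>) * (\<integral>\<^sup>+x\<in>{a<..<b}. ennreal (fcap c0 (\<epsilon> * avg_abs a b \<epsilon> (g \<epsilon>) x)) \<partial>lborel) \<le> ennreal (B \<epsilon>)"
        using window_energy[OF ab _ p \<eta> elim, of c0] c0 unfolding eq g_def B_def by simp
    qed
    finally show ?case .
  qed
  then have "Limsup (at_right 0) (\<lambda>\<epsilon>. Eeps a b K c0 \<epsilon> (ue \<epsilon>) (ge \<epsilon>)) \<le>
      Limsup (at_right 0) (\<lambda>\<epsilon>. (\<integral>\<^sup>+x\<in>{a<..<b}. ennreal ((h x)\<^sup>2) \<partial>lborel) + ennreal (B \<epsilon>))"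
    by (rule Limsup_mono)
  also have "\<dots> = (\<integral>\<^sup>+x\<in>{a<..<b}. ennreal ((h x)\<^sup>2) \<partial>lborel) + ennreal (c0 * (1 + 0 / 2) * measure (capped_meas \<tau>) UNIV + c0 * 0 + c0 * 0)"
    by (intro lim_imp_Limsup tendsto_add tendsto_const tendsto_ennrealI lim) auto
  also have "\<dots> = (\<integral>\<^sup>+x\<in>{a<..<b}. ennreal ((h x)\<^sup>2) \<partial>lborel) + ennreal c0 * capped \<tau>"
    using c0 by (simp add: capped_meas(2)[OF \<tau>] ennreal_mult)
  finally show ?thesis using 1 2 3 by blast
qed

text \<open>\<open>Elim\<close> is an infimum over decompositions, but a recovery family is built
  from one of them. Since \<open>u\<close> determines its derivative measure, h = v - g is almost
  everywhere the same for all decompositions, and one family serves the whole infimum.\<close>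

lemma limsup_inequality:
  assumes ab: "a < b" and c0: "c0 > 0" and K: "K > 0" and u: "L1 a b u" and \<gamma>: "smeas a b \<gamma>"
  shows "\<exists>(ue :: real \<Rightarrow> real \<Rightarrow> real) (ge :: real \<Rightarrow> smeasure).
      (\<forall>\<epsilon>>0. L1 a b (ue \<epsilon>) \<and> smeas a b (ge \<epsilon>)) \<and>
      ((\<lambda>\<epsilon>. \<integral>x\<in>{a<..<b}. \<bar>ue \<epsilon> x - u x\<bar> \<partial>lborel) \<longlongrightarrow> 0) (at_right 0) \<and>
      ((\<lambda>\<epsilon>. flat_dist a b (ge \<epsilon>) \<gamma>) \<longlongrightarrow> 0) (at_right 0) \<and>
      Limsup (at_right 0) (\<lambda>\<epsilon>. Eeps a b K c0 \<epsilon> (ue \<epsilon>) (ge \<epsilon>)) \<le> Elim a b K c0 u \<gamma>"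
proof -
  define W where "W = {(Du, v, Ds, g). BV_decomp a b u Du v Ds \<and> ess_bdd a b K u \<and> smeas a b \<gamma> \<and>
                 L1 a b g \<and>
                 (\<forall>A \<in> sets borel. sval \<gamma> A = sval Ds A + (\<integral>x\<in>A \<inter> {a<..<b}. g x \<partial>lborel)) \<and>
                 L1 a b (\<lambda>x. (v x - g x)^2)}"
  obtain \<tau> \<sigma> where p: "polar a b \<gamma> \<tau> \<sigma>" using ex_polar[OF \<gamma>] by blast
  show ?thesis
  proof (cases "W = {}")
    \<comment> \<open>Without an admissible decomposition the limit energy is infinite, and the
      constant family suffices.\<close>
    case True
    have "Elim a b K c0 u \<gamma> = \<infinity>" unfolding Elim_def W_def[symmetric] True by simp
    moreover have "flat_dist a b \<gamma> \<gamma> = 0"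
    proof -
      have "{sint \<gamma> \<phi> - sint \<gamma> \<phi> |\<phi>. flat_test a b \<phi>} = {0}"
        by (auto simp: flat_test_def intro!: exI[of _ "\<lambda>_. 0"])
      then show ?thesis by (simp add: flat_dist_def)
    qed
    ultimately show ?thesis
      using u \<gamma> by (intro exI[of _ "\<lambda>_. u"] exI[of _ "\<lambda>_. \<gamma>"]) (auto simp: set_lebesgue_integral_def)
  next
    case False
    \<comment> \<open>The singular part is common to the derivative of \<open>u\<close> and to
      \<open>\<gamma>\<close>, so it cancels in their difference.\<close>
    have wit: "meas_deriv a b u (add_smeas \<gamma> (dens a b (\<lambda>x. v x - g x))) \<and> L1 a b (\<lambda>x. v x - g x) \<and>
        (\<forall>A\<in>sets borel. sval (dens a b (\<lambda>x. v x - g x)) A = sval Du A - sval \<gamma> A)"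
      if w: "(Du, v, Ds, g) \<in> W" for Du v Ds g
    proof -
      have D: "meas_deriv a b u Du" and v: "L1 a b v" and g: "L1 a b g"
        and Du: "\<And>A. A \<in> sets borel \<Longrightarrow> sval Du A = (\<integral>x\<in>A \<inter> {a<..<b}. v x \<partial>lborel) + sval Ds A"
        and gam: "\<And>A. A \<in> sets borel \<Longrightarrow> sval \<gamma> A = sval Ds A + (\<integral>x\<in>A \<inter> {a<..<b}. g x \<partial>lborel)"
        using w by (auto simp: W_def BV_decomp_def)
      have h: "L1 a b (\<lambda>x. v x - g x)" by (rule L1_diff[OF v g])
      have eq: "sval (dens a b (\<lambda>x. v x - g x)) A = sval Du A - sval \<gamma> A" if A: "A \<in> sets borel" for A
      proof -
        have "set_integrable lborel (A \<inter> {a<..<b}) v" "set_integrable lborel (A \<inter> {a<..<b}) g"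
          using v g A by (auto simp: L1_def intro: set_integrable_subset)
        then show ?thesis by (simp add: sval_dens[OF h A] Du[OF A] gam[OF A])
      qed
      have sD: "smeas a b Du" using D by (simp add: meas_deriv_def)
      have "meas_deriv a b u (add_smeas \<gamma> (dens a b (\<lambda>x. v x - g x)))"
        unfolding meas_deriv_def
      proof (intro conjI allI impI u smeas_add \<gamma> smeas_dens h)
        fix \<phi> assume \<phi>: "test_fun a b \<phi>"
        have "sint (add_smeas \<gamma> (dens a b (\<lambda>x. v x - g x))) \<phi> = sint Du \<phi>"
          unfolding sint_by_parts[OF smeas_add[OF \<gamma> smeas_dens[OF h]] \<phi>] sint_by_parts[OF sD \<phi>]
          by (simp add: sval_add[OF \<gamma> smeas_dens[OF h]] eq)
        then show "(\<integral>x\<in>{a<..<b}. u x * deriv \<phi> x \<partial>lborel) = - sint (add_smeas \<gamma> (dens a b (\<lambda>x. v x - g x))) \<phi>"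
          using D \<phi> by (simp add: meas_deriv_def)
      qed
      with h eq show ?thesis by blast
    qed
    from False obtain Du v Ds g where w: "(Du, v, Ds, g) \<in> W" by (metis equals0I prod_cases4)
    define h where "h = (\<lambda>x. v x - g x)"
    have h: "L1 a b h" "L1 a b (\<lambda>x. (h x)\<^sup>2)" "ess_bdd a b K u" "meas_deriv a b u Du"
      using wit[OF w] w by (auto simp: h_def W_def BV_decomp_def)
    obtain ue :: "real \<Rightarrow> real \<Rightarrow> real" and ge :: "real \<Rightarrow> smeasure" where rec:
      "\<forall>\<epsilon>>0. L1 a b (ue \<epsilon>) \<and> smeas a b (ge \<epsilon>)"
      "((\<lambda>\<epsilon>. \<integral>x\<in>{a<..<b}. \<bar>ue \<epsilon> x - u x\<bar> \<partial>lborel) \<longlongrightarrow> 0) (at_right 0)"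
      "((\<lambda>\<epsilon>. flat_dist a b (ge \<epsilon>) \<gamma>) \<longlongrightarrow> 0) (at_right 0)"
      "Limsup (at_right 0) (\<lambda>\<epsilon>. Eeps a b K c0 \<epsilon> (ue \<epsilon>) (ge \<epsilon>))
        \<le> (\<integral>\<^sup>+x\<in>{a<..<b}. ennreal ((h x)\<^sup>2) \<partial>lborel) + ennreal c0 * capped \<tau>"
      using recovery_family[OF ab c0 K p _ h(3,1,2)] wit[OF w] unfolding h_def by blast
    have "(\<integral>\<^sup>+x\<in>{a<..<b}. ennreal ((h x)\<^sup>2) \<partial>lborel) + ennreal c0 * capped \<tau> \<le> Elim a b K c0 u \<gamma>"
      unfolding Elim_def W_def[symmetric]
    proof (rule INF_greatest)
      fix w' assume w': "w' \<in> W"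
      obtain Du' v' Ds' g' where W': "w' = (Du', v', Ds', g')" by (metis prod_cases4)
      note wit' = wit[OF w'[unfolded W']]
      have D': "meas_deriv a b u Du'" and BV': "BV_decomp a b u Du' v' Ds'" and g': "L1 a b g'"
        and gam': "\<And>A. A \<in> sets borel \<Longrightarrow> sval \<gamma> A = sval Ds' A + (\<integral>x\<in>A \<inter> {a<..<b}. g' x \<partial>lborel)"
        using w' unfolding W' by (auto simp: W_def BV_decomp_def)
      have sD: "smeas a b Du" "smeas a b Du'" using h(4) D' by (auto simp: meas_deriv_def)
      have DD: "sval Du A = sval Du' A" if "A \<in> sets borel" for A
      proof (rule sval_unique[OF ab sD _ that])
        fix c and n :: nat assume "a \<le> c" "0 < n"
        then have "test_fun a b (cutoff c b n)" by (intro test_fun_cutoff ab) auto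
        then show "sint Du (cutoff c b n) = sint Du' (cutoff c b n)"
          using h(4) D' unfolding meas_deriv_def by (metis neg_equal_iff_equal)
      qed
      have dh: "L1 a b (\<lambda>x. h x - (v' x - g' x))" using h(1) wit' by (intro L1_diff[of a b h "\<lambda>x. v' x - g' x"]) auto
      \<comment> \<open>Both candidates are densities of the same signed measure, the derivative of
        \<open>u\<close> minus \<open>\<gamma>\<close>.\<close>
      have "AE x in lborel. x \<in> {a<..<b} \<longrightarrow> h x - (v' x - g' x) = 0"
      proof (rule AE_zero_if_dens_null[OF dh])
        fix A :: "real set" assume A: "A \<in> sets borel"
        have "set_integrable lborel (A \<inter> {a<..<b}) h" "set_integrable lborel (A \<inter> {a<..<b}) (\<lambda>x. v' x - g' x)"
          using h(1) wit' A by (auto simp: L1_def intro: set_integrable_subset)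
        then have "sval (dens a b (\<lambda>x. h x - (v' x - g' x))) A = sval (dens a b h) A - sval (dens a b (\<lambda>x. v' x - g' x)) A"
          using h(1) wit' A dh by (simp add: sval_dens)
        also have "\<dots> = 0" using wit[OF w] wit' A DD[OF A] by (simp add: h_def)
        finally show "sval (dens a b (\<lambda>x. h x - (v' x - g' x))) A = 0" .
      qed
      then have "(\<integral>\<^sup>+x\<in>{a<..<b}. ennreal ((h x)\<^sup>2) \<partial>lborel) = (\<integral>\<^sup>+x\<in>{a<..<b}. ennreal ((v' x - g' x)\<^sup>2) \<partial>lborel)"
        by (intro nn_integral_cong_AE) (auto elim!: eventually_mono split: split_indicator)
      then show "(\<integral>\<^sup>+x\<in>{a<..<b}. ennreal ((h x)\<^sup>2) \<partial>lborel) + ennreal c0 * capped \<tau> \<le>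
         (case w' of (Du, v, Ds, g) \<Rightarrow>
          (\<integral>\<^sup>+x\<in>{a<..<b}. ennreal ((v x - g x)^2) \<partial>lborel)
          + ennreal c0 * (\<integral>\<^sup>+x\<in>{a<..<b}. ennreal \<bar>g x\<bar> \<partial>lborel)
          + 2 * (\<integral>\<^sup>+x. ennreal (fcap c0 (\<bar>jump u x\<bar> / 2)) \<partial>count_space (jset a b u))
          + ennreal c0 * tvar (\<lambda>A. sval Ds (A - jset a b u)) {a<..<b})"
        using Elim_witness_ge[OF ab _ p BV' g' gam'] c0 unfolding W' by (simp add: add.assoc add_left_mono)
    qed
    with rec show ?thesis by (intro exI[of _ ue] exI[of _ ge]) auto
  qed
qed

section \<open>Bounded functionals on square-integrable functions\<close>

text \<open>The discriminant criterion, evaluated at the minimiser t = - e / N. For N = 0 the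
  right-hand side is linear in t, and it is bounded below only if e = 0.\<close>

lemma quadratic_nonneg_imp:
  fixes e N \<delta> :: real
  assumes "\<And>t. - \<delta> \<le> 2 * t * e + t\<^sup>2 * N" "0 \<le> N" "0 \<le> \<delta>"
  shows "e\<^sup>2 \<le> \<delta> * N"
proof (cases "N = 0")
  case True
  have "e = 0"
  proof (rule ccontr)
    assume "e \<noteq> 0"
    then show False using assms(1)[of "- (\<delta> + 1) / (2 * e)"] True by simp
  qed
  then show ?thesis using True by simp
next
  case False
  then have N: "N > 0" using assms(2) by simp
  have "- \<delta> \<le> 2 * (- e / N) * e + (- e / N)\<^sup>2 * N" by (rule assms(1))
  also have "\<dots> = - e\<^sup>2 / N" using N by (simp add: power2_eq_square field_simps)
  finally show ?thesis using N by (simp add: field_simps)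
qed

text \<open>\<open>h\<close> is the limit of a minimising sequence of \<open>\<phi> \<mapsto> \<integral>\<phi>\<^sup>2 - 2 T \<phi>\<close> on \<open>V\<close>, which is Cauchy by the parallelogram law.\<close>
lemma Riesz_bounded_functional:
  fixes M :: "'a measure" and V :: "('a \<Rightarrow> real) set" and T :: "('a \<Rightarrow> real) \<Rightarrow> real"
  assumes fin: "finite_measure M" and A: "0 \<le> A"
    and Vm: "\<And>\<phi>. \<phi> \<in> V \<Longrightarrow> \<phi> \<in> borel_measurable M" and Vb: "\<And>\<phi>. \<phi> \<in> V \<Longrightarrow> \<exists>C. \<forall>x. \<bar>\<phi> x\<bar> \<le> C"
    and V0: "V \<noteq> {}" and Vc: "\<And>\<phi> \<psi> c. \<phi> \<in> V \<Longrightarrow> \<psi> \<in> V \<Longrightarrow> (\<lambda>x. \<phi> x + c * \<psi> x) \<in> V"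
    and T: "\<And>\<phi> \<psi> c. \<phi> \<in> V \<Longrightarrow> \<psi> \<in> V \<Longrightarrow> T (\<lambda>x. \<phi> x + c * \<psi> x) = T \<phi> + c * T \<psi>"
    and bd: "\<And>\<phi>. \<phi> \<in> V \<Longrightarrow> (T \<phi>)\<^sup>2 \<le> A * (\<integral>x. (\<phi> x)\<^sup>2 \<partial>M)"
  shows "\<exists>h. integrable M h \<and> (\<integral>\<^sup>+x. ennreal ((h x)\<^sup>2) \<partial>M) \<le> ennreal A \<and> (\<forall>\<phi>\<in>V. T \<phi> = (\<integral>x. h x * \<phi> x \<partial>M))"
proof -
  interpret finite_measure M by (rule fin)
  define N where "N = (\<lambda>\<phi> :: 'a \<Rightarrow> real. \<integral>x. (\<phi> x)\<^sup>2 \<partial>M)"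
  define q where "q = (\<lambda>\<phi>. N \<phi> - 2 * T \<phi>)"
  have Vi: "integrable M \<phi>" if \<phi>: "\<phi> \<in> V" for \<phi>
  proof -
    obtain C where "\<And>x. \<bar>\<phi> x\<bar> \<le> C" using Vb[OF \<phi>] by blast
    then show ?thesis using Vm[OF \<phi>] by (intro integrable_const_bound[where B = C]) auto
  qed
  have Vii: "integrable M (\<lambda>x. \<phi> x * \<psi> x)" if \<phi>: "\<phi> \<in> V" and \<psi>: "\<psi> \<in> V" for \<phi> \<psi>
  proof -
    obtain C where "\<And>x. \<bar>\<phi> x\<bar> \<le> C" using Vb[OF \<phi>] by blast
    moreover obtain C' where "\<And>x. \<bar>\<psi> x\<bar> \<le> C'" using Vb[OF \<psi>] by blast
    ultimately have "\<bar>\<phi> x * \<psi> x\<bar> \<le> C * C'" for x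
      unfolding abs_mult by (intro mult_mono) (auto intro: order_trans[OF abs_ge_zero])
    then show ?thesis using Vm[OF \<phi>] Vm[OF \<psi>] by (intro integrable_const_bound[where B = "C * C'"]) auto
  qed
  have N0: "0 \<le> N \<phi>" for \<phi> unfolding N_def by simp
  have Nexp: "N (\<lambda>x. \<phi> x + t * \<psi> x) = N \<phi> + 2 * t * (\<integral>x. \<phi> x * \<psi> x \<partial>M) + t\<^sup>2 * N \<psi>"
    if "\<phi> \<in> V" "\<psi> \<in> V" for \<phi> \<psi> t
  proof -
    have "N (\<lambda>x. \<phi> x + t * \<psi> x) = (\<integral>x. \<phi> x * \<phi> x + 2 * t * (\<phi> x * \<psi> x) + t\<^sup>2 * (\<psi> x * \<psi> x) \<partial>M)"
      unfolding N_def by (intro Bochner_Integration.integral_cong) (auto simp: power2_eq_square algebra_simps)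
    then show ?thesis using Vii that by (simp add: N_def power2_eq_square)
  qed
  \<comment> \<open>The arithmetic-geometric mean inequality turns the bound on \<open>T\<close>
    into 2 T \<phi> \<le> A + N \<phi>.\<close>
  have qlow: "- A \<le> q \<phi>" if "\<phi> \<in> V" for \<phi>
  proof -
    have "(2 * T \<phi>)\<^sup>2 \<le> 4 * (A * N \<phi>)" using bd[OF that] by (simp add: N_def power_mult_distrib)
    also have "\<dots> \<le> (A + N \<phi>)\<^sup>2" using sum_power2_ge_zero[of "A - N \<phi>" 0] by (simp add: power2_eq_square algebra_simps)
    finally have "2 * T \<phi> \<le> A + N \<phi>" using A N0[of \<phi>] by (meson add_nonneg_nonneg power2_le_imp_le)
    then show ?thesis by (simp add: q_def)
  qed
  define m where "m = Inf (q ` V)"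
  have bb: "bdd_below (q ` V)" using qlow by (intro bdd_belowI[of _ "- A"]) auto
  have mlow: "m \<le> q \<phi>" if "\<phi> \<in> V" for \<phi> unfolding m_def using that bb by (intro cInf_lower) auto
  \<comment> \<open>The gaps are geometric so that the increments of the minimising sequence satisfy
    N (d n) \<le> 4 \<delta> n = 4^-n and become summable in L1.\<close>
  define \<delta> where "\<delta> = (\<lambda>n::nat. (1 / 4) ^ n / 4 :: real)"
  have \<delta>: "\<delta> n > 0" "\<delta> (Suc n) \<le> \<delta> n" for n by (auto simp: \<delta>_def)
  have "\<exists>\<phi>\<in>V. q \<phi> < m + \<delta> n" for n
  proof -
    have "Inf (q ` V) < m + \<delta> n" using \<delta>(1)[of n] by (simp add: m_def)
    then show ?thesis using V0 bb by (subst (asm) cInf_less_iff) auto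
  qed
  then obtain \<phi> where \<phi>: "\<And>n. \<phi> n \<in> V" "\<And>n. q (\<phi> n) < m + \<delta> n" by metis
  \<comment> \<open>A minimiser would satisfy the Euler equation exactly; being within \<delta> n of
    the infimum bounds the error in every direction \<psi>.\<close>
  have var: "((\<integral>x. \<phi> n x * \<psi> x \<partial>M) - T \<psi>)\<^sup>2 \<le> \<delta> n * N \<psi>" if \<psi>: "\<psi> \<in> V" for n \<psi>
  proof (rule quadratic_nonneg_imp[OF _ N0])
    fix t
    have "m \<le> q (\<lambda>x. \<phi> n x + t * \<psi> x)" by (intro mlow Vc \<phi> \<psi>)
    also have "\<dots> = q (\<phi> n) + 2 * t * ((\<integral>x. \<phi> n x * \<psi> x \<partial>M) - T \<psi>) + t\<^sup>2 * N \<psi>"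
      unfolding q_def Nexp[OF \<phi>(1) \<psi>] T[OF \<phi>(1) \<psi>] by (simp add: algebra_simps)
    finally show "- \<delta> n \<le> 2 * t * ((\<integral>x. \<phi> n x * \<psi> x \<partial>M) - T \<psi>) + t\<^sup>2 * N \<psi>" using \<phi>(2)[of n] by simp
  qed (use \<delta> less_imp_le in auto)
  define d where "d = (\<lambda>n x. \<phi> (Suc n) x - \<phi> n x)"
  have dV: "d n \<in> V" for n using Vc[OF \<phi>(1)[of "Suc n"] \<phi>(1)[of n], of "-1"] by (simp add: d_def)
  \<comment> \<open>The parallelogram law: the midpoint of two near-minimisers cannot lie below the
    infimum, which forces them to be close.\<close>
  have Nd: "N (d n) \<le> (1 / 4) ^ n" for n
  proof -
    let ?mid = "\<lambda>x. (\<phi> n x + 1 / 2 * d n x)"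
    have eq1: "\<phi> (Suc n) = (\<lambda>x. \<phi> n x + 1 * d n x)" by (auto simp: d_def)
    have s1: "q (\<phi> (Suc n)) = q (\<phi> n) + 2 * ((\<integral>x. \<phi> n x * d n x \<partial>M) - T (d n)) + N (d n)"
      unfolding eq1 q_def Nexp[OF \<phi>(1) dV] T[OF \<phi>(1) dV] by (simp add: algebra_simps)
    have s2: "q ?mid = q (\<phi> n) + ((\<integral>x. \<phi> n x * d n x \<partial>M) - T (d n)) + N (d n) / 4"
      unfolding q_def Nexp[OF \<phi>(1) dV] T[OF \<phi>(1) dV] by (simp add: power2_eq_square algebra_simps)
    have "m \<le> q ?mid" by (intro mlow Vc \<phi> dV)
    then have "N (d n) \<le> 2 * \<delta> n + 2 * \<delta> (Suc n)" using s1 s2 \<phi>(2)[of n] \<phi>(2)[of "Suc n"] by argo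
    also have "\<dots> \<le> 4 * \<delta> n" using \<delta>(2)[of n] by simp
    also have "\<dots> = (1 / 4) ^ n" by (simp add: \<delta>_def)
    finally show ?thesis .
  qed
  let ?\<mu> = "measure M (space M)"
  have d1: "(\<integral>x. \<bar>d n x\<bar> \<partial>M) \<le> (1 + ?\<mu>) / 2 * (1 / 2) ^ n" for n
  proof -
    have p: "(2::real) ^ n > 0" by simp
    \<comment> \<open>Young's inequality with weight 2^n balances 4^-n against the finite total
      mass, so that both terms are of order 2^-n.\<close>
    have "(\<integral>x. \<bar>d n x\<bar> \<partial>M) \<le> (\<integral>x. 2 ^ n / 2 * (d n x)\<^sup>2 + (1 / 2) ^ n / 2 \<partial>M)"
    proof (rule integral_mono)
      show "integrable M (\<lambda>x. \<bar>d n x\<bar>)" using Vi[OF dV] by (rule integrable_abs)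
      show "integrable M (\<lambda>x. 2 ^ n / 2 * (d n x)\<^sup>2 + (1 / 2) ^ n / 2)"
        using Vii[OF dV[of n] dV[of n]] by (auto simp: power2_eq_square)
      fix x
      have "0 \<le> (2 ^ n * \<bar>d n x\<bar> - 1)\<^sup>2" by simp
      then have "2 * (2 ^ n * \<bar>d n x\<bar>) \<le> 2 ^ n * 2 ^ n * (d n x)\<^sup>2 + 1"
        by (simp add: power2_eq_square algebra_simps)
      then have "2 ^ n * \<bar>d n x\<bar> \<le> 2 ^ n * (2 ^ n / 2 * (d n x)\<^sup>2 + (1 / 2) ^ n / 2)"
        by (simp add: algebra_simps power_one_over)
      then show "\<bar>d n x\<bar> \<le> 2 ^ n / 2 * (d n x)\<^sup>2 + (1 / 2) ^ n / 2"
        using p by (simp add: mult_le_cancel_left)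
    qed
    also have "\<dots> = 2 ^ n / 2 * N (d n) + (1 / 2) ^ n / 2 * ?\<mu>"
      using Vii[OF dV[of n] dV[of n]] by (simp add: N_def power2_eq_square mult.commute)
    also have "\<dots> \<le> 2 ^ n / 2 * (1 / 4) ^ n + (1 / 2) ^ n / 2 * ?\<mu>"
      by (intro add_right_mono mult_left_mono Nd) auto
    also have "(2::real) ^ n * (1 / 4) ^ n = (1 / 2) ^ n" by (simp flip: power_mult_distrib)
    then have "2 ^ n / 2 * (1 / 4) ^ n + (1 / 2) ^ n / 2 * ?\<mu> = (1 + ?\<mu>) / 2 * (1 / 2) ^ n"
      by (simp add: field_simps)
    finally show ?thesis .
  qed
  have sum1: "summable (\<lambda>n. \<integral>x. norm (d n x) \<partial>M)"
    by (rule summable_comparison_test'[where g = "\<lambda>n. (1 + ?\<mu>) / 2 * (1 / 2) ^ n"])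
      (use d1 in \<open>auto intro!: summable_mult summable_geometric\<close>)
  have AEs: "AE x in M. summable (\<lambda>n. norm (d n x))"
  proof -
    have [measurable]: "d n \<in> borel_measurable M" for n by (rule Vm[OF dV])
    have "(\<integral>\<^sup>+x. (\<Sum>n. ennreal (norm (d n x))) \<partial>M) = (\<Sum>n. \<integral>\<^sup>+x. ennreal (norm (d n x)) \<partial>M)"
      by (rule nn_integral_suminf) auto
    also have "\<dots> = (\<Sum>n. ennreal (\<integral>x. norm (d n x) \<partial>M))"
      by (intro suminf_cong nn_integral_eq_integral) (use Vi[OF dV] in auto)
    also have "\<dots> \<noteq> \<infinity>" using sum1 by (simp add: ennreal_suminf_neq_top)
    finally have "AE x in M. (\<Sum>n. ennreal (norm (d n x))) \<noteq> \<infinity>"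
      by (intro nn_integral_noteq_infinite) auto
    then show ?thesis by eventually_elim (auto intro: summable_suminf_not_top)
  qed
  \<comment> \<open>The telescoping series converges absolutely almost everywhere and in L1, so this
    is the limit of the minimising sequence.\<close>
  define h where "h = (\<lambda>x. \<phi> 0 x + (\<Sum>n. d n x))"
  have hi: "integrable M h"
    unfolding h_def using integrable_suminf[OF Vi[OF dV] AEs sum1] Vi[OF \<phi>(1)] by auto
  have tele: "(\<Sum>k<n. d k x) = \<phi> n x - \<phi> 0 x" for n x
    unfolding d_def by (rule sum_lessThan_telescope)
  have lim: "AE x in M. (\<lambda>n. \<phi> n x) \<longlonglongrightarrow> h x"
    using AEs
  proof eventually_elim
    case (elim x)
    have "(\<lambda>n. \<Sum>k<n. d k x) \<longlonglongrightarrow> (\<Sum>n. d n x)"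
      by (rule summable_LIMSEQ[OF summable_norm_cancel[OF elim]])
    then have "(\<lambda>n. \<phi> 0 x + (\<Sum>k<n. d k x)) \<longlonglongrightarrow> \<phi> 0 x + (\<Sum>n. d n x)"
      by (intro tendsto_add tendsto_const)
    then show ?case by (simp add: tele h_def)
  qed
  \<comment> \<open>Testing the approximate Euler equation with \<phi> n itself bounds its norm. The
    excess over A vanishes with \<delta> n, so Fatou's lemma gives the bound A for
    \<open>h\<close>.\<close>
  have Nbound: "N (\<phi> n) \<le> (sqrt A + sqrt (\<delta> n))\<^sup>2" for n
  proof (cases "N (\<phi> n) = 0")
    case False
    then have pos: "N (\<phi> n) > 0" using N0[of "\<phi> n"] by simp
    have "(\<integral>x. \<phi> n x * \<phi> n x \<partial>M) = N (\<phi> n)" by (simp add: N_def power2_eq_square)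
    then have "(N (\<phi> n) - T (\<phi> n))\<^sup>2 \<le> \<delta> n * N (\<phi> n)" using var[OF \<phi>(1), of n n] by simp
    then have "N (\<phi> n) - T (\<phi> n) \<le> sqrt (\<delta> n) * sqrt (N (\<phi> n))"
      by (metis real_le_rsqrt real_sqrt_mult)
    moreover have "T (\<phi> n) \<le> sqrt A * sqrt (N (\<phi> n))"
      using bd[OF \<phi>(1), of n] unfolding N_def by (metis real_le_rsqrt real_sqrt_mult)
    ultimately have "sqrt (N (\<phi> n)) * sqrt (N (\<phi> n)) \<le> (sqrt A + sqrt (\<delta> n)) * sqrt (N (\<phi> n))"
      using pos by (simp add: algebra_simps)
    then have "sqrt (N (\<phi> n)) \<le> sqrt A + sqrt (\<delta> n)"
      by (rule mult_right_le_imp_le) (use pos in simp)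
    then have "(sqrt (N (\<phi> n)))\<^sup>2 \<le> (sqrt A + sqrt (\<delta> n))\<^sup>2" using pos by (intro power_mono) auto
    then show ?thesis using pos by simp
  qed simp
  have \<delta>0: "\<delta> \<longlonglongrightarrow> 0"
  proof -
    have "(\<lambda>n. (1 / 4) ^ n / 4) \<longlonglongrightarrow> (0 / 4 :: real)" by (intro tendsto_divide LIMSEQ_power_zero tendsto_const) auto
    then show ?thesis by (simp add: \<delta>_def)
  qed
  have "(\<integral>\<^sup>+x. ennreal ((h x)\<^sup>2) \<partial>M) = (\<integral>\<^sup>+x. liminf (\<lambda>n. ennreal ((\<phi> n x)\<^sup>2)) \<partial>M)"
  proof (rule nn_integral_cong_AE)
    show "AE x in M. ennreal ((h x)\<^sup>2) = liminf (\<lambda>n. ennreal ((\<phi> n x)\<^sup>2))"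
      using lim
    proof eventually_elim
      case (elim x)
      have "(\<lambda>n. ennreal ((\<phi> n x)\<^sup>2)) \<longlonglongrightarrow> ennreal ((h x)\<^sup>2)"
        by (intro tendsto_ennrealI tendsto_power elim)
      from lim_imp_Liminf[OF sequentially_bot this] show ?case by (rule sym)
    qed
  qed
  also have "\<dots> \<le> liminf (\<lambda>n. \<integral>\<^sup>+x. ennreal ((\<phi> n x)\<^sup>2) \<partial>M)"
    using Vm[OF \<phi>(1)] by (intro nn_integral_liminf) auto
  also have "\<dots> \<le> liminf (\<lambda>n. ennreal ((sqrt A + sqrt (\<delta> n))\<^sup>2))"
  proof (rule Liminf_mono, rule always_eventually, rule allI)
    fix n
    have "(\<integral>\<^sup>+x. ennreal ((\<phi> n x)\<^sup>2) \<partial>M) = ennreal (N (\<phi> n))"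
      unfolding N_def using Vii[OF \<phi>(1)[of n] \<phi>(1)[of n]]
      by (intro nn_integral_eq_integral) (auto simp: power2_eq_square)
    also have "\<dots> \<le> ennreal ((sqrt A + sqrt (\<delta> n))\<^sup>2)" by (rule ennreal_leI[OF Nbound])
    finally show "(\<integral>\<^sup>+x. ennreal ((\<phi> n x)\<^sup>2) \<partial>M) \<le> ennreal ((sqrt A + sqrt (\<delta> n))\<^sup>2)" .
  qed
  also have "\<dots> = ennreal A"
  proof -
    have "(\<lambda>n. ennreal ((sqrt A + sqrt (\<delta> n))\<^sup>2)) \<longlonglongrightarrow> ennreal ((sqrt A + sqrt 0)\<^sup>2)"
      by (intro tendsto_ennrealI tendsto_power tendsto_add tendsto_const tendsto_real_sqrt \<delta>0)
    from lim_imp_Liminf[OF sequentially_bot this] show ?thesis using A by (simp only: real_sqrt_zero add_0_right real_sqrt_pow2)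
  qed
  finally have h2: "(\<integral>\<^sup>+x. ennreal ((h x)\<^sup>2) \<partial>M) \<le> ennreal A" .
  \<comment> \<open>As \<psi> is bounded, L1 convergence survives the multiplication by \<psi>, and
    by \<open>var\<close> the error in the Euler equation tends to 0.\<close>
  have "T \<psi> = (\<integral>x. h x * \<psi> x \<partial>M)" if \<psi>: "\<psi> \<in> V" for \<psi>
  proof -
    obtain C where C: "\<And>x. \<bar>\<psi> x\<bar> \<le> C" using Vb[OF \<psi>] by blast
    have C0: "0 \<le> C" using C[of undefined] by linarith
    have i: "integrable M (\<lambda>x. d n x * \<psi> x)" for n by (rule Vii[OF dV \<psi>])
    have bound: "norm (d n x * \<psi> x) \<le> C * norm (d n x)" for n x
      using C[of x] by (simp add: abs_mult mult.commute mult_right_mono)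
    have AEs': "AE x in M. summable (\<lambda>n. norm (d n x * \<psi> x))"
      using AEs
    proof eventually_elim
      case (elim x)
      show ?case
        by (rule summable_comparison_test'[OF summable_mult[OF elim, of C]]) (use bound in simp)
    qed
    have sum1': "summable (\<lambda>n. \<integral>x. norm (d n x * \<psi> x) \<partial>M)"
    proof (rule summable_comparison_test'[OF summable_mult[OF sum1, of C]])
      fix n
      have "(\<integral>x. norm (d n x * \<psi> x) \<partial>M) \<le> (\<integral>x. C * norm (d n x) \<partial>M)"
        using i[of n] Vi[OF dV[of n]] bound by (intro integral_mono) auto
      then show "norm (\<integral>x. norm (d n x * \<psi> x) \<partial>M) \<le> C * (\<integral>x. norm (d n x) \<partial>M)" by simp
    qed
    have "(\<lambda>n. \<Sum>k<n. \<integral>x. d k x * \<psi> x \<partial>M) \<longlonglongrightarrow> (\<integral>x. (\<Sum>n. d n x * \<psi> x) \<partial>M)"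
      using sums_integral[OF i AEs' sum1'] by (simp add: sums_def)
    moreover have "(\<Sum>k<n. \<integral>x. d k x * \<psi> x \<partial>M) = (\<integral>x. \<phi> n x * \<psi> x \<partial>M) - (\<integral>x. \<phi> 0 x * \<psi> x \<partial>M)" for n
    proof -
      have "(\<Sum>k<n. \<integral>x. d k x * \<psi> x \<partial>M) = (\<integral>x. (\<Sum>k<n. d k x * \<psi> x) \<partial>M)" using i by simp
      also have "\<dots> = (\<integral>x. \<phi> n x * \<psi> x - \<phi> 0 x * \<psi> x \<partial>M)"
        by (simp flip: sum_distrib_right add: tele left_diff_distrib)
      finally show ?thesis using Vii[OF \<phi>(1) \<psi>] by simp
    qed
    moreover have "(\<integral>x. (\<Sum>n. d n x * \<psi> x) \<partial>M) = (\<integral>x. (h x - \<phi> 0 x) * \<psi> x \<partial>M)"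
    proof (rule integral_cong_AE)
      show "(\<lambda>x. \<Sum>n. d n x * \<psi> x) \<in> borel_measurable M" using integrable_suminf[OF i AEs' sum1'] by auto
      show "(\<lambda>x. (h x - \<phi> 0 x) * \<psi> x) \<in> borel_measurable M" using hi Vm[OF \<psi>] Vm[OF \<phi>(1)] by auto
      show "AE x in M. (\<Sum>n. d n x * \<psi> x) = (h x - \<phi> 0 x) * \<psi> x"
        using AEs by eventually_elim (simp add: h_def suminf_mult2[symmetric] summable_norm_cancel)
    qed
    moreover have hp: "integrable M (\<lambda>x. h x * \<psi> x)"
      by (rule Bochner_Integration.integrable_bound[OF integrable_mult_right[OF hi, of C]])
        (use hi Vm[OF \<psi>] C C0 in \<open>auto simp: abs_mult mult.commute mult_right_mono\<close>)
    then have "(\<integral>x. (h x - \<phi> 0 x) * \<psi> x \<partial>M) = (\<integral>x. h x * \<psi> x \<partial>M) - (\<integral>x. \<phi> 0 x * \<psi> x \<partial>M)"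
      using Vii[OF \<phi>(1) \<psi>] by (simp add: left_diff_distrib)
    ultimately have "(\<lambda>n. (\<integral>x. \<phi> n x * \<psi> x \<partial>M) - (\<integral>x. \<phi> 0 x * \<psi> x \<partial>M)) \<longlonglongrightarrow> (\<integral>x. h x * \<psi> x \<partial>M) - (\<integral>x. \<phi> 0 x * \<psi> x \<partial>M)"
      by simp
    then have "(\<lambda>n. ((\<integral>x. \<phi> n x * \<psi> x \<partial>M) - (\<integral>x. \<phi> 0 x * \<psi> x \<partial>M)) + (\<integral>x. \<phi> 0 x * \<psi> x \<partial>M))
        \<longlonglongrightarrow> ((\<integral>x. h x * \<psi> x \<partial>M) - (\<integral>x. \<phi> 0 x * \<psi> x \<partial>M)) + (\<integral>x. \<phi> 0 x * \<psi> x \<partial>M)"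
      by (intro tendsto_add tendsto_const)
    then have l1: "(\<lambda>n. \<integral>x. \<phi> n x * \<psi> x \<partial>M) \<longlonglongrightarrow> (\<integral>x. h x * \<psi> x \<partial>M)" by simp
    have "(\<lambda>n. ((\<integral>x. \<phi> n x * \<psi> x \<partial>M) - T \<psi>)\<^sup>2) \<longlonglongrightarrow> 0"
    proof (rule tendsto_sandwich[OF _ _ tendsto_const])
      show "(\<lambda>n. \<delta> n * N \<psi>) \<longlonglongrightarrow> 0" using tendsto_mult[OF \<delta>0 tendsto_const, of "N \<psi>"] by simp
    qed (use var[OF \<psi>] in auto)
    moreover have "(\<lambda>n. ((\<integral>x. \<phi> n x * \<psi> x \<partial>M) - T \<psi>)\<^sup>2) \<longlonglongrightarrow> ((\<integral>x. h x * \<psi> x \<partial>M) - T \<psi>)\<^sup>2"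
      by (intro tendsto_intros l1)
    ultimately have "((\<integral>x. h x * \<psi> x \<partial>M) - T \<psi>)\<^sup>2 = 0" using LIMSEQ_unique by blast
    then show ?thesis by simp
  qed
  with hi h2 show ?thesis by blast
qed

section \<open>Lower bound for the nonlocal energy\<close>

text \<open>Allows an arbitrary pair that represents g dx to be replaced by
  \<open>dens a b g\<close> under the integral.\<close>

lemma sint_cong_sval:
  assumes D: "smeas a b D1" "smeas a b D2" and eq: "\<And>A. A \<in> sets borel \<Longrightarrow> sval D1 A = sval D2 A"
    and \<phi>: "\<phi> \<in> borel_measurable borel" "\<And>x. \<bar>\<phi> x\<bar> \<le> C"
  shows "sint D1 \<phi> = sint D2 \<phi>"
proof -
  have M: "fin_meas_on a b (fst D1)" "fin_meas_on a b (snd D1)" "fin_meas_on a b (fst D2)" "fin_meas_on a b (snd D2)"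
    using D by (auto simp: smeas_def)
  let ?P = "add_meas (fst D1) (snd D2)" and ?Q = "add_meas (fst D2) (snd D1)"
  note P = fin_meas_on_add_meas[OF M(1,4)] and Q = fin_meas_on_add_meas[OF M(3,2)]
  interpret P: finite_measure ?P by (rule fin_meas_onD(3)[OF P])
  interpret Q: finite_measure ?Q by (rule fin_meas_onD(3)[OF Q])
  have "?P = ?Q"
  proof (rule measure_eqI)
    show "sets ?P = sets ?Q" using fin_meas_onD(1)[OF P] fin_meas_onD(1)[OF Q] by simp
    fix A assume "A \<in> sets ?P"
    then have A: "A \<in> sets borel" using fin_meas_onD(1)[OF P] by simp
    have "measure ?P A = measure ?Q A"
      using eq[OF A] by (simp add: measure_add_meas[OF M(1,4) A] measure_add_meas[OF M(3,2) A] sval_def)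
    then show "emeasure ?P A = emeasure ?Q A" by (simp add: P.emeasure_eq_measure Q.emeasure_eq_measure)
  qed
  then have "(\<integral>x. \<phi> x \<partial>?P) = (\<integral>x. \<phi> x \<partial>?Q)" by simp
  then show ?thesis
    unfolding integral_add_meas[OF M(1,4) \<phi>] integral_add_meas[OF M(3,2) \<phi>] sint_def by linarith
qed

lemma abs_sint_bound:
  assumes D: "smeas a b D" and \<phi>: "\<phi> \<in> borel_measurable borel" "\<And>x. \<bar>\<phi> x\<bar> \<le> 1"
  shows "\<bar>sint D \<phi>\<bar> \<le> measure (fst D) UNIV + measure (snd D) UNIV"
proof -
  have "\<bar>\<integral>x. \<phi> x \<partial>M\<bar> \<le> measure M UNIV" if M: "fin_meas_on a b M" for M
  proof -
    interpret finite_measure M by (rule fin_meas_onD(3)[OF M])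
    have "\<bar>\<integral>x. \<phi> x \<partial>M\<bar> \<le> (\<integral>x. \<bar>\<phi> x\<bar> \<partial>M)" by (rule integral_abs_bound)
    also have "\<dots> \<le> (\<integral>x. 1 \<partial>M)" using \<phi>(2) by (intro integral_mono') auto
    finally show ?thesis using fin_meas_onD(2)[OF M] by simp
  qed
  from this[of "fst D"] this[of "snd D"] show ?thesis
    using D unfolding smeas_def sint_def by linarith
qed

lemma flat_dist_ge:
  assumes D: "smeas a b D1" "smeas a b D2" and \<phi>: "flat_test a b \<phi>"
  shows "\<bar>sint D1 \<phi> - sint D2 \<phi>\<bar> \<le> flat_dist a b D1 D2"
proof -
  let ?S = "{sint D1 \<phi> - sint D2 \<phi> |\<phi>. flat_test a b \<phi>}"
  let ?B = "(measure (fst D1) UNIV + measure (snd D1) UNIV) + (measure (fst D2) UNIV + measure (snd D2) UNIV)"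
  have "sint D1 \<psi> - sint D2 \<psi> \<le> ?B" if "flat_test a b \<psi>" for \<psi>
    using abs_sint_bound[OF D(1) flat_test_props(1,2)[OF that]] abs_sint_bound[OF D(2) flat_test_props(1,2)[OF that]]
    by linarith
  then have bdd: "bdd_above ?S" by (intro bdd_aboveI[of _ ?B]) auto
  have le: "sint D1 \<psi> - sint D2 \<psi> \<le> flat_dist a b D1 D2" if "flat_test a b \<psi>" for \<psi>
    unfolding flat_dist_def using that by (intro cSup_upper bdd) auto
  have "flat_test a b (\<lambda>x. - \<phi> x)"
    using \<phi> unfolding flat_test_def by (auto simp: abs_minus_commute)
  from le[OF this] le[OF \<phi>] show ?thesis by (simp add: sint_def)
qed

lemma Lipschitz_sint_dist:
  assumes D: "smeas a b D1" "smeas a b D2" and C: "C > 0"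
    and \<phi>: "\<And>x. \<bar>\<phi> x\<bar> \<le> C" "\<And>x y. \<bar>\<phi> x - \<phi> y\<bar> \<le> C * \<bar>x - y\<bar>" "\<And>x. x \<notin> {a<..<b} \<Longrightarrow> \<phi> x = 0"
  shows "\<bar>sint D1 \<phi> - sint D2 \<phi>\<bar> \<le> C * flat_dist a b D1 D2"
proof -
  have "flat_test a b (\<lambda>x. \<phi> x / C)"
    unfolding flat_test_def
  proof (intro conjI allI impI)
    fix x y
    show "\<bar>\<phi> x / C\<bar> \<le> 1" using \<phi>(1)[of x] C by simp
    show "\<bar>\<phi> x / C - \<phi> y / C\<bar> \<le> \<bar>x - y\<bar>"
      using \<phi>(2)[of x y] C by (simp add: diff_divide_distrib[symmetric] pos_divide_le_eq mult.commute)
  qed (use \<phi>(3) in auto)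
  from flat_dist_ge[OF D this] have "\<bar>(sint D1 \<phi> - sint D2 \<phi>) / C\<bar> \<le> flat_dist a b D1 D2"
    by (simp add: sint_def diff_divide_distrib)
  then show ?thesis using C by (simp add: pos_divide_le_eq mult.commute)
qed

text \<open>For almost every y, all points whose window contains y belong to \<open>S\<close>. So no
  length is lost and \<open>window_Fubini\<close> becomes an equality, as a lower bound
  requires.\<close>

lemma window_Fubini_eq:
  assumes M: "fin_meas_on a b M" and S: "S \<in> sets borel" "emeasure lborel S < \<infinity>"
    and pq: "0 \<le> p + q" and ST: "AE y in M. {y - q..<y + p} \<subseteq> S"
  shows "(\<integral>x. indicator S x * measure M {x - p<..x + q} \<partial>lborel) = (p + q) * measure M UNIV"
proof -
  interpret M: finite_measure M by (rule fin_meas_onD(3)[OF M])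
  note F = Fubini_sint[OF smeas_single(1)[OF M] measurable_window_kernel[of p q], of 1 "indicator S"]
  have k: "\<bar>indicator {x - p<..x + q} y :: real\<bar> \<le> 1" for x y by (auto split: split_indicator)
  have Si: "integrable lborel (indicator S :: real \<Rightarrow> real)" using S by (intro integrable_real_indicator) auto
  have m: "(\<integral>y. indicator {x - p<..x + q} y \<partial>M) = measure M {x - p<..x + q}" for x
    using fin_meas_onD(1,2)[OF M] by simp
  let ?f = "\<lambda>y. \<integral>x. indicator {x - p<..x + q} y * indicator S x \<partial>lborel :: real"
  have "(\<integral>x. indicator S x * measure M {x - p<..x + q} \<partial>lborel) = (\<integral>y. ?f y \<partial>M)"
    using F(1)[OF k Si] by (simp add: smeas_single[OF M] m mult.commute fin_meas_onD(2)[OF M])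
  also have "\<dots> = (\<integral>y. p + q \<partial>M)"
  proof (rule integral_cong_AE)
    have fm: "?f y = measure lborel ({y - q..<y + p} \<inter> S)" for y
    proof -
      have "?f y = (\<integral>x. indicator ({y - q..<y + p} \<inter> S) x \<partial>lborel)"
        by (intro Bochner_Integration.integral_cong) (auto split: split_indicator)
      then show ?thesis using S by simp
    qed
    have "(\<lambda>y. ?f y) \<in> borel_measurable borel"
    proof -
      have [measurable]: "(\<lambda>z. indicator {snd z - p<..snd z + q} (fst z) :: real) \<in> borel_measurable (borel \<Otimes>\<^sub>M lborel)"
      proof -
        have "(\<lambda>z. (fst z, snd z)) \<in> borel \<Otimes>\<^sub>M lborel \<rightarrow>\<^sub>M borel \<Otimes>\<^sub>M (borel :: real measure)" by measurable
        from measurable_compose[OF this measurable_window_kernel[of p q]] show ?thesis by simp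
      qed
      have [measurable]: "S \<in> sets borel" by (rule S(1))
      have "(\<lambda>z. indicator {snd z - p<..snd z + q} (fst z) * indicator S (snd z) :: real) \<in> borel_measurable (borel \<Otimes>\<^sub>M lborel)"
        by measurable
      then show ?thesis by (intro lborel.borel_measurable_lebesgue_integral) (simp add: case_prod_beta)
    qed
    then show "?f \<in> borel_measurable M" using borel_measurable_fin_meas[OF M] by blast
    show "AE y in M. ?f y = p + q"
      using ST
    proof eventually_elim
      case (elim y)
      then have "{y - q..<y + p} \<inter> S = {y - q..<y + p}" by auto
      then have "measure lborel ({y - q..<y + p} \<inter> S) = p + q" using pq by simp
      with fm[of y] show ?case by (rule trans)
    qed
  qed simp
  also have "\<dots> = (p + q) * measure M UNIV" using fin_meas_onD(2)[OF M] by simp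
  finally show ?thesis .
qed

text \<open>Let \<open>\<mu>\<close> be the mass of \<open>\<bar>g\<bar>\<close> on one cell and \<open>m x \<le> \<mu>\<close> its mass in the window around \<open>x\<close>. Then
  \<open>min (m x) 2 \<ge> qcap \<mu> * m x\<close> is linear in \<open>m\<close>, and \<open>\<integral>m = 2 \<epsilon> \<mu>\<close>.\<close>
lemma nonlocal_energy_ge:
  fixes l r :: "'i \<Rightarrow> real" and \<phi> :: "'i \<Rightarrow> real \<Rightarrow> real"
  assumes c0: "c0 \<ge> 0" and \<epsilon>: "\<epsilon> > 0" and g: "L1 a b g" and fin: "finite I"
    and \<phi>: "\<And>k. k \<in> I \<Longrightarrow> \<phi> k \<in> borel_measurable borel" "\<And>k x. k \<in> I \<Longrightarrow> \<bar>\<phi> k x\<bar> \<le> 1"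
      "\<And>k x. k \<in> I \<Longrightarrow> x \<notin> {l k..r k} \<Longrightarrow> \<phi> k x = 0"
    and lr: "\<And>k. k \<in> I \<Longrightarrow> a + 2 * \<epsilon> < l k" "\<And>k. k \<in> I \<Longrightarrow> l k \<le> r k" "\<And>k. k \<in> I \<Longrightarrow> r k < b - 2 * \<epsilon>"
    and sep: "\<And>k k'. k \<in> I \<Longrightarrow> k' \<in> I \<Longrightarrow> k \<noteq> k' \<Longrightarrow> r k + 2 * \<epsilon> < l k' \<or> r k' + 2 * \<epsilon> < l k"
  shows "ennreal (\<Sum>k\<in>I. c0 * min \<bar>\<integral>x\<in>{a<..<b}. g x * \<phi> k x \<partial>lborel\<bar> 2)
    \<le> ennreal (1 / \<epsilon>) * (\<integral>\<^sup>+x\<in>{a<..<b}. ennreal (fcap c0 (\<epsilon> * avg_abs a b \<epsilon> g x)) \<partial>lborel)"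
proof -
  define g0 where "g0 = (\<lambda>x. indicator {a<..<b} x * g x :: real)"
  have gi: "integrable lborel (\<lambda>x. \<bar>g0 x\<bar>)" using g by (auto simp: g0_def L1_iff intro!: integrable_abs)
  have [measurable]: "g0 \<in> borel_measurable borel" using g by (auto simp: g0_def L1_iff)
  define G where "G = density lborel (\<lambda>x. ennreal \<bar>g0 x\<bar>)"
  have G: "fin_meas_on a b G" unfolding G_def
    using gi by (intro fin_meas_on_density) (auto simp: g0_def split: split_indicator)
  interpret G: finite_measure G by (rule fin_meas_onD(3)[OF G])
  have mG: "measure G A = (\<integral>x. indicator A x * \<bar>g0 x\<bar> \<partial>lborel)" if A[measurable]: "A \<in> sets borel" for A
  proof -
    have "emeasure G A = (\<integral>\<^sup>+x. ennreal (indicator A x * \<bar>g0 x\<bar>) \<partial>lborel)"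
      unfolding G_def by (subst emeasure_density) (auto intro!: nn_integral_cong split: split_indicator)
    also have "\<dots> = ennreal (\<integral>x. indicator A x * \<bar>g0 x\<bar> \<partial>lborel)"
      using integrable_real_mult_indicator[OF _ gi, of A] by (intro nn_integral_eq_integral) (auto simp: mult.commute)
    finally show ?thesis by (simp add: measure_def)
  qed
  \<comment> \<open>Only the mass inside the cell is kept, so that no window mass exceeds the cell
    mass \<open>\<mu> k\<close>.\<close>
  define M where "M = (\<lambda>k. density G (\<lambda>x. ennreal (indicator {l k..r k} x)))"
  have sG: "sets G = sets borel" by (rule fin_meas_onD(1)[OF G])
  have M: "fin_meas_on a b (M k)" for k
    unfolding M_def using AE_fin_meas[OF G] sG
    by (intro fin_meas_on_density integrable_indicator_fin_meas[OF G]) auto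
  have mM: "measure (M k) A = measure G (A \<inter> {l k..r k})" if "A \<in> sets borel" for k A
    unfolding M_def using emeasure_density_indicator[OF sG that, of "{l k..r k}"] by (simp add: measure_def)
  define \<mu> where "\<mu> = (\<lambda>k. measure (M k) UNIV)"
  define m where "m = (\<lambda>k x. measure (M k) {x - \<epsilon><..x + \<epsilon>})"
  \<comment> \<open>Contains all points whose window meets the cell. The gaps of more than 2
    \<epsilon> keep these sets disjoint, so at most one cell contributes at each point.\<close>
  define S where "S = (\<lambda>k. {l k - \<epsilon>..r k + \<epsilon>})"
  have Sfin: "emeasure lborel (S k) < \<infinity>" for k
    unfolding S_def using emeasure_lborel_cbox_finite[of "l k - \<epsilon>" "r k + \<epsilon>"] by simp
  have W: "(\<integral>x. indicator (S k) x * m k x \<partial>lborel) = 2 * \<epsilon> * \<mu> k" if k: "k \<in> I" for k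
  proof -
    have "AE y in M k. y \<in> {l k..r k}"
    proof (rule AE_I[where N = "UNIV - {l k..r k}"])
      have "(UNIV - {l k..r k}) \<inter> {l k..r k} = {}" by blast
      then have "emeasure (M k) (UNIV - {l k..r k}) = emeasure G {}"
        unfolding M_def by (subst emeasure_density_indicator[OF sG]) simp_all
      then show "emeasure (M k) (UNIV - {l k..r k}) = 0" by simp
    qed (auto simp: fin_meas_onD(1)[OF M])
    then have "AE y in M k. {y - \<epsilon>..<y + \<epsilon>} \<subseteq> S k"
      by eventually_elim (auto simp: S_def)
    from window_Fubini_eq[OF M _ Sfin _ this] show ?thesis
      using \<epsilon> by (simp add: m_def \<mu>_def S_def)
  qed
  have Wi: "integrable lborel (\<lambda>x. indicator (S k) x * m k x)" for k
    unfolding m_def using window_Fubini(1)[OF M _ Sfin, where T = UNIV and p = \<epsilon> and q = \<epsilon>] \<epsilon> by (simp add: S_def)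
  have m\<mu>: "m k x \<le> \<mu> k" for k x
  proof -
    interpret finite_measure "M k" by (rule fin_meas_onD(3)[OF M])
    show ?thesis unfolding m_def \<mu>_def using fin_meas_onD(1)[OF M] by (intro finite_measure_mono) auto
  qed
  have m0: "0 \<le> m k x" "0 \<le> \<mu> k" for k x by (auto simp: m_def \<mu>_def)
  define t where "t = (\<lambda>k x. c0 / 2 * qcap (\<mu> k) * (indicator (S k) x * m k x))"
  have t0: "0 \<le> t k x" for k x unfolding t_def using c0 m0 qcap_bounds by (auto intro!: mult_nonneg_nonneg)
  have Sab: "x \<in> {a + \<epsilon><..<b - \<epsilon>}" if "k \<in> I" "x \<in> S k" for k x
    using lr[OF that(1)] that(2) \<epsilon> by (auto simp: S_def)
  have pw: "t k x \<le> fcap c0 (\<epsilon> * avg_abs a b \<epsilon> g x)" if k: "k \<in> I" and x: "x \<in> S k" for k x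
  proof -
    have xab: "a + \<epsilon> < x" "x < b - \<epsilon>" using Sab[OF k x] by auto
    have I: "{x - \<epsilon><..<x + \<epsilon>} \<inter> {a<..<b} = {x - \<epsilon><..<x + \<epsilon>}" using xab by auto
    define J where "J = (\<integral>t. indicator {x - \<epsilon><..<x + \<epsilon>} t * \<bar>g0 t\<bar> \<partial>lborel)"
    have "(\<integral>t\<in>{x - \<epsilon><..<x + \<epsilon>} \<inter> {a<..<b}. \<bar>g t\<bar> \<partial>lborel) = J"
      unfolding J_def set_lebesgue_integral_def
      by (intro Bochner_Integration.integral_cong) (auto simp: g0_def split: split_indicator)
    then have avg: "\<epsilon> * avg_abs a b \<epsilon> g x = J / 2"
      unfolding avg_abs_def I using \<epsilon> by simp
    have "m k x \<le> measure G {x - \<epsilon><..x + \<epsilon>}"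
    proof -
      have "m k x = measure G ({x - \<epsilon><..x + \<epsilon>} \<inter> {l k..r k})" unfolding m_def by (rule mM) auto
      also have "\<dots> \<le> measure G {x - \<epsilon><..x + \<epsilon>}" by (rule G.finite_measure_mono) (auto simp: sG)
      finally show ?thesis .
    qed
    also have "\<dots> = (\<integral>t. indicator {x - \<epsilon><..x + \<epsilon>} t * \<bar>g0 t\<bar> \<partial>lborel)" by (rule mG) auto
    also have "\<dots> = J"
      unfolding J_def
    proof (rule integral_cong_AE)
      show "AE t in lborel. indicator {x - \<epsilon><..x + \<epsilon>} t * \<bar>g0 t\<bar> = indicator {x - \<epsilon><..<x + \<epsilon>} t * \<bar>g0 t\<bar>"
        using AE_lborel_singleton[of "x + \<epsilon>"] by eventually_elim (auto split: split_indicator)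
    qed auto
    finally have mJ: "m k x \<le> J" .
    have J0: "0 \<le> J" using mJ m0(1)[of k x] by linarith
    have "t k x = c0 / 2 * (m k x * qcap (\<mu> k))" using x by (simp add: t_def)
    also have "\<dots> \<le> c0 / 2 * (m k x * qcap (m k x))"
      using c0 m0 m\<mu> by (intro mult_left_mono qcap_antimono) auto
    also have "\<dots> = c0 / 2 * min (m k x) 2" using qcap_mult[OF m0(1)] by simp
    also have "\<dots> \<le> c0 / 2 * min J 2" using c0 mJ by (intro mult_left_mono) auto
    also have "\<dots> = fcap c0 (\<epsilon> * avg_abs a b \<epsilon> g x)" unfolding avg using fcap_eq[OF J0, of c0] by simp
    finally show ?thesis .
  qed
  have sum_le: "(\<Sum>k\<in>I. t k x) \<le> indicator {a<..<b} x * fcap c0 (\<epsilon> * avg_abs a b \<epsilon> g x)" for x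
  proof (cases "\<exists>k\<in>I. x \<in> S k")
    case True
    then obtain k where k: "k \<in> I" "x \<in> S k" by blast
    have "t k' x = 0" if "k' \<in> I - {k}" for k'
    proof -
      have "x \<notin> S k'" using sep[of k k'] that k \<epsilon> by (auto simp: S_def)
      then show ?thesis by (simp add: t_def)
    qed
    then have "(\<Sum>k\<in>I. t k x) = t k x" using fin k by (simp add: sum.remove[of I k])
    moreover have "x \<in> {a<..<b}" using Sab[OF k] \<epsilon> by auto
    ultimately show ?thesis using pw[OF k] by simp
  next
    case False
    then have "(\<Sum>k\<in>I. t k x) = 0" by (intro sum.neutral) (auto simp: t_def)
    moreover have "0 \<le> avg_abs a b \<epsilon> g x"
      unfolding avg_abs_def by (auto intro!: divide_nonneg_nonneg simp: set_lebesgue_integral_def)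
    then have "0 \<le> fcap c0 (\<epsilon> * avg_abs a b \<epsilon> g x)"
      using c0 \<epsilon> by (auto simp: fcap_def)
    ultimately show ?thesis by simp
  qed
  have ti: "integrable lborel (t k)" for k
    unfolding t_def by (intro integrable_mult_right Wi)
  \<comment> \<open>c0 / 2 times the window length 2 \<epsilon> is c0 \<epsilon>, and
    \<open>qcap (\<mu> k)\<close> times \<open>\<mu> k\<close> is the truncated cell mass.\<close>
  have tint: "(\<integral>x. t k x \<partial>lborel) = \<epsilon> * (c0 * min (\<mu> k) 2)" if "k \<in> I" for k
    unfolding t_def using W[OF that] qcap_mult[OF m0(2)[of k]] by (simp add: algebra_simps)
  have lower: "min \<bar>\<integral>x\<in>{a<..<b}. g x * \<phi> k x \<partial>lborel\<bar> 2 \<le> min (\<mu> k) 2" if k: "k \<in> I" for k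
  proof -
    have "\<bar>\<integral>x\<in>{a<..<b}. g x * \<phi> k x \<partial>lborel\<bar> = \<bar>\<integral>x. g0 x * \<phi> k x \<partial>lborel\<bar>"
      by (simp add: set_lebesgue_integral_def g0_def mult.assoc)
    also have "\<dots> \<le> (\<integral>x. \<bar>g0 x * \<phi> k x\<bar> \<partial>lborel)" by (rule integral_abs_bound)
    also have "\<dots> \<le> (\<integral>x. indicator {l k..r k} x * \<bar>g0 x\<bar> \<partial>lborel)"
    proof (rule integral_mono')
      show "integrable lborel (\<lambda>x. indicator {l k..r k} x * \<bar>g0 x\<bar>)"
        using integrable_real_mult_indicator[OF _ gi, of "{l k..r k}"] by (simp add: mult.commute)
      fix x
      have "\<bar>g0 x\<bar> * \<bar>\<phi> k x\<bar> \<le> \<bar>g0 x\<bar>" using \<phi>(2)[OF k, of x] by (simp add: mult_left_le)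
      then show "\<bar>g0 x * \<phi> k x\<bar> \<le> indicator {l k..r k} x * \<bar>g0 x\<bar>"
        using \<phi>(3)[OF k, of x] by (auto simp: abs_mult split: split_indicator)
    qed auto
    also have "\<dots> = \<mu> k" by (simp add: \<mu>_def mM mG)
    finally show ?thesis by auto
  qed
  have "ennreal (\<Sum>k\<in>I. c0 * min \<bar>\<integral>x\<in>{a<..<b}. g x * \<phi> k x \<partial>lborel\<bar> 2) \<le> ennreal (\<Sum>k\<in>I. c0 * min (\<mu> k) 2)"
    using c0 lower by (intro ennreal_leI sum_mono mult_left_mono) auto
  also have "(\<Sum>k\<in>I. c0 * min (\<mu> k) 2) = 1 / \<epsilon> * (\<integral>x. (\<Sum>k\<in>I. t k x) \<partial>lborel)"
    using \<epsilon> ti tint by (simp add: sum_distrib_left sum_divide_distrib)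
  also have "ennreal (1 / \<epsilon> * (\<integral>x. (\<Sum>k\<in>I. t k x) \<partial>lborel)) = ennreal (1 / \<epsilon>) * (\<integral>\<^sup>+x. ennreal (\<Sum>k\<in>I. t k x) \<partial>lborel)"
  proof -
    have "(\<integral>\<^sup>+x. ennreal (\<Sum>k\<in>I. t k x) \<partial>lborel) = ennreal (\<integral>x. (\<Sum>k\<in>I. t k x) \<partial>lborel)"
      using ti t0 by (intro nn_integral_eq_integral Bochner_Integration.integrable_sum AE_I2 sum_nonneg) auto
    moreover have "0 \<le> (\<integral>x. (\<Sum>k\<in>I. t k x) \<partial>lborel)" using t0 by (intro Bochner_Integration.integral_nonneg sum_nonneg) auto
    ultimately show ?thesis using \<epsilon> by (simp only: ennreal_mult zero_le_divide_1_iff less_imp_le)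
  qed
  also have "\<dots> \<le> ennreal (1 / \<epsilon>) * (\<integral>\<^sup>+x\<in>{a<..<b}. ennreal (fcap c0 (\<epsilon> * avg_abs a b \<epsilon> g x)) \<partial>lborel)"
  proof (intro mult_left_mono nn_integral_mono)
    fix x
    have "ennreal (\<Sum>k\<in>I. t k x) \<le> ennreal (indicator {a<..<b} x * fcap c0 (\<epsilon> * avg_abs a b \<epsilon> g x))"
      by (rule ennreal_leI[OF sum_le])
    also have "\<dots> = ennreal (fcap c0 (\<epsilon> * avg_abs a b \<epsilon> g x)) * indicator {a<..<b} x"
      by (auto split: split_indicator)
    finally show "ennreal (\<Sum>k\<in>I. t k x) \<le> ennreal (fcap c0 (\<epsilon> * avg_abs a b \<epsilon> g x)) * indicator {a<..<b} x" .
  qed auto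
  finally show ?thesis .
qed

text \<open>A Lipschitz cutoff that is 1 on \<open>X\<close> and 0 from distance \<rho> on. The
  empty set is treated apart because \<open>infdist\<close> to it is 0, which would produce the
  constant 1.\<close>

definition bump :: "real \<Rightarrow> real set \<Rightarrow> real \<Rightarrow> real" where
  "bump \<rho> X x = (if X = {} then 0 else max 0 (1 - infdist x X / \<rho>))"

lemma bump_props:
  assumes "\<rho> > 0"
  shows "0 \<le> bump \<rho> X x" "bump \<rho> X x \<le> 1" "x \<in> X \<Longrightarrow> bump \<rho> X x = 1"
    "\<bar>bump \<rho> X x - bump \<rho> X y\<bar> \<le> \<bar>x - y\<bar> / \<rho>"
proof -
  show "0 \<le> bump \<rho> X x" "bump \<rho> X x \<le> 1" using assms infdist_nonneg[of x X] by (auto simp: bump_def)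
  show "x \<in> X \<Longrightarrow> bump \<rho> X x = 1" by (auto simp: bump_def)
  have "\<bar>infdist x X / \<rho> - infdist y X / \<rho>\<bar> \<le> \<bar>x - y\<bar> / \<rho>"
    using infdist_triangle_abs[of x X y] assms
    by (simp add: diff_divide_distrib[symmetric] divide_right_mono dist_real_def)
  moreover have "\<bar>s - t\<bar> \<le> d \<Longrightarrow> \<bar>max 0 (1 - s) - max 0 (1 - t)\<bar> \<le> d" for s t d :: real by linarith
  ultimately have "\<bar>max 0 (1 - infdist x X / \<rho>) - max 0 (1 - infdist y X / \<rho>)\<bar> \<le> \<bar>x - y\<bar> / \<rho>" by blast
  then show "\<bar>bump \<rho> X x - bump \<rho> X y\<bar> \<le> \<bar>x - y\<bar> / \<rho>" using assms by (auto simp: bump_def)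
qed

lemma bump_nonzero:
  assumes "\<rho> > 0" "closed X" "bump \<rho> X x \<noteq> 0"
  obtains y where "y \<in> X" "dist x y < \<rho>"
proof -
  have X: "X \<noteq> {}" using assms(3) by (auto simp: bump_def)
  then obtain y where y: "y \<in> X" "infdist x X = dist x y" using infdist_attains_inf[OF assms(2)] by metis
  have "infdist x X < \<rho>"
  proof (rule ccontr)
    assume "\<not> infdist x X < \<rho>"
    then have "1 - infdist x X / \<rho> \<le> 0" using assms(1) by simp
    then have "max 0 (1 - infdist x X / \<rho>) = 0" by (rule max_absorb1)
    then show False using assms(3) X unfolding bump_def by metis
  qed
  with y that show thesis by simp
qed

lemma inner_compact:
  assumes \<tau>: "fin_meas_on a b \<tau>" and B: "B \<in> sets borel" and \<theta>: "\<theta> > 0"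
  obtains X where "X \<subseteq> B" "compact X" "measure \<tau> B - \<theta> \<le> measure \<tau> X"
proof -
  interpret finite_measure \<tau> by (rule fin_meas_onD(3)[OF \<tau>])
  show thesis
  proof (cases "measure \<tau> B - \<theta> < 0")
    \<comment> \<open>The empty set is enough here; in the other case the bound is nonnegative and
      survives the passage to extended reals.\<close>
    case True
    then show thesis by (intro that[of "{}"]) auto
  next
    case False
    have "ennreal (measure \<tau> B - \<theta>) < emeasure \<tau> B"
      using \<theta> False by (simp add: emeasure_eq_measure ennreal_less_iff)
    also have "emeasure \<tau> B = (SUP X\<in>{X. X \<subseteq> B \<and> compact X}. emeasure \<tau> X)"
      using fin_meas_onD(1)[OF \<tau>] B by (intro inner_regular) auto
    finally obtain X where X: "X \<subseteq> B" "compact X" "ennreal (measure \<tau> B - \<theta>) < emeasure \<tau> X"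
      by (auto simp: less_SUP_iff)
    then have "measure \<tau> B - \<theta> \<le> measure \<tau> X"
      using False by (simp add: emeasure_eq_measure ennreal_less_iff)
    with X that show thesis by blast
  qed
qed

text \<open>The dual description of the variation on an open interval: compact sets exhaust the
  parts where \<sigma> is 1 and -1, and a difference of bumps takes these values on them. The
  support is compact in (l, r), so that test functions for adjacent intervals are separated by a
  positive distance.\<close>

lemma Lipschitz_approximation:
  assumes p: "polar a b \<gamma> \<tau> \<sigma>" and lr: "l < r" and \<theta>: "\<theta> > 0"
  shows "\<exists>\<phi> C l' r'. C > 0 \<and> l < l' \<and> l' \<le> r' \<and> r' < r \<and> (\<forall>x. \<bar>\<phi> x\<bar> \<le> 1) \<and>
    (\<forall>x y. \<bar>\<phi> x - \<phi> y\<bar> \<le> C * \<bar>x - y\<bar>) \<and> (\<forall>x. x \<notin> {l'..r'} \<longrightarrow> \<phi> x = 0) \<and>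
    measure \<tau> {l<..<r} - \<theta> \<le> sint \<gamma> \<phi>"
proof -
  interpret finite_measure \<tau> by (rule polarD(5)[OF p])
  have s: "sets \<tau> = sets borel" by (rule polarD(6)[OF p])
  have [measurable]: "\<sigma> \<in> borel_measurable borel" by (rule polarD(3)[OF p])
  define P where "P = {x. \<sigma> x = 1} \<inter> {l<..<r}"
  define Q where "Q = {x. \<sigma> x = -1} \<inter> {l<..<r}"
  have [measurable]: "P \<in> sets borel" "Q \<in> sets borel" unfolding P_def Q_def by measurable
  have PQ: "P \<union> Q = {l<..<r}" "P \<inter> Q = {}"
  proof -
    have "\<sigma> x = 1 \<or> \<sigma> x = -1" for x using polarD(4)[OF p, of x] by linarith
    then show "P \<union> Q = {l<..<r}" "P \<inter> Q = {}" unfolding P_def Q_def by auto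
  qed
  \<comment> \<open>A quarter of \<theta> for each compact set suffices although lost mass counts
    twice: it is missing from the integral, and the integrand may be -1 there.\<close>
  obtain X where X: "X \<subseteq> P" "compact X" "measure \<tau> P - \<theta> / 4 \<le> measure \<tau> X"
    using inner_compact[OF polarD(2)[OF p], of P "\<theta> / 4"] \<theta> by auto
  obtain Y where Y: "Y \<subseteq> Q" "compact Y" "measure \<tau> Q - \<theta> / 4 \<le> measure \<tau> Y"
    using inner_compact[OF polarD(2)[OF p], of Q "\<theta> / 4"] \<theta> by auto
  have XY: "X \<inter> Y = {}" "X \<union> Y \<subseteq> {l<..<r}" "compact (X \<union> Y)" using X Y PQ by auto
  have Xm[measurable]: "X \<in> sets borel" "Y \<in> sets borel" using X Y by (auto intro: borel_compact)
  obtain e0 where e0: "e0 > 0" "(\<Union>x\<in>X \<union> Y. cball x e0) \<subseteq> {l<..<r}"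
    using compact_subset_open_imp_cball_epsilon_subset[OF XY(3) open_greaterThanLessThan XY(2)] by blast
  \<comment> \<open>The cap (r - l) / 2 keeps [l + e / 2, r - e / 2] nonempty whatever
    \<open>e0\<close> is.\<close>
  define e where "e = min e0 ((r - l) / 2)"
  have e: "e > 0" "e \<le> (r - l) / 2" "e \<le> e0" 
  proof -
    show "e > 0" using e0(1) lr by (simp add: e_def)
    show "e \<le> (r - l) / 2" unfolding e_def by (rule min.cobounded2)
    show "e \<le> e0" unfolding e_def by (rule min.cobounded1)
  qed
  have near: "l + e < y" "y < r - e" if "y \<in> X \<union> Y" for y
  proof -
    have "cball y e0 \<subseteq> {l<..<r}" using e0(2) that by blast
    moreover have "y - e0 \<in> cball y e0" "y + e0 \<in> cball y e0" using e0(1) by (auto simp: dist_real_def)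
    ultimately have "y - e0 \<in> {l<..<r}" "y + e0 \<in> {l<..<r}" by blast+
    then show "l + e < y" "y < r - e" using e(3) by auto
  qed
  obtain d where d: "d > 0" "\<And>x y. x \<in> X \<Longrightarrow> y \<in> Y \<Longrightarrow> d \<le> dist x y"
    using separate_compact_closed[OF X(2) compact_imp_closed[OF Y(2)] XY(1)] by blast
  \<comment> \<open>At most \<open>d\<close>, so that each bump vanishes on the other compact set;
    at most e / 2, so that the supports stay inside [l + e / 2, r - e / 2].\<close>
  define \<rho> where "\<rho> = min (e / 2) d"
  have \<rho>: "\<rho> > 0" "\<rho> \<le> e / 2" "\<rho> \<le> d" using e d by (auto simp: \<rho>_def)
  define \<phi> where "\<phi> = (\<lambda>x. bump \<rho> X x - bump \<rho> Y x)"
  have b1: "\<bar>\<phi> x\<bar> \<le> 1" for x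
    unfolding \<phi>_def using bump_props(1,2)[OF \<rho>(1), of X x] bump_props(1,2)[OF \<rho>(1), of Y x] by linarith
  have lip: "\<bar>\<phi> x - \<phi> y\<bar> \<le> 2 / \<rho> * \<bar>x - y\<bar>" for x y
  proof -
    have "\<bar>\<phi> x - \<phi> y\<bar> \<le> \<bar>x - y\<bar> / \<rho> + \<bar>x - y\<bar> / \<rho>"
      unfolding \<phi>_def using bump_props(4)[OF \<rho>(1), of X x y] bump_props(4)[OF \<rho>(1), of Y x y] by linarith
    then show ?thesis by simp
  qed
  have supp: "\<phi> x = 0" if x: "x \<notin> {l + e / 2..r - e / 2}" for x
  proof -
    have "bump \<rho> Z x = 0" if Z: "Z \<subseteq> X \<union> Y" "closed Z" for Z
    proof (rule ccontr)
      assume "bump \<rho> Z x \<noteq> 0"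
      then obtain y where y: "y \<in> Z" "dist x y < \<rho>" using bump_nonzero[OF \<rho>(1) Z(2)] by blast
      then have "l + e < y" "y < r - e" using near Z by auto
      then show False using y(2) \<rho>(2) x by (auto simp: dist_real_def)
    qed
    then show ?thesis using X Y by (simp add: \<phi>_def compact_imp_closed)
  qed
  have on: "\<phi> x * \<sigma> x = 1" if "x \<in> X \<union> Y" for x
  proof (cases "x \<in> X")
    case True
    have "bump \<rho> Y x = 0"
    proof (rule ccontr)
      assume "bump \<rho> Y x \<noteq> 0"
      then obtain y where "y \<in> Y" "dist x y < \<rho>" using bump_nonzero[OF \<rho>(1) compact_imp_closed[OF Y(2)]] by blast
      then show False using d(2)[OF True, of y] \<rho>(3) by simp
    qed
    moreover have "\<sigma> x = 1" using X(1) True by (auto simp: P_def)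
    ultimately show ?thesis using bump_props(3)[OF \<rho>(1) True] by (simp add: \<phi>_def)
  next
    case False
    then have y: "x \<in> Y" using that by simp
    have "bump \<rho> X x = 0"
    proof (rule ccontr)
      assume "bump \<rho> X x \<noteq> 0"
      then obtain z where "z \<in> X" "dist x z < \<rho>" using bump_nonzero[OF \<rho>(1) compact_imp_closed[OF X(2)]] by blast
      then show False using d(2)[of z x] y \<rho>(3) by (simp add: dist_commute)
    qed
    moreover have "\<sigma> x = -1" using Y(1) y by (auto simp: Q_def)
    ultimately show ?thesis using bump_props(3)[OF \<rho>(1) y] by (simp add: \<phi>_def)
  qed
  have "(2 / \<rho>)-lipschitz_on UNIV \<phi>" using lip \<rho>(1) by (intro lipschitz_onI) (auto simp: dist_real_def)
  then have \<phi>m: "\<phi> \<in> borel_measurable borel"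
    by (intro borel_measurable_continuous_onI lipschitz_on_continuous_on)
  \<comment> \<open>The product with \<sigma> is 1 on both compact sets, at least -1 elsewhere in
    (l, r), and 0 outside.\<close>
  have low: "2 * indicator (X \<union> Y) x - indicator {l<..<r} x \<le> \<phi> x * \<sigma> x" for x
  proof (cases "x \<in> X \<union> Y")
    case True
    then show ?thesis using on[OF True] XY(2) by auto
  next
    case False
    have "\<bar>\<phi> x * \<sigma> x\<bar> \<le> 1" using b1[of x] polarD(4)[OF p, of x] by (simp add: abs_mult)
    moreover have "\<phi> x = 0" if "x \<notin> {l<..<r}" using that e by (intro supp) auto
    ultimately show ?thesis using False by (cases "x \<in> {l<..<r}") auto
  qed
  have "2 * measure \<tau> (X \<union> Y) - measure \<tau> {l<..<r} = (\<integral>x. 2 * indicator (X \<union> Y) x - indicator {l<..<r} x \<partial>\<tau>)"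
    using integrable_indicator_fin_meas[OF polarD(2)[OF p], of "X \<union> Y"] integrable_indicator_fin_meas[OF polarD(2)[OF p], of "{l<..<r}"]
      polarD(6,7)[OF p] by simp
  also have "\<dots> \<le> (\<integral>x. \<phi> x * \<sigma> x \<partial>\<tau>)"
  proof (rule integral_mono[OF _ _ low])
    show "integrable \<tau> (\<lambda>x. 2 * indicator (X \<union> Y) x - indicator {l<..<r} x :: real)"
      using integrable_indicator_fin_meas[OF polarD(2)[OF p], of "X \<union> Y"] integrable_indicator_fin_meas[OF polarD(2)[OF p], of "{l<..<r}"]
      by simp
    show "integrable \<tau> (\<lambda>x. \<phi> x * \<sigma> x)"
      using \<phi>m b1 polarD(4)[OF p] by (intro integrable_fin_meas[OF polarD(2)[OF p], where C = 1]) (auto simp: abs_mult)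
  qed
  also have "\<dots> = sint \<gamma> \<phi>" by (rule polarD(8)[OF p \<phi>m b1, symmetric])
  finally have 1: "2 * measure \<tau> (X \<union> Y) - measure \<tau> {l<..<r} \<le> sint \<gamma> \<phi>" .
  have "measure \<tau> (X \<union> Y) = measure \<tau> X + measure \<tau> Y"
    using XY(1) s by (intro finite_measure_Union) auto
  moreover have "measure \<tau> {l<..<r} = measure \<tau> P + measure \<tau> Q"
    unfolding PQ(1)[symmetric] using PQ(2) s by (intro finite_measure_Union) auto
  ultimately have "measure \<tau> {l<..<r} - \<theta> \<le> sint \<gamma> \<phi>" using 1 X(3) Y(3) by linarith
  moreover have "2 / \<rho> > 0" "l < l + e / 2" "l + e / 2 \<le> r - e / 2" "r - e / 2 < r" using \<rho> e by auto
  ultimately show ?thesis using b1 lip supp by blast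
qed

text \<open>On a grid of mesh \<delta> that misses the atoms, almost every x lies in an open cell
  contained in (x - \<delta>, x + \<delta>). Since \<open>qcap\<close> decreases, its value at the
  mass of the larger interval is at most its value at the cell mass, and cell by cell the latter
  integrates to the truncated mass. As \<delta> tends to 0 the intervals shrink to the point x, and
  Fatou's lemma concludes.\<close>

lemma capped_le_partitions:
  assumes ab: "a < b" and \<tau>: "fin_meas_on a b \<tau>"
    and E: "\<And>(I :: int set) l r. finite I \<Longrightarrow> (\<And>k. k \<in> I \<Longrightarrow> a \<le> l k \<and> l k < r k \<and> r k \<le> b) \<Longrightarrow>
      (\<And>k k'. k \<in> I \<Longrightarrow> k' \<in> I \<Longrightarrow> k < k' \<Longrightarrow> r k \<le> l k') \<Longrightarrow> (\<Sum>k\<in>I. min (measure \<tau> {l k<..<r k}) 2) \<le> E"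
  shows "capped \<tau> \<le> ennreal E"
proof -
  interpret finite_measure \<tau> by (rule fin_meas_onD(3)[OF \<tau>])
  have s[measurable_cong]: "sets \<tau> = sets borel" and sp: "space \<tau> = UNIV" using fin_meas_onD[OF \<tau>] by auto
  define w where "w = (\<lambda>\<delta> x. measure \<tau> {x - \<delta><..<x + \<delta>})"
  have part: "(\<integral>\<^sup>+x. ennreal (qcap (w \<delta> x)) \<partial>\<tau>) \<le> ennreal E" if \<delta>: "\<delta> > 0" for \<delta>
  proof -
    define At where "At = {x. measure \<tau> {x} \<noteq> 0}"
    have "countable At" unfolding At_def using countable_support by simp
    then have "countable (\<Union>k::int. (\<lambda>x. x - of_int k * \<delta>) ` At)" by auto
    \<comment> \<open>Each grid index forbids only countably many shifts, so some shift keeps every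
      grid point off the atoms.\<close>
    then obtain s0 where s0: "s0 \<notin> (\<Union>k::int. (\<lambda>x. x - of_int k * \<delta>) ` At)"
      using uncountable_UNIV_real by (metis UNIV_eq_I)
    have noat: "measure \<tau> {s0 + of_int k * \<delta>} = 0" for k :: int
    proof (rule ccontr)
      assume "measure \<tau> {s0 + of_int k * \<delta>} \<noteq> 0"
      then have "s0 + of_int k * \<delta> \<in> At" by (simp add: At_def)
      then have "s0 \<in> (\<lambda>x. x - of_int k * \<delta>) ` At" by (intro image_eqI[of _ _ "s0 + of_int k * \<delta>"]) auto
      then show False using s0 by blast
    qed
    define l where "l = (\<lambda>k::int. max a (s0 + of_int k * \<delta>))"
    define r where "r = (\<lambda>k::int. min b (s0 + of_int (k + 1) * \<delta>))"
    \<comment> \<open>The cells that are nonempty after clipping to (a, b); the floors bound the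
      indices that can occur.\<close>
    define I where "I = {k \<in> {\<lfloor>(a - s0) / \<delta>\<rfloor>..\<lfloor>(b - s0) / \<delta>\<rfloor>}. l k < r k}"
    have finI: "finite I" unfolding I_def by (rule finite_subset[OF _ finite_atLeastAtMost_int]) auto
    have mono: "r k \<le> l k'" if "k < k'" for k k'
    proof -
      have "of_int (k + 1) * \<delta> \<le> of_int k' * \<delta>" using that \<delta> by (intro mult_right_mono) auto
      then show ?thesis by (auto simp: l_def r_def)
    qed
    have AEx: "AE x in \<tau>. \<exists>k\<in>I. x \<in> {l k<..<r k}"
    proof -
      have "AE x in \<tau>. \<forall>k::int. x \<noteq> s0 + of_int k * \<delta>"
        unfolding AE_all_countable
      proof
        fix k :: int
        show "AE x in \<tau>. x \<noteq> s0 + of_int k * \<delta>"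
          using noat[of k] s by (intro AE_I[where N = "{s0 + of_int k * \<delta>}"]) (auto simp: emeasure_eq_measure)
      qed
      with AE_fin_meas[OF \<tau>] show ?thesis
      proof eventually_elim
        case (elim x)
        define k where "k = \<lfloor>(x - s0) / \<delta>\<rfloor>"
        have "of_int k \<le> (x - s0) / \<delta>" "(x - s0) / \<delta> < of_int k + 1" by (auto simp: k_def)
        then have "of_int k * \<delta> \<le> x - s0" "x - s0 < of_int (k + 1) * \<delta>" using \<delta> by (auto simp: field_simps)
        then have "x \<in> {l k<..<r k}" using elim(1) elim(2)[rule_format, of k] by (auto simp: l_def r_def)
        moreover have "k \<in> {\<lfloor>(a - s0) / \<delta>\<rfloor>..\<lfloor>(b - s0) / \<delta>\<rfloor>}"
          using elim(1) \<delta> by (auto simp: k_def intro!: floor_mono divide_right_mono)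
        ultimately show ?case unfolding I_def by force
      qed
    qed
    have "(\<integral>\<^sup>+x. ennreal (qcap (w \<delta> x)) \<partial>\<tau>) \<le> (\<integral>\<^sup>+x. (\<Sum>k\<in>I. ennreal (qcap (measure \<tau> {l k<..<r k})) * indicator {l k<..<r k} x) \<partial>\<tau>)"
    proof (rule nn_integral_mono_AE)
      show "AE x in \<tau>. ennreal (qcap (w \<delta> x)) \<le> (\<Sum>k\<in>I. ennreal (qcap (measure \<tau> {l k<..<r k})) * indicator {l k<..<r k} x)"
        using AEx
      proof eventually_elim
        case (elim x)
        then obtain k where k: "k \<in> I" "x \<in> {l k<..<r k}" by blast
        have "{l k<..<r k} \<subseteq> {x - \<delta><..<x + \<delta>}"
          using k(2) by (auto simp: l_def r_def algebra_simps)
        then have "measure \<tau> {l k<..<r k} \<le> w \<delta> x" unfolding w_def using s by (intro finite_measure_mono) auto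
        then have "ennreal (qcap (w \<delta> x)) \<le> ennreal (qcap (measure \<tau> {l k<..<r k})) * indicator {l k<..<r k} x"
          using k by (auto intro!: ennreal_leI qcap_antimono)
        also have "\<dots> \<le> (\<Sum>k\<in>I. ennreal (qcap (measure \<tau> {l k<..<r k})) * indicator {l k<..<r k} x)"
          using k finI by (intro member_le_sum) auto
        finally show ?case .
      qed
    qed
    also have "\<dots> = (\<Sum>k\<in>I. ennreal (qcap (measure \<tau> {l k<..<r k})) * emeasure \<tau> {l k<..<r k})"
      using s by (subst nn_integral_sum) (auto simp: nn_integral_cmult_indicator)
    also have "\<dots> = (\<Sum>k\<in>I. ennreal (min (measure \<tau> {l k<..<r k}) 2))"
    proof (intro sum.cong refl)
      fix k
      show "ennreal (qcap (measure \<tau> {l k<..<r k})) * emeasure \<tau> {l k<..<r k} = ennreal (min (measure \<tau> {l k<..<r k}) 2)"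
        unfolding emeasure_eq_measure using qcap_mult[of "measure \<tau> {l k<..<r k}"]
        by (simp add: ennreal_mult[symmetric] qcap_bounds mult.commute)
    qed
    also have "\<dots> = ennreal (\<Sum>k\<in>I. min (measure \<tau> {l k<..<r k}) 2)" by (intro sum_ennreal) auto
    also have "\<dots> \<le> ennreal E"
      using finI mono by (intro ennreal_leI E) (auto simp: I_def l_def r_def)
    finally show ?thesis .
  qed
  have wm[measurable]: "w \<delta> \<in> borel_measurable borel" for \<delta>
  proof -
    have [measurable]: "(\<lambda>x. measure \<tau> {..x}) \<in> borel_measurable borel" "(\<lambda>x. measure \<tau> {..<x}) \<in> borel_measurable borel"
    proof -
      have "mono (\<lambda>x. measure \<tau> {..x})" "mono (\<lambda>x. measure \<tau> {..<x})"
        by (intro monoI finite_measure_mono; use s in force)+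
      then show "(\<lambda>x. measure \<tau> {..x}) \<in> borel_measurable borel" "(\<lambda>x. measure \<tau> {..<x}) \<in> borel_measurable borel"
        by (simp_all add: borel_measurable_mono)
    qed
    \<comment> \<open>For \<delta> \<le> 0 the interval is empty while the difference may be
      negative, hence the case distinction.\<close>
    have "w \<delta> x = (if \<delta> > 0 then measure \<tau> {..<x + \<delta>} - measure \<tau> {..x - \<delta>} else 0)" for x
    proof (cases "\<delta> > 0")
      case True
      have "measure \<tau> ({..<x + \<delta>} - {..x - \<delta>}) = measure \<tau> {..<x + \<delta>} - measure \<tau> {..x - \<delta>}"
        using True s by (intro finite_measure_Diff) auto
      moreover have "{..<x + \<delta>} - {..x - \<delta>} = {x - \<delta><..<x + \<delta>}" by auto
      ultimately show ?thesis using True by (simp add: w_def)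
    qed (simp add: w_def)
    then have "w \<delta> = (\<lambda>x. if \<delta> > 0 then measure \<tau> {..<x + \<delta>} - measure \<tau> {..x - \<delta>} else 0)" by (rule ext)
    then show ?thesis by simp
  qed
  have wlim: "(\<lambda>n. w (1 / Suc n) x) \<longlonglongrightarrow> measure \<tau> {x}" for x
  proof -
    have "(\<Inter>n. {x - 1 / Suc n<..<x + 1 / Suc n}) = {x}"
    proof (intro equalityI subsetI)
      fix y assume y: "y \<in> (\<Inter>n. {x - 1 / Suc n<..<x + 1 / Suc n})"
      show "y \<in> {x}"
      proof (rule ccontr)
        assume "y \<notin> {x}"
        then obtain n where n: "1 / Suc n < \<bar>y - x\<bar>" using nat_approx_posE[of "\<bar>y - x\<bar>"] by auto
        have "y \<in> {x - 1 / Suc n<..<x + 1 / Suc n}" using y by blast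
        then have "\<bar>y - x\<bar> < 1 / Suc n" by auto
        then show False using n by simp
      qed
    qed auto
    moreover have "(\<lambda>n. measure \<tau> {x - 1 / Suc n<..<x + 1 / Suc n}) \<longlonglongrightarrow> measure \<tau> (\<Inter>n. {x - 1 / Suc n<..<x + 1 / Suc n})"
    proof (rule finite_Lim_measure_decseq)
      show "range (\<lambda>n. {x - 1 / Suc n<..<x + 1 / Suc n}) \<subseteq> sets \<tau>" unfolding s by (rule image_subsetI) simp
      show "decseq (\<lambda>n. {x - 1 / Suc n<..<x + 1 / Suc n})"
      proof (rule decseq_SucI)
        fix n
        have "1 / Suc (Suc n) \<le> 1 / real (Suc n)" by (intro divide_left_mono) auto
        then show "{x - 1 / Suc (Suc n)<..<x + 1 / Suc (Suc n)} \<subseteq> {x - 1 / Suc n<..<x + 1 / Suc n}" by auto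
      qed
    qed
    ultimately show ?thesis by (simp add: w_def)
  qed
  \<comment> \<open>In this form the continuity of \<open>qcap\<close> is evident.\<close>
  have qeq: "qcap t = 2 / max t 2" for t by (auto simp: qcap_def max_def)
  have qlim: "(\<lambda>n. qcap (w (1 / Suc n) x)) \<longlonglongrightarrow> qcap (measure \<tau> {x})" for x
    unfolding qeq by (intro tendsto_divide tendsto_max tendsto_const wlim) (auto simp: max_def)
  have "capped \<tau> = (\<integral>\<^sup>+x. liminf (\<lambda>n. ennreal (qcap (w (1 / Suc n) x))) \<partial>\<tau>)"
    unfolding capped_def
  proof (intro nn_integral_cong)
    fix x
    from lim_imp_Liminf[OF sequentially_bot tendsto_ennrealI[OF qlim[of x]]]
    show "ennreal (qcap (measure \<tau> {x})) = liminf (\<lambda>n. ennreal (qcap (w (1 / Suc n) x)))" by (rule sym)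
  qed
  also have "\<dots> \<le> liminf (\<lambda>n. \<integral>\<^sup>+x. ennreal (qcap (w (1 / Suc n) x)) \<partial>\<tau>)"
    by (intro nn_integral_liminf) measurable
  also have "\<dots> \<le> liminf (\<lambda>n::nat. ennreal E)"
    by (intro Liminf_mono always_eventually allI part) simp
  also have "\<dots> = ennreal E" by (simp add: Liminf_const)
  finally show ?thesis .
qed

section \<open>The liminf inequality\<close>

lemma test_fun_lincomb:
  assumes "test_fun a b \<phi>" "test_fun a b \<psi>"
  shows "test_fun a b (\<lambda>x. \<phi> x + c * \<psi> x)" "deriv (\<lambda>x. \<phi> x + c * \<psi> x) = (\<lambda>x. deriv \<phi> x + c * deriv \<psi> x)"
proof -
  have d: "((deriv ^^ n) \<phi>) field_differentiable (at x)" "((deriv ^^ n) \<psi>) field_differentiable (at x)" for n x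
    using assms by (auto simp: test_fun_def)
  have step: "((\<lambda>x. (deriv ^^ n) \<phi> x + c * (deriv ^^ n) \<psi> x) has_field_derivative
      (deriv ^^ Suc n) \<phi> x + c * (deriv ^^ Suc n) \<psi> x) (at x)" for n x
    using field_differentiable_derivI[OF d(1)[of n x]] field_differentiable_derivI[OF d(2)[of n x]]
    by (auto intro!: derivative_eq_intros)
  have n: "(deriv ^^ n) (\<lambda>x. \<phi> x + c * \<psi> x) = (\<lambda>x. (deriv ^^ n) \<phi> x + c * (deriv ^^ n) \<psi> x)" for n
  proof (induction n)
    case (Suc n)
    then have "(deriv ^^ Suc n) (\<lambda>x. \<phi> x + c * \<psi> x) = deriv (\<lambda>x. (deriv ^^ n) \<phi> x + c * (deriv ^^ n) \<psi> x)" by simp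
    also have "\<dots> = (\<lambda>x. (deriv ^^ Suc n) \<phi> x + c * (deriv ^^ Suc n) \<psi> x)"
      by (rule ext, rule DERIV_imp_deriv, rule step)
    finally show ?case .
  qed simp
  show "deriv (\<lambda>x. \<phi> x + c * \<psi> x) = (\<lambda>x. deriv \<phi> x + c * deriv \<psi> x)" using n[of 1] by simp
  obtain c1 d1 c2 d2 where s: "a < c1" "c1 \<le> d1" "d1 < b" "\<And>x. x \<notin> {c1..d1} \<Longrightarrow> \<phi> x = 0"
    "a < c2" "c2 \<le> d2" "d2 < b" "\<And>x. x \<notin> {c2..d2} \<Longrightarrow> \<psi> x = 0"
    using assms unfolding test_fun_def by blast
  have "\<phi> x + c * \<psi> x = 0" if "x \<notin> {min c1 c2..max d1 d2}" for x
  proof -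
    have "x \<notin> {c1..d1}" "x \<notin> {c2..d2}" using that by auto
    then show ?thesis using s(4,8) by simp
  qed
  moreover have "a < min c1 c2" "min c1 c2 \<le> max d1 d2" "max d1 d2 < b" using s by auto
  moreover have "(deriv ^^ n) (\<lambda>x. \<phi> x + c * \<psi> x) field_differentiable (at x)" for n x
    unfolding n using step field_differentiable_def by blast
  ultimately show "test_fun a b (\<lambda>x. \<phi> x + c * \<psi> x)" unfolding test_fun_def by blast
qed

lemma test_fun_Lipschitz:
  assumes "test_fun a b \<phi>"
  obtains C where "C > 0" "\<And>x. \<bar>\<phi> x\<bar> \<le> C" "\<And>x. \<bar>deriv \<phi> x\<bar> \<le> C" "\<And>x y. \<bar>\<phi> x - \<phi> y\<bar> \<le> C * \<bar>x - y\<bar>"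
    "\<And>x. x \<notin> {a<..<b} \<Longrightarrow> \<phi> x = 0" "\<phi> \<in> borel_measurable borel" "deriv \<phi> \<in> borel_measurable borel"
proof -
  obtain c d C where p: "a < c" "c \<le> d" "d < b" "\<And>x. x \<notin> {c..d} \<Longrightarrow> \<phi> x = 0"
    "0 < C" "\<And>x. \<bar>\<phi> x\<bar> \<le> C" "\<And>x. \<bar>deriv \<phi> x\<bar> \<le> C"
    "continuous_on UNIV \<phi>" "continuous_on UNIV (deriv \<phi>)"
    "\<And>x. (\<phi> has_field_derivative deriv \<phi> x) (at x)"
    using test_fun_props[OF assms] by metis
  have "\<bar>\<phi> x - \<phi> y\<bar> \<le> C * \<bar>x - y\<bar>" for x y
    using field_differentiable_bound[of UNIV \<phi> "deriv \<phi>" C x y] p by auto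
  moreover have "\<phi> x = 0" if "x \<notin> {a<..<b}" for x using p(1-3) that by (intro p(4)) auto
  ultimately show thesis using that p(5-9) borel_measurable_continuous_onI by blast
qed

lemma test_fun_bounded: assumes "test_fun a b \<phi>" shows "\<exists>C. \<forall>x. \<bar>\<phi> x\<bar> \<le> C"
  by (rule test_fun_Lipschitz[OF assms]) blast

lemma test_fun_measurable: assumes "test_fun a b \<phi>" shows "\<phi> \<in> borel_measurable borel"
  by (rule test_fun_Lipschitz[OF assms]) blast

lemma set_integral_CS:
  assumes h: "L1 a b h" "L1 a b (\<lambda>x. (h x)\<^sup>2)" and \<phi>: "\<phi> \<in> borel_measurable borel" "\<And>x. \<bar>\<phi> x\<bar> \<le> C"
  shows "(\<integral>x\<in>{a<..<b}. h x * \<phi> x \<partial>lborel)\<^sup>2 \<le> (\<integral>x\<in>{a<..<b}. (h x)\<^sup>2 \<partial>lborel) * (\<integral>x\<in>{a<..<b}. (\<phi> x)\<^sup>2 \<partial>lborel)"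
proof (rule quadratic_nonneg_imp)
  have i: "set_integrable lborel {a<..<b} (\<lambda>x. (h x)\<^sup>2)" "set_integrable lborel {a<..<b} (\<lambda>x. h x * \<phi> x)"
    using h L1_mult_bounded[OF h(1) \<phi>] by (auto simp: L1_def)
  have "\<bar>(\<phi> x)\<^sup>2\<bar> \<le> C\<^sup>2" for x using power_mono[OF \<phi>(2)[of x], of 2] by simp
  then have i2: "set_integrable lborel {a<..<b} (\<lambda>x. (\<phi> x)\<^sup>2)"
    using \<phi>(1) unfolding L1_def[symmetric] by (intro L1_bounded[where C = "C\<^sup>2"]) auto
  fix t :: real
  have "0 \<le> (\<integral>x\<in>{a<..<b}. (h x + t * \<phi> x)\<^sup>2 \<partial>lborel)" by (simp add: set_lebesgue_integral_def)
  also have "\<dots> = (\<integral>x\<in>{a<..<b}. ((h x)\<^sup>2 + 2 * t * (h x * \<phi> x)) + t\<^sup>2 * (\<phi> x)\<^sup>2 \<partial>lborel)"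
    by (intro set_lebesgue_integral_cong) (auto simp: power2_eq_square algebra_simps)
  also have "\<dots> = ((\<integral>x\<in>{a<..<b}. (h x)\<^sup>2 \<partial>lborel) + 2 * t * (\<integral>x\<in>{a<..<b}. h x * \<phi> x \<partial>lborel)) + t\<^sup>2 * (\<integral>x\<in>{a<..<b}. (\<phi> x)\<^sup>2 \<partial>lborel)"
  proof -
    have j: "set_integrable lborel {a<..<b} (\<lambda>x. 2 * t * (h x * \<phi> x))" "set_integrable lborel {a<..<b} (\<lambda>x. t\<^sup>2 * (\<phi> x)\<^sup>2)"
      using i(2) i2 by (auto intro!: set_integrable_mult_right)
    show ?thesis
      unfolding set_integral_add(2)[OF set_integral_add(1)[OF i(1) j(1)] j(2)] set_integral_add(2)[OF i(1) j(1)] by simp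
  qed
  finally show "- (\<integral>x\<in>{a<..<b}. (h x)\<^sup>2 \<partial>lborel) \<le> 2 * t * (\<integral>x\<in>{a<..<b}. h x * \<phi> x \<partial>lborel) + t\<^sup>2 * (\<integral>x\<in>{a<..<b}. (\<phi> x)\<^sup>2 \<partial>lborel)"
    by simp
qed (auto simp: set_lebesgue_integral_def)

text \<open>The excess of |u| over \<open>K\<close> is almost everywhere at most the distance from
  \<open>u\<close> to \<open>un n\<close>, so its integral is below every L1 distance and therefore
  0.\<close>

lemma ess_bdd_L1_limit:
  assumes u: "L1 a b u" "\<And>n. L1 a b (un n)" "\<And>n. ess_bdd a b K (un n)"
    and lim: "(\<lambda>n. \<integral>x\<in>{a<..<b}. \<bar>un n x - u x\<bar> \<partial>lborel) \<longlonglongrightarrow> 0"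
  shows "ess_bdd a b K u"
proof -
  define w where "w = (\<lambda>x. max 0 (\<bar>indicator {a<..<b} x * u x\<bar> - K) * indicator {a<..<b} x)"
  have iu: "integrable lborel (\<lambda>x. indicator {a<..<b} x * u x)" using u(1) by (simp add: L1_iff)
  have K: "integrable lborel (\<lambda>x. \<bar>K\<bar> * indicator {a<..<b} x :: real)"
    using emeasure_lborel_box_finite[of a b] by (intro integrable_mult_right integrable_real_indicator) auto
  have um: "(\<lambda>x. indicator {a<..<b} x * u x) \<in> borel_measurable borel" using iu by auto
  have wi: "integrable lborel w"
  proof (rule Bochner_Integration.integrable_bound)
    show "integrable lborel (\<lambda>x. \<bar>indicator {a<..<b} x * u x\<bar> + \<bar>K\<bar> * indicator {a<..<b} x)"
      by (intro Bochner_Integration.integrable_add integrable_abs iu K)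
    show "w \<in> borel_measurable lborel" unfolding w_def using um by simp
    show "AE x in lborel. norm (w x) \<le> norm (\<bar>indicator {a<..<b} x * u x\<bar> + \<bar>K\<bar> * indicator {a<..<b} x)"
      by (intro AE_I2) (auto simp: w_def split: split_indicator)
  qed
  have w0: "0 \<le> w x" for x by (auto simp: w_def)
  have le: "(\<integral>x. w x \<partial>lborel) \<le> (\<integral>x\<in>{a<..<b}. \<bar>un n x - u x\<bar> \<partial>lborel)" for n
    unfolding set_lebesgue_integral_def
  proof (rule integral_mono_AE[OF wi])
    show "integrable lborel (\<lambda>x. indicator {a<..<b} x *\<^sub>R \<bar>un n x - u x\<bar>)"
      using set_integrable_abs[OF L1_diff[OF u(2) u(1), unfolded L1_def]] by (simp add: set_integrable_def)
    show "AE x in lborel. w x \<le> indicator {a<..<b} x *\<^sub>R \<bar>un n x - u x\<bar>"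
      using u(3)[of n] unfolding ess_bdd_def
    proof eventually_elim
      case (elim x)
      then show ?case by (auto simp: w_def split: split_indicator)
    qed
  qed
  have "(\<integral>x. w x \<partial>lborel) \<le> 0" by (rule LIMSEQ_le_const[OF lim]) (use le in auto)
  moreover have "0 \<le> (\<integral>x. w x \<partial>lborel)" using w0 by (intro Bochner_Integration.integral_nonneg) auto
  ultimately have "(\<integral>x. w x \<partial>lborel) = 0" by simp
  then have "AE x in lborel. w x = 0" using wi w0 by (subst (asm) integral_nonneg_eq_0_iff_AE) auto
  then show ?thesis unfolding ess_bdd_def
    by eventually_elim (auto simp: w_def max_def split: if_splits)
qed

text \<open>The representation is applied to Lebesgue measure on (a, b) and the space of test
  functions. The resulting function is the u' - g of the limit.\<close>

lemma square_integrable_limit: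
  assumes ab: "a < b" and A: "0 \<le> A"
    and T: "\<And>\<phi> \<psi> c. test_fun a b \<phi> \<Longrightarrow> test_fun a b \<psi> \<Longrightarrow> T (\<lambda>x. \<phi> x + c * \<psi> x) = T \<phi> + c * T \<psi>"
    and bd: "\<And>\<phi>. test_fun a b \<phi> \<Longrightarrow> (T \<phi>)\<^sup>2 \<le> A * (\<integral>x\<in>{a<..<b}. (\<phi> x)\<^sup>2 \<partial>lborel)"
  shows "\<exists>h. L1 a b h \<and> L1 a b (\<lambda>x. (h x)\<^sup>2) \<and> (\<integral>\<^sup>+x\<in>{a<..<b}. ennreal ((h x)\<^sup>2) \<partial>lborel) \<le> ennreal A \<and>
    (\<forall>\<phi>. test_fun a b \<phi> \<longrightarrow> T \<phi> = (\<integral>x\<in>{a<..<b}. h x * \<phi> x \<partial>lborel))"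
proof -
  define M where "M = density lborel (\<lambda>x. ennreal (indicator {a<..<b} x))"
  have fin: "fin_meas_on a b M"
    unfolding M_def using emeasure_lborel_box_finite[of a b]
    by (intro fin_meas_on_density integrable_real_indicator) auto
  have int: "(\<integral>x. f x \<partial>M) = (\<integral>x\<in>{a<..<b}. f x \<partial>lborel)" if "f \<in> borel_measurable borel" for f :: "real \<Rightarrow> real"
    unfolding M_def set_lebesgue_integral_def using that by (subst integral_density) auto
  have "\<exists>h. integrable M h \<and> (\<integral>\<^sup>+x. ennreal ((h x)\<^sup>2) \<partial>M) \<le> ennreal A \<and> (\<forall>\<phi>\<in>Collect (test_fun a b). T \<phi> = (\<integral>x. h x * \<phi> x \<partial>M))"
  proof (rule Riesz_bounded_functional[OF fin_meas_onD(3)[OF fin] A])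
    fix \<phi> \<psi> c assume \<phi>: "\<phi> \<in> Collect (test_fun a b)"
    have m: "\<phi> \<in> borel_measurable borel" using \<phi> test_fun_measurable by blast
    then show "\<phi> \<in> borel_measurable M" using borel_measurable_fin_meas[OF fin] by blast
    show "\<exists>C. \<forall>x. \<bar>\<phi> x\<bar> \<le> C" using \<phi> test_fun_bounded by blast
    have "(\<lambda>x. (\<phi> x)\<^sup>2) \<in> borel_measurable borel" using m by simp
    from int[OF this] show "(T \<phi>)\<^sup>2 \<le> A * (\<integral>x. (\<phi> x)\<^sup>2 \<partial>M)" using bd \<phi> by simp
  next
    show "Collect (test_fun a b) \<noteq> {}" using test_fun_cutoff[OF ab order_refl order_refl, of 1] by auto
  qed (use T test_fun_lincomb in auto)
  then obtain h where h: "integrable M h" "(\<integral>\<^sup>+x. ennreal ((h x)\<^sup>2) \<partial>M) \<le> ennreal A"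
    "\<And>\<phi>. test_fun a b \<phi> \<Longrightarrow> T \<phi> = (\<integral>x. h x * \<phi> x \<partial>M)" by blast
  have hm[measurable]: "h \<in> borel_measurable borel"
    using borel_measurable_integrable[OF h(1)] borel_measurable_fin_meas[OF fin] by blast
  have "integrable lborel (\<lambda>x. indicator {a<..<b} x *\<^sub>R h x)"
    using h(1) unfolding M_def by (subst (asm) integrable_density) auto
  then have hL: "L1 a b h" by (simp add: L1_iff)
  have nn: "(\<integral>\<^sup>+x. ennreal ((h x)\<^sup>2) \<partial>M) = (\<integral>\<^sup>+x\<in>{a<..<b}. ennreal ((h x)\<^sup>2) \<partial>lborel)"
    unfolding M_def by (subst nn_integral_density) (auto intro!: nn_integral_cong split: split_indicator)
  have "L1 a b (\<lambda>x. (h x)\<^sup>2)" unfolding L1_iff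
  proof (rule integrableI_nonneg)
    have "(\<integral>\<^sup>+x. ennreal (indicator {a<..<b} x * (h x)\<^sup>2) \<partial>lborel) = (\<integral>\<^sup>+x\<in>{a<..<b}. ennreal ((h x)\<^sup>2) \<partial>lborel)"
      by (intro nn_integral_cong) (auto split: split_indicator)
    also have "\<dots> \<le> ennreal A" using h(2) unfolding nn .
    also have "\<dots> < \<infinity>" by simp
    finally show "(\<integral>\<^sup>+x. ennreal (indicator {a<..<b} x * (h x)\<^sup>2) \<partial>lborel) < \<infinity>" .
  qed auto
  moreover have "T \<phi> = (\<integral>x\<in>{a<..<b}. h x * \<phi> x \<partial>lborel)" if \<phi>: "test_fun a b \<phi>" for \<phi>
  proof -
    have "\<phi> \<in> borel_measurable borel" by (rule test_fun_measurable[OF \<phi>])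
    then have "(\<lambda>x. h x * \<phi> x) \<in> borel_measurable borel" by simp
    from int[OF this] show ?thesis using h(3)[OF \<phi>] by simp
  qed
  ultimately show ?thesis using hL h(2) unfolding nn by blast
qed

text \<open>The bound \<open>B\<close> is strict so that witnesses of the infima can be chosen with
  energy below it. In the limit \<open>A\<close> bounds the square integral of \<open>h\<close> and
  B - A bounds c0 times \<open>capped \<tau>\<close>; adding the two restores
  \<open>B\<close>.\<close>

lemma liminf_sequence:
  assumes ab: "a < b" and c0: "c0 > 0" and u: "L1 a b u" and \<gamma>: "smeas a b \<gamma>"
    and e: "\<And>n. e n > 0" "e \<longlonglongrightarrow> 0"
    and un: "\<And>n. L1 a b (un n)" "(\<lambda>n. \<integral>x\<in>{a<..<b}. \<bar>un n x - u x\<bar> \<partial>lborel) \<longlonglongrightarrow> 0"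
    and gn: "\<And>n. smeas a b (gn n)" "(\<lambda>n. flat_dist a b (gn n) \<gamma>) \<longlonglongrightarrow> 0"
    and B: "\<And>n. Eeps a b K c0 (e n) (un n) (gn n) < ennreal B"
  shows "Elim a b K c0 u \<gamma> \<le> ennreal B"
proof -
  obtain \<tau> \<sigma> where p: "polar a b \<gamma> \<tau> \<sigma>" using ex_polar[OF \<gamma>] by blast
  let ?F = "\<lambda>n g. ennreal (1 / e n) * (\<integral>\<^sup>+x\<in>{a<..<b}. ennreal (fcap c0 (e n * avg_abs a b (e n) g x)) \<partial>lborel)"
  define P where "P = (\<lambda>n v g. weak_deriv a b (un n) v \<and> ess_bdd a b K (un n) \<and> L1 a b g \<and>
      (\<forall>A\<in>sets borel. sval (gn n) A = (\<integral>x\<in>A \<inter> {a<..<b}. g x \<partial>lborel)) \<and> L1 a b (\<lambda>x. (v x - g x)\<^sup>2) \<and>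
      (\<integral>\<^sup>+x\<in>{a<..<b}. ennreal ((v x - g x)\<^sup>2) \<partial>lborel) + ?F n g < ennreal B)"
  have "\<exists>v g. P n v g" for n
    using B[of n] unfolding Eeps_def INF_less_iff P_def by auto
  then obtain v where "\<And>n. \<exists>g. P n (v n) g" using choice[of "\<lambda>n v. \<exists>g. P n v g"] by blast
  then obtain g where P: "\<And>n. P n (v n) (g n)" using choice[of "\<lambda>n g. P n (v n) g"] by blast
  have w: "\<And>n. weak_deriv a b (un n) (v n)" "\<And>n. ess_bdd a b K (un n)" "\<And>n. L1 a b (g n)"
    "\<And>n A. A \<in> sets borel \<Longrightarrow> sval (gn n) A = (\<integral>x\<in>A \<inter> {a<..<b}. g n x \<partial>lborel)"
    "\<And>n. L1 a b (\<lambda>x. (v n x - g n x)\<^sup>2)"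
    "\<And>n. (\<integral>\<^sup>+x\<in>{a<..<b}. ennreal ((v n x - g n x)\<^sup>2) \<partial>lborel) + ?F n (g n) < ennreal B"
    using P unfolding P_def by blast+
  define h where "h = (\<lambda>n x. v n x - g n x)"
  define A' where "A' = (\<lambda>n. \<integral>x\<in>{a<..<b}. (h n x)\<^sup>2 \<partial>lborel)"
  have vL: "L1 a b (v n)" for n using w(1)[of n] by (simp add: weak_deriv_def)
  have hL: "L1 a b (h n)" "L1 a b (\<lambda>x. (h n x)\<^sup>2)" for n
    unfolding h_def by (rule L1_diff[OF vL w(3)], rule w(5))
  have A'0: "0 \<le> A' n" for n by (simp add: A'_def set_lebesgue_integral_def)
  have nnA: "(\<integral>\<^sup>+x\<in>{a<..<b}. ennreal ((v n x - g n x)\<^sup>2) \<partial>lborel) = ennreal (A' n)" for n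
    using set_integral_abs_eq_nn_integral[OF hL(2)[of n]] by (simp add: A'_def h_def)
  \<comment> \<open>The first term is finite, so it may be subtracted from \<open>B\<close>; the
    remainder is what the nonlocal term can use.\<close>
  have wB: "A' n < B \<and> ?F n (g n) \<le> ennreal (B - A' n)" for n
  proof -
    have lt: "ennreal (A' n) + ?F n (g n) < ennreal B" using w(6)[of n] unfolding nnA .
    then have "ennreal (A' n) < ennreal B" by (meson le_less_trans le_iff_add)
    then have AB: "A' n < B" using A'0[of n] by (simp add: ennreal_less_iff)
    have "ennreal (A' n) + ?F n (g n) \<le> ennreal (A' n) + ennreal (B - A' n)"
      using lt AB A'0[of n] by (subst ennreal_plus[symmetric]) (auto intro: less_imp_le)
    then show ?thesis using AB by (simp add: ennreal_add_left_cancel_le)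
  qed
  \<comment> \<open>The subsequence is taken for the numbers \<open>A'\<close> alone; the pairings
    with test functions converge along the full sequence.\<close>
  have "seq_compact {0..B}" by (simp add: compact_imp_seq_compact)
  then obtain A r where A: "A \<in> {0..B}" "strict_mono r" "(A' \<circ> r) \<longlonglongrightarrow> A"
    using A'0 wB less_imp_le unfolding seq_compact_def by (metis atLeastAtMost_iff)
  have lim_r: "(\<lambda>n. f (r n)) \<longlonglongrightarrow> L" if "f \<longlonglongrightarrow> L" for f :: "nat \<Rightarrow> real" and L
    using LIMSEQ_subseq_LIMSEQ[OF that A(2)] by (simp add: o_def)
  have gint: "sint (gn n) \<phi> = (\<integral>x\<in>{a<..<b}. g n x * \<phi> x \<partial>lborel)"
    if "\<phi> \<in> borel_measurable borel" "\<And>x. \<bar>\<phi> x\<bar> \<le> C" for n \<phi> C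
  proof -
    have "sint (gn n) \<phi> = sint (dens a b (g n)) \<phi>"
      by (rule sint_cong_sval[OF gn(1) smeas_dens[OF w(3)] _ that]) (simp add: w(4) sval_dens[OF w(3)])
    then show ?thesis by (simp add: sint_dens[OF w(3) that])
  qed
  have slim: "(\<lambda>n. sint (gn n) \<phi>) \<longlonglongrightarrow> sint \<gamma> \<phi>"
    if "C > 0" "\<And>x. \<bar>\<phi> x\<bar> \<le> C" "\<And>x y. \<bar>\<phi> x - \<phi> y\<bar> \<le> C * \<bar>x - y\<bar>" "\<And>x. x \<notin> {a<..<b} \<Longrightarrow> \<phi> x = 0" for \<phi> C
  proof -
    have "(\<lambda>n. sint (gn n) \<phi> - sint \<gamma> \<phi>) \<longlonglongrightarrow> 0"
    proof (rule Lim_null_comparison)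
      show "\<forall>\<^sub>F n in sequentially. norm (sint (gn n) \<phi> - sint \<gamma> \<phi>) \<le> C * flat_dist a b (gn n) \<gamma>"
        using Lipschitz_sint_dist[OF gn(1) \<gamma> that] by simp
      show "(\<lambda>n. C * flat_dist a b (gn n) \<gamma>) \<longlonglongrightarrow> 0" using tendsto_mult[OF tendsto_const gn(2), of C] by simp
    qed
    then show ?thesis by (simp add: LIM_zero_iff)
  qed
  \<comment> \<open>The distribution u' - \<gamma>, which is to be represented by a square
    integrable function.\<close>
  define T where "T = (\<lambda>\<phi>. - ((\<integral>x\<in>{a<..<b}. u x * deriv \<phi> x \<partial>lborel) + sint \<gamma> \<phi>))"
  have Tlim: "(\<lambda>n. \<integral>x\<in>{a<..<b}. h n x * \<phi> x \<partial>lborel) \<longlonglongrightarrow> T \<phi>" if \<phi>: "test_fun a b \<phi>" for \<phi>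
  proof -
    obtain C where C: "C > 0" "\<And>x. \<bar>\<phi> x\<bar> \<le> C" "\<And>x. \<bar>deriv \<phi> x\<bar> \<le> C" "\<And>x y. \<bar>\<phi> x - \<phi> y\<bar> \<le> C * \<bar>x - y\<bar>"
      "\<And>x. x \<notin> {a<..<b} \<Longrightarrow> \<phi> x = 0" "\<phi> \<in> borel_measurable borel" "deriv \<phi> \<in> borel_measurable borel"
      using test_fun_Lipschitz[OF \<phi>] by blast
    have "(\<lambda>n. (\<integral>x\<in>{a<..<b}. un n x * deriv \<phi> x \<partial>lborel) - (\<integral>x\<in>{a<..<b}. u x * deriv \<phi> x \<partial>lborel)) \<longlonglongrightarrow> 0"
    proof (rule Lim_null_comparison)
      show "\<forall>\<^sub>F n in sequentially. norm ((\<integral>x\<in>{a<..<b}. un n x * deriv \<phi> x \<partial>lborel) - (\<integral>x\<in>{a<..<b}. u x * deriv \<phi> x \<partial>lborel))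
          \<le> C * (\<integral>x\<in>{a<..<b}. \<bar>un n x - u x\<bar> \<partial>lborel)"
      proof (rule always_eventually, rule allI)
        fix n
        have i: "set_integrable lborel {a<..<b} (\<lambda>x. un n x * deriv \<phi> x)" "set_integrable lborel {a<..<b} (\<lambda>x. u x * deriv \<phi> x)"
          using L1_mult_bounded[OF _ C(7,3)] u un(1) by (auto simp: L1_def)
        have d: "set_integrable lborel {a<..<b} (\<lambda>x. un n x - u x)" using L1_diff[OF un(1) u] by (simp add: L1_def)
        have "(\<integral>x\<in>{a<..<b}. un n x * deriv \<phi> x \<partial>lborel) - (\<integral>x\<in>{a<..<b}. u x * deriv \<phi> x \<partial>lborel) =
           (\<integral>x\<in>{a<..<b}. un n x * deriv \<phi> x - u x * deriv \<phi> x \<partial>lborel)" using i by simp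
        moreover have "\<bar>\<integral>x\<in>{a<..<b}. un n x * deriv \<phi> x - u x * deriv \<phi> x \<partial>lborel\<bar> \<le>
           (\<integral>x. \<bar>indicator {a<..<b} x *\<^sub>R (un n x * deriv \<phi> x - u x * deriv \<phi> x)\<bar> \<partial>lborel)"
          unfolding set_lebesgue_integral_def by (rule integral_abs_bound)
        moreover have "\<dots> \<le> (\<integral>x\<in>{a<..<b}. C * \<bar>un n x - u x\<bar> \<partial>lborel)"
          unfolding set_lebesgue_integral_def
        proof (rule integral_mono')
          show "integrable lborel (\<lambda>x. indicator {a<..<b} x *\<^sub>R (C * \<bar>un n x - u x\<bar>))"
            using set_integrable_mult_right[OF set_integrable_abs[OF d], of C] unfolding set_integrable_def .
          fix x
          have "\<bar>un n x * deriv \<phi> x - u x * deriv \<phi> x\<bar> = \<bar>un n x - u x\<bar> * \<bar>deriv \<phi> x\<bar>"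
            by (simp add: left_diff_distrib[symmetric] abs_mult)
          also have "\<dots> \<le> C * \<bar>un n x - u x\<bar>" using C(3)[of x] by (simp add: mult.commute mult_right_mono)
          finally show "\<bar>indicator {a<..<b} x *\<^sub>R (un n x * deriv \<phi> x - u x * deriv \<phi> x)\<bar> \<le> indicator {a<..<b} x *\<^sub>R (C * \<bar>un n x - u x\<bar>)"
            by (simp split: split_indicator)
        qed (use C(1) in auto)
        ultimately show "norm ((\<integral>x\<in>{a<..<b}. un n x * deriv \<phi> x \<partial>lborel) - (\<integral>x\<in>{a<..<b}. u x * deriv \<phi> x \<partial>lborel))
          \<le> C * (\<integral>x\<in>{a<..<b}. \<bar>un n x - u x\<bar> \<partial>lborel)" by simp
      qed
      show "(\<lambda>n. C * (\<integral>x\<in>{a<..<b}. \<bar>un n x - u x\<bar> \<partial>lborel)) \<longlonglongrightarrow> 0" using tendsto_mult[OF tendsto_const un(2), of C] by simp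
    qed
    then have ul: "(\<lambda>n. \<integral>x\<in>{a<..<b}. un n x * deriv \<phi> x \<partial>lborel) \<longlonglongrightarrow> (\<integral>x\<in>{a<..<b}. u x * deriv \<phi> x \<partial>lborel)"
      by (simp add: LIM_zero_iff)
    have "(\<integral>x\<in>{a<..<b}. h n x * \<phi> x \<partial>lborel) = - ((\<integral>x\<in>{a<..<b}. un n x * deriv \<phi> x \<partial>lborel) + sint (gn n) \<phi>)" for n
    proof -
      have i: "set_integrable lborel {a<..<b} (\<lambda>x. v n x * \<phi> x)" "set_integrable lborel {a<..<b} (\<lambda>x. g n x * \<phi> x)"
        using L1_mult_bounded[OF _ C(6,2)] vL w(3) by (auto simp: L1_def)
      have "(\<integral>x\<in>{a<..<b}. h n x * \<phi> x \<partial>lborel) = (\<integral>x\<in>{a<..<b}. v n x * \<phi> x \<partial>lborel) - (\<integral>x\<in>{a<..<b}. g n x * \<phi> x \<partial>lborel)"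
        unfolding h_def using i by (simp add: left_diff_distrib)
      moreover have "(\<integral>x\<in>{a<..<b}. un n x * deriv \<phi> x \<partial>lborel) = - (\<integral>x\<in>{a<..<b}. v n x * \<phi> x \<partial>lborel)"
        using w(1)[of n] \<phi> by (simp add: weak_deriv_def)
      ultimately show ?thesis using gint[OF C(6,2), of n] by simp
    qed
    then show ?thesis
      unfolding T_def using tendsto_minus[OF tendsto_add[OF ul slim[OF C(1,2,4,5)]]] by simp
  qed
  have Tbd: "(T \<phi>)\<^sup>2 \<le> A * (\<integral>x\<in>{a<..<b}. (\<phi> x)\<^sup>2 \<partial>lborel)" if \<phi>: "test_fun a b \<phi>" for \<phi>
  proof (rule LIMSEQ_le)
    show "(\<lambda>n. (\<integral>x\<in>{a<..<b}. h (r n) x * \<phi> x \<partial>lborel)\<^sup>2) \<longlonglongrightarrow> (T \<phi>)\<^sup>2"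
      by (intro tendsto_power lim_r Tlim \<phi>)
    show "(\<lambda>n. A' (r n) * (\<integral>x\<in>{a<..<b}. (\<phi> x)\<^sup>2 \<partial>lborel)) \<longlonglongrightarrow> A * (\<integral>x\<in>{a<..<b}. (\<phi> x)\<^sup>2 \<partial>lborel)"
      using A(3) by (intro tendsto_mult tendsto_const) (simp add: o_def)
    obtain C where C: "\<And>x. \<bar>\<phi> x\<bar> \<le> C" using test_fun_bounded[OF \<phi>] by blast
    show "\<exists>N. \<forall>n\<ge>N. (\<integral>x\<in>{a<..<b}. h (r n) x * \<phi> x \<partial>lborel)\<^sup>2 \<le> A' (r n) * (\<integral>x\<in>{a<..<b}. (\<phi> x)\<^sup>2 \<partial>lborel)"
      unfolding A'_def using set_integral_CS[OF hL test_fun_measurable[OF \<phi>] C] by blast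
  qed
  \<comment> \<open>Linearity is inherited from the approximating integrals by uniqueness of
    limits.\<close>
  have Tlin: "T (\<lambda>x. \<phi> x + c * \<psi> x) = T \<phi> + c * T \<psi>" if \<phi>: "test_fun a b \<phi>" and \<psi>: "test_fun a b \<psi>" for \<phi> \<psi> c
  proof (rule LIMSEQ_unique[OF Tlim[OF test_fun_lincomb(1)[OF that]]])
    have i: "set_integrable lborel {a<..<b} (\<lambda>x. h n x * \<phi> x)" if \<phi>: "test_fun a b \<phi>" for n \<phi>
    proof -
      obtain C where C: "\<And>x. \<bar>\<phi> x\<bar> \<le> C" using test_fun_bounded[OF \<phi>] by blast
      from L1_mult_bounded[OF hL(1) test_fun_measurable[OF \<phi>] C] show ?thesis by (simp add: L1_def)
    qed
    have eq: "(\<integral>x\<in>{a<..<b}. h n x * (\<phi> x + c * \<psi> x) \<partial>lborel) = (\<integral>x\<in>{a<..<b}. h n x * \<phi> x \<partial>lborel) + c * (\<integral>x\<in>{a<..<b}. h n x * \<psi> x \<partial>lborel)" for n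
    proof -
      have "(\<integral>x\<in>{a<..<b}. h n x * (\<phi> x + c * \<psi> x) \<partial>lborel) = (\<integral>x\<in>{a<..<b}. h n x * \<phi> x + c * (h n x * \<psi> x) \<partial>lborel)"
        by (intro set_lebesgue_integral_cong) (auto simp: algebra_simps)
      also have "\<dots> = (\<integral>x\<in>{a<..<b}. h n x * \<phi> x \<partial>lborel) + (\<integral>x\<in>{a<..<b}. c * (h n x * \<psi> x) \<partial>lborel)"
        by (intro set_integral_add i \<phi> set_integrable_mult_right impI \<psi>)
      finally show ?thesis by simp
    qed
    show "(\<lambda>n. \<integral>x\<in>{a<..<b}. h n x * (\<phi> x + c * \<psi> x) \<partial>lborel) \<longlonglongrightarrow> T \<phi> + c * T \<psi>"
      unfolding eq by (rule tendsto_add[OF Tlim[OF \<phi>] tendsto_mult[OF tendsto_const Tlim[OF \<psi>]]])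
  qed
  have A0: "0 \<le> A" using A(1) by simp
  obtain hh where hh: "L1 a b hh" "L1 a b (\<lambda>x. (hh x)\<^sup>2)" "(\<integral>\<^sup>+x\<in>{a<..<b}. ennreal ((hh x)\<^sup>2) \<partial>lborel) \<le> ennreal A"
    "\<And>\<phi>. test_fun a b \<phi> \<Longrightarrow> T \<phi> = (\<integral>x\<in>{a<..<b}. hh x * \<phi> x \<partial>lborel)"
    using square_integrable_limit[OF ab A0 Tlin Tbd] by blast
  have cap: "capped \<tau> \<le> ennreal ((B - A) / c0)"
  proof (rule capped_le_partitions[OF ab polarD(2)[OF p]])
    fix I :: "int set" and l s :: "int \<Rightarrow> real"
    assume I: "finite I" "\<And>k. k \<in> I \<Longrightarrow> a \<le> l k \<and> l k < s k \<and> s k \<le> b"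
      "\<And>k k'. k \<in> I \<Longrightarrow> k' \<in> I \<Longrightarrow> k < k' \<Longrightarrow> s k \<le> l k'"
    show "(\<Sum>k\<in>I. min (measure \<tau> {l k<..<s k}) 2) \<le> (B - A) / c0"
    proof (rule field_le_epsilon)
      fix \<zeta> :: real assume \<zeta>: "\<zeta> > 0"
      \<comment> \<open>Each cell may lose \<theta>, and all cells together at most \<zeta>; the
        added 1 keeps \<theta> positive when \<open>I\<close> is empty.\<close>
      define \<theta> where "\<theta> = \<zeta> / (real (card I) + 1)"
      have \<theta>: "\<theta> > 0" "real (card I) * \<theta> \<le> \<zeta>" using \<zeta> by (auto simp: \<theta>_def field_simps)
      have "\<forall>k\<in>I. \<exists>\<phi> C l' r'. C > 0 \<and> l k < l' \<and> l' \<le> r' \<and> r' < s k \<and> (\<forall>x. \<bar>\<phi> x\<bar> \<le> 1) \<and>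
          (\<forall>x y. \<bar>\<phi> x - \<phi> y\<bar> \<le> C * \<bar>x - y\<bar>) \<and> (\<forall>x. x \<notin> {l'..r'} \<longrightarrow> \<phi> x = 0) \<and>
          measure \<tau> {l k<..<s k} - \<theta> \<le> sint \<gamma> \<phi>"
        using Lipschitz_approximation[OF p _ \<theta>(1)] I(2) by blast
      then obtain \<phi> C l' r' where \<phi>: "\<And>k. k \<in> I \<Longrightarrow> C k > 0 \<and> l k < l' k \<and> l' k \<le> r' k \<and> r' k < s k \<and> (\<forall>x. \<bar>\<phi> k x\<bar> \<le> 1) \<and>
          (\<forall>x y. \<bar>\<phi> k x - \<phi> k y\<bar> \<le> C k * \<bar>x - y\<bar>) \<and> (\<forall>x. x \<notin> {l' k..r' k} \<longrightarrow> \<phi> k x = 0) \<and>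
          measure \<tau> {l k<..<s k} - \<theta> \<le> sint \<gamma> (\<phi> k)"
        by metis
      have \<phi>m: "\<phi> k \<in> borel_measurable borel" if "k \<in> I" for k
      proof -
        have "(C k)-lipschitz_on UNIV (\<phi> k)" using \<phi>[OF that] by (intro lipschitz_onI) (auto simp: dist_real_def)
        then show ?thesis by (intro borel_measurable_continuous_onI lipschitz_on_continuous_on)
      qed
      have \<phi>lim: "(\<lambda>n. \<integral>x\<in>{a<..<b}. g n x * \<phi> k x \<partial>lborel) \<longlonglongrightarrow> sint \<gamma> (\<phi> k)" if k: "k \<in> I" for k
      proof -
        have "(\<lambda>n. sint (gn n) (\<phi> k)) \<longlonglongrightarrow> sint \<gamma> (\<phi> k)"
        \<comment> \<open>One constant has to bound both the values and the slopes of the test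
          function.\<close>
        proof (rule slim[of "max (C k) 1"])
          fix x y
          show "\<bar>\<phi> k x\<bar> \<le> max (C k) 1" using \<phi>[OF k] by (auto simp: le_max_iff_disj)
          have "\<bar>\<phi> k x - \<phi> k y\<bar> \<le> C k * \<bar>x - y\<bar>" using \<phi>[OF k] by blast
          also have "\<dots> \<le> max (C k) 1 * \<bar>x - y\<bar>" by (intro mult_right_mono) auto
          finally show "\<bar>\<phi> k x - \<phi> k y\<bar> \<le> max (C k) 1 * \<bar>x - y\<bar>" .
        next
          fix x assume "x \<notin> {a<..<b}"
          then have "x \<notin> {l' k..r' k}" using \<phi>[OF k] I(2)[OF k] by auto
          then show "\<phi> k x = 0" using \<phi>[OF k] by blast
        qed auto
        then show ?thesis using gint[OF \<phi>m[OF k], of 1] \<phi>[OF k] by simp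
      qed
      have small: "\<forall>\<^sub>F n in sequentially. 2 * e n < d" if "d > 0" for d
      proof -
        have "(\<lambda>n. 2 * e n) \<longlonglongrightarrow> 2 * 0" by (intro tendsto_mult tendsto_const e(2))
        then show ?thesis using order_tendstoD(2)[of _ 0 sequentially d] that by simp
      qed
      \<comment> \<open>The supports are compactly contained in disjoint cells, so for small
        \<open>e n\<close> they keep the distances from each other and from the endpoints that
        \<open>nonlocal_energy_ge\<close> asks for.\<close>
      have ev1: "\<forall>\<^sub>F n in sequentially. \<forall>k\<in>I. a + 2 * e n < l' k \<and> r' k < b - 2 * e n"
      proof (rule eventually_ball_finite[OF I(1)], rule ballI)
        fix k assume k: "k \<in> I"
        have "l' k - a > 0" "b - r' k > 0" using \<phi>[OF k] I(2)[OF k] by auto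
        from small[OF this(1)] small[OF this(2)] show "\<forall>\<^sub>F n in sequentially. a + 2 * e n < l' k \<and> r' k < b - 2 * e n"
          by eventually_elim auto
      qed
      have gap: "r' k < l' k'" if "k \<in> I" "k' \<in> I" "k < k'" for k k'
        using \<phi>[OF that(1)] \<phi>[OF that(2)] I(3)[OF that] by auto
      have ev2: "\<forall>\<^sub>F n in sequentially. \<forall>k\<in>I. \<forall>k'\<in>I. k < k' \<longrightarrow> r' k + 2 * e n < l' k'"
      proof (intro eventually_ball_finite[OF I(1)] ballI)
        fix k k' assume k: "k \<in> I" "k' \<in> I"
        show "\<forall>\<^sub>F n in sequentially. k < k' \<longrightarrow> r' k + 2 * e n < l' k'"
        proof (cases "k < k'")
          case True
          then have "l' k' - r' k > 0" using gap[OF k] by simp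
          from small[OF this] show ?thesis by eventually_elim auto
        qed simp
      qed
      have "\<forall>\<^sub>F n in sequentially. (\<Sum>k\<in>I. c0 * min \<bar>\<integral>x\<in>{a<..<b}. g n x * \<phi> k x \<partial>lborel\<bar> 2) \<le> B - A' n"
        using ev1 ev2
      proof eventually_elim
        case (elim n)
        have "ennreal (\<Sum>k\<in>I. c0 * min \<bar>\<integral>x\<in>{a<..<b}. g n x * \<phi> k x \<partial>lborel\<bar> 2) \<le> ?F n (g n)"
        proof (rule nonlocal_energy_ge[OF _ e(1) w(3) I(1) \<phi>m, where l = l' and r = r'])
          fix k k' assume k: "k \<in> I" "k' \<in> I" "k \<noteq> k'"
          then show "r' k + 2 * e n < l' k' \<or> r' k' + 2 * e n < l' k"
            using elim(2) by (metis linorder_neqE)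
        qed (use elim \<phi> c0 in auto)
        also have "\<dots> \<le> ennreal (B - A' n)" using wB[of n] by simp
        finally show ?case using wB[of n] by (simp add: ennreal_le_iff)
      qed
      then have evr: "\<forall>\<^sub>F n in sequentially. (\<Sum>k\<in>I. c0 * min \<bar>\<integral>x\<in>{a<..<b}. g (r n) x * \<phi> k x \<partial>lborel\<bar> 2) \<le> B - A' (r n)"
        by (rule eventually_subseq[OF A(2)])
      \<comment> \<open>Truncation and absolute value are continuous, so the finite sum passes to
        the limit together with \<open>A'\<close>.\<close>
      have "(\<Sum>k\<in>I. c0 * min \<bar>sint \<gamma> (\<phi> k)\<bar> 2) \<le> B - A"
      proof (rule tendsto_le[OF _ _ _ evr])
        show "(\<lambda>n. B - A' (r n)) \<longlonglongrightarrow> B - A" using A(3) by (intro tendsto_diff tendsto_const) (simp add: o_def)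
        show "(\<lambda>n. \<Sum>k\<in>I. c0 * min \<bar>\<integral>x\<in>{a<..<b}. g (r n) x * \<phi> k x \<partial>lborel\<bar> 2) \<longlonglongrightarrow> (\<Sum>k\<in>I. c0 * min \<bar>sint \<gamma> (\<phi> k)\<bar> 2)"
          by (intro tendsto_sum tendsto_mult tendsto_const tendsto_min tendsto_rabs lim_r \<phi>lim)
      qed simp
      then have "(\<Sum>k\<in>I. min \<bar>sint \<gamma> (\<phi> k)\<bar> 2) \<le> (B - A) / c0"
        using c0 by (simp add: sum_distrib_left[symmetric] pos_le_divide_eq mult.commute)
      moreover have "(\<Sum>k\<in>I. min (measure \<tau> {l k<..<s k}) 2) \<le> (\<Sum>k\<in>I. min \<bar>sint \<gamma> (\<phi> k)\<bar> 2 + \<theta>)"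
      proof (rule sum_mono)
        fix k assume k: "k \<in> I"
        have "measure \<tau> {l k<..<s k} - \<theta> \<le> \<bar>sint \<gamma> (\<phi> k)\<bar>" using \<phi>[OF k] by (meson abs_ge_self order_trans)
        then show "min (measure \<tau> {l k<..<s k}) 2 \<le> min \<bar>sint \<gamma> (\<phi> k)\<bar> 2 + \<theta>" using \<theta>(1) by linarith
      qed
      ultimately show "(\<Sum>k\<in>I. min (measure \<tau> {l k<..<s k}) 2) \<le> (B - A) / c0 + \<zeta>"
        using \<theta>(2) by (simp add: sum.distrib)
    qed
  qed
  have "Elim a b K c0 u \<gamma> \<le> (\<integral>\<^sup>+x\<in>{a<..<b}. ennreal ((hh x)\<^sup>2) \<partial>lborel) + ennreal c0 * capped \<tau>"
  proof (rule Elim_le[OF ab _ p u _ hh(1,2)])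
    show "ess_bdd a b K u" by (rule ess_bdd_L1_limit[OF u un(1) w(2) un(2)])
    fix \<phi> assume \<phi>: "test_fun a b \<phi>"
    show "(\<integral>x\<in>{a<..<b}. u x * deriv \<phi> x \<partial>lborel) = - (sint \<gamma> \<phi> + (\<integral>x\<in>{a<..<b}. hh x * \<phi> x \<partial>lborel))"
      using hh(4)[OF \<phi>] unfolding T_def by linarith
  qed (use c0 in simp)
  also have "\<dots> \<le> ennreal A + ennreal c0 * ennreal ((B - A) / c0)"
    by (intro add_mono mult_left_mono hh(3) cap) auto
  also have "\<dots> = ennreal B"
    using c0 A(1) by (simp add: ennreal_mult[symmetric] ennreal_plus[symmetric] del: ennreal_plus)
  finally show ?thesis .
qed

theorem mainTheorem1:
  fixes a b c0 K :: real
  assumes "a < b" and "c0 > 0" and "K > 0"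
  shows "(\<forall>u \<gamma> (ue :: real \<Rightarrow> real \<Rightarrow> real) (ge :: real \<Rightarrow> smeasure).
            L1 a b u \<and> smeas a b \<gamma> \<and> (\<forall>\<epsilon>>0. L1 a b (ue \<epsilon>) \<and> smeas a b (ge \<epsilon>)) \<and>
            ((\<lambda>\<epsilon>. \<integral>x\<in>{a<..<b}. \<bar>ue \<epsilon> x - u x\<bar> \<partial>lborel) \<longlongrightarrow> 0) (at_right 0) \<and>
            ((\<lambda>\<epsilon>. flat_dist a b (ge \<epsilon>) \<gamma>) \<longlongrightarrow> 0) (at_right 0)
            \<longrightarrow> Elim a b K c0 u \<gamma> \<le> Liminf (at_right 0) (\<lambda>\<epsilon>. Eeps a b K c0 \<epsilon> (ue \<epsilon>) (ge \<epsilon>)))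
       \<and> (\<forall>u \<gamma>. L1 a b u \<and> smeas a b \<gamma> \<longrightarrow>
            (\<exists>(ue :: real \<Rightarrow> real \<Rightarrow> real) (ge :: real \<Rightarrow> smeasure).
              (\<forall>\<epsilon>>0. L1 a b (ue \<epsilon>) \<and> smeas a b (ge \<epsilon>)) \<and>
              ((\<lambda>\<epsilon>. \<integral>x\<in>{a<..<b}. \<bar>ue \<epsilon> x - u x\<bar> \<partial>lborel) \<longlongrightarrow> 0) (at_right 0) \<and>
              ((\<lambda>\<epsilon>. flat_dist a b (ge \<epsilon>) \<gamma>) \<longlongrightarrow> 0) (at_right 0) \<and>
              Limsup (at_right 0) (\<lambda>\<epsilon>. Eeps a b K c0 \<epsilon> (ue \<epsilon>) (ge \<epsilon>)) \<le> Elim a b K c0 u \<gamma>))"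
proof (rule conjI)
  show "\<forall>u \<gamma> (ue :: real \<Rightarrow> real \<Rightarrow> real) (ge :: real \<Rightarrow> smeasure).
            L1 a b u \<and> smeas a b \<gamma> \<and> (\<forall>\<epsilon>>0. L1 a b (ue \<epsilon>) \<and> smeas a b (ge \<epsilon>)) \<and>
            ((\<lambda>\<epsilon>. \<integral>x\<in>{a<..<b}. \<bar>ue \<epsilon> x - u x\<bar> \<partial>lborel) \<longlongrightarrow> 0) (at_right 0) \<and>
            ((\<lambda>\<epsilon>. flat_dist a b (ge \<epsilon>) \<gamma>) \<longlongrightarrow> 0) (at_right 0)
            \<longrightarrow> Elim a b K c0 u \<gamma> \<le> Liminf (at_right 0) (\<lambda>\<epsilon>. Eeps a b K c0 \<epsilon> (ue \<epsilon>) (ge \<epsilon>))"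
  proof (intro allI impI, elim conjE)
    fix u \<gamma> and ue :: "real \<Rightarrow> real \<Rightarrow> real" and ge :: "real \<Rightarrow> smeasure"
    assume u: "L1 a b u" and \<gamma>: "smeas a b \<gamma>" and L: "\<forall>\<epsilon>>0. L1 a b (ue \<epsilon>) \<and> smeas a b (ge \<epsilon>)"
      and lu: "((\<lambda>\<epsilon>. \<integral>x\<in>{a<..<b}. \<bar>ue \<epsilon> x - u x\<bar> \<partial>lborel) \<longlongrightarrow> 0) (at_right 0)"
      and lg: "((\<lambda>\<epsilon>. flat_dist a b (ge \<epsilon>) \<gamma>) \<longlongrightarrow> 0) (at_right 0)"
    let ?X = "\<lambda>\<epsilon>. Eeps a b K c0 \<epsilon> (ue \<epsilon>) (ge \<epsilon>)"
    show "Elim a b K c0 u \<gamma> \<le> Liminf (at_right 0) ?X"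
    proof (rule ccontr)
      assume "\<not> ?thesis"
      \<comment> \<open>A value strictly below the limit energy is finite, hence a real bound of the
        kind \<open>liminf_sequence\<close> expects.\<close>
      then obtain B' where B': "Liminf (at_right 0) ?X < B'" "B' < Elim a b K c0 u \<gamma>"
        using dense[of "Liminf (at_right 0) ?X"] by (auto simp: not_le)
      obtain B where B: "B' = ennreal B" using B'(2) by (cases B') auto
      \<comment> \<open>A lower limit below \<open>B'\<close> gives arbitrarily small \<epsilon>
        with energy below \<open>B'\<close>; a sequence of these contradicts
        \<open>liminf_sequence\<close>.\<close>
      have "\<not> (\<forall>\<^sub>F \<epsilon> in at_right 0. B' \<le> ?X \<epsilon>)" using B'(1) Liminf_bounded[of B' ?X "at_right 0"] by (meson not_le)
      then have "\<exists>\<epsilon>. 0 < \<epsilon> \<and> \<epsilon> < 1 / Suc n \<and> ?X \<epsilon> < B'" for n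
        unfolding eventually_at_right_field by (metis not_le of_nat_0_less_iff zero_less_Suc zero_less_divide_1_iff)
      then obtain e where e: "\<And>n. 0 < e n" "\<And>n. e n < 1 / Suc n" "\<And>n. ?X (e n) < B'" by metis
      have e0: "e \<longlonglongrightarrow> 0"
      proof (rule tendsto_sandwich[OF _ _ tendsto_const LIMSEQ_inverse_real_of_nat])
        show "\<forall>\<^sub>F n in sequentially. 0 \<le> e n" by (intro always_eventually allI less_imp_le e(1))
        show "\<forall>\<^sub>F n in sequentially. e n \<le> inverse (real (Suc n))"
          unfolding inverse_eq_divide by (intro always_eventually allI less_imp_le e(2))
      qed
      have fl: "filterlim e (at_right 0) sequentially"
        unfolding filterlim_at using e(1) e0 by (auto intro!: always_eventually simp: less_imp_neq[symmetric] less_imp_neq[THEN not_sym])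
      have "Elim a b K c0 u \<gamma> \<le> ennreal B"
      proof (rule liminf_sequence[OF assms(1,2) u \<gamma> e(1) e0])
        show "(\<lambda>n. \<integral>x\<in>{a<..<b}. \<bar>ue (e n) x - u x\<bar> \<partial>lborel) \<longlonglongrightarrow> 0" by (rule filterlim_compose[OF lu fl])
        show "(\<lambda>n. flat_dist a b (ge (e n)) \<gamma>) \<longlonglongrightarrow> 0" by (rule filterlim_compose[OF lg fl])
      qed (use L e(1,3) B in auto)
      then show False using B'(2) B by simp
    qed
  qed
  show "\<forall>u \<gamma>. L1 a b u \<and> smeas a b \<gamma> \<longrightarrow>
            (\<exists>(ue :: real \<Rightarrow> real \<Rightarrow> real) (ge :: real \<Rightarrow> smeasure).
              (\<forall>\<epsilon>>0. L1 a b (ue \<epsilon>) \<and> smeas a b (ge \<epsilon>)) \<and>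
              ((\<lambda>\<epsilon>. \<integral>x\<in>{a<..<b}. \<bar>ue \<epsilon> x - u x\<bar> \<partial>lborel) \<longlongrightarrow> 0) (at_right 0) \<and>
              ((\<lambda>\<epsilon>. flat_dist a b (ge \<epsilon>) \<gamma>) \<longlongrightarrow> 0) (at_right 0) \<and>
              Limsup (at_right 0) (\<lambda>\<epsilon>. Eeps a b K c0 \<epsilon> (ue \<epsilon>) (ge \<epsilon>)) \<le> Elim a b K c0 u \<gamma>)"
    using limsup_inequality[OF assms] by blast
qed

end
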